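(* Under $P_n$, the random variable $s_n^{\frac{r(r+1)}{2}}N$ converges in distribution as $n\to\infty$ to the unique (in law) real random variable whose moment generating function equals $M(u)$ for $-1<u<1$.
   Context: Throughout $r\ge 2$ is a fixed integer and $\mathbb{N}=\{1,2,\dots\}$, $\mathbb{N}_0=\mathbb{N}\cup\{0\}$. For $\mathbf{y}\in\mathbb{R}^r_{\ge0}$ put $$a(\mathbf{y}):=\frac{1}{c_r}\prod_{1\le\ell\le j\le r}(y_\ell+\dots+y_j),\qquad c_r:=r!\,(r-1)!\cdots1!.$$ Finite-dimensional irreducible representations $\rho_{\mathbf{k}}$ of $\mathfrak{sl}_{r+1}(\mathbb{C})$ are indexed (up to isomorphism) by $\mathbf{k}\in\mathbb{N}^r$, with $\dim\rho_{\mathbf{k}}=a(\mathbf{k})$. A finite-dimensional representation $\rho$ (up to isomorphism) is $\rho=\bigoplus_{\mathbf{k}\in\mathbb{N}^r}\rho_{\mathbf{k}}^{X_{\mathbf{k}}(\rho)}$ with multiplicities $X_{\mathbf{k}}(\rho)\in\mathbb{N}_0$, all but finitely many zero, and $\dim\rho=\sum_{\mathbf{k}}a(\mathbf{k})X_{\mathbf{k}}(\rho)$. $P_n$ is the uniform probability measure on the (finite) set of $n$-dimensional representations up to isomorphism. $N:=\sum_{\mathbf{k}\in\mathbb{N}^r}X_{\mathbf{k}}$ is the total number of irreducible representations in the decomposition, and $$M(z):=\prod_{\mathbf{k}\in\mathbb{N}^r}\left(1-\frac{z}{a(\mathbf{k})}\right)^{-1}.$$ The moment generating function of a real random variable $X$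 is $u\mapsto \mathrm{E}(e^{uX})$. For $n\in\mathbb{N}$, $q_n\in(0,1)$ is the unique solution $q$ of $\sum_{\mathbf{k}\in\mathbb{N}^r}\frac{a(\mathbf{k})q^{a(\mathbf{k})}}{1-q^{a(\mathbf{k})}}=n$, and $s_n>0$ is defined by $q_n=\exp\big(-s_n^{r(r+1)/2}\big)$. *)

theory Defs
  imports "HOL-Probability.Probability" "HOL-Library.Multiset"
begin

text \<open>
  Vectors with \<open>r\<close> components are functions on indices \<open>1, ..., r\<close>; on \<open>\<nat>\<^sup>r\<close> they are made
  extensional (\<open>undefined\<close> outside \<open>{1..r}\<close>), so that distinct functions are distinct vectors.
\<close>

definition weights :: "nat \<Rightarrow> (nat \<Rightarrow> nat) set" where
  "weights r = ({1..r} \<rightarrow>\<^sub>E {1..})"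

definition c_const :: "nat \<Rightarrow> real" where
  "c_const r = (\<Prod>i=1..r. fact i)"

definition weyl :: "nat \<Rightarrow> (nat \<Rightarrow> real) \<Rightarrow> real" where
  "weyl r y = (\<Prod>l=1..r. \<Prod>j=l..r. \<Sum>i=l..j. y i) / c_const r"

abbreviation irr_dim :: "nat \<Rightarrow> (nat \<Rightarrow> nat) \<Rightarrow> real" where
  "irr_dim r k \<equiv> weyl r (\<lambda>i. real (k i))"

text \<open>
  An isomorphism class of finite-dimensional representations of \<open>sl\<^sub>r\<^sub>+\<^sub>1(\<complex>)\<close> is its finitely
  supported family of multiplicities \<open>X\<^sub>k\<close>, i.e. a finite multiset \<open>\<rho>\<close> of elements of \<open>\<nat>\<^sup>r\<close>
  with \<open>X\<^sub>k(\<rho>) = count \<rho> k\<close>.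
\<close>

definition rep_dim :: "nat \<Rightarrow> (nat \<Rightarrow> nat) multiset \<Rightarrow> real" where
  "rep_dim r \<rho> = (\<Sum>k\<in>set_mset \<rho>. irr_dim r k * real (count \<rho> k))"

definition reps :: "nat \<Rightarrow> nat \<Rightarrow> (nat \<Rightarrow> nat) multiset set" where
  "reps r n = {\<rho>. set_mset \<rho> \<subseteq> weights r \<and> rep_dim r \<rho> = real n}"

definition P :: "nat \<Rightarrow> nat \<Rightarrow> (nat \<Rightarrow> nat) multiset measure" where
  "P r n = measure_pmf (pmf_of_set (reps r n))"

definition N_irr :: "(nat \<Rightarrow> nat) multiset \<Rightarrow> nat" where
  "N_irr \<rho> = (\<Sum>k\<in>set_mset \<rho>. count \<rho> k)"

definition q_seq :: "nat \<Rightarrow> nat \<Rightarrow> real" where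
  "q_seq r n = (THE q. 0 < q \<and> q < 1 \<and>
     ((\<lambda>k. irr_dim r k * q powr irr_dim r k / (1 - q powr irr_dim r k)) has_sum real n)
       (weights r))"

definition s_seq :: "nat \<Rightarrow> nat \<Rightarrow> real" where
  "s_seq r n = (THE s. 0 < s \<and> q_seq r n = exp (- (s ^ (r * (r + 1) div 2))))"

text \<open>
  The product over the countable set \<open>\<nat>\<^sup>r\<close> is the unordered one: the limit of the finite partial
  products along the finite subsets of \<open>\<nat>\<^sup>r\<close>. Only real arguments in \<open>(-1, 1)\<close> are used.
\<close>

definition M_fun :: "nat \<Rightarrow> real \<Rightarrow> real" where
  "M_fun r z = Lim (finite_subsets_at_top (weights r))
     (\<lambda>F. \<Prod>k\<in>F. inverse (1 - z / irr_dim r k))"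

text \<open>Finiteness of the expectation \<open>E(exp (u X))\<close> is part of \<open>has_bochner_integral\<close>.\<close>

definition has_mgf_on :: "real measure \<Rightarrow> (real \<Rightarrow> real) \<Rightarrow> real set \<Rightarrow> bool" where
  "has_mgf_on \<mu> f S \<longleftrightarrow> (\<forall>u\<in>S. has_bochner_integral \<mu> (\<lambda>x. exp (u * x)) (f u))"

end

theory Submission imports Defs "HOL-Complex_Analysis.Complex_Analysis" begin

text \<open>
  Put \<open>t = s\<^sub>n\<^bsup>r (r + 1) / 2\<^esup>\<close>, so that \<open>q\<^sub>n = exp (- t)\<close>. Let the multiplicities \<open>X\<^sub>k\<close> be independent
  and geometric with ratios \<open>exp (- t a(k))\<close>. In this model all representations of equal dimension are
  equally likely, so \<open>P\<^sub>n\<close> is the model conditioned on total dimension \<open>n\<close>; the choice of \<open>t\<close> makes \<open>n\<close> the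
  expected dimension. Without the conditioning the limit is clear: \<open>t X\<^sub>k\<close> is close to an exponential
  variable of mean \<open>1 / a(k)\<close>, and as \<open>\<Sum> 1 / a(k)\<close> converges, which needs \<open>r \<ge> 2\<close>, \<open>t N\<close> is close to
  \<open>\<Sum> E\<^sub>k / a(k)\<close> with independent standard exponential \<open>E\<^sub>k\<close>. The moment generating function of this series
  is \<open>M\<close> (\<open>exponential_series_law\<close>).

  The conditioning does not change the limit, because \<open>N\<close> is governed by the few representations of small
  dimension, with multiplicities of order \<open>1 / t\<close>, whereas the fluctuations of the dimension come from
  the many representations of dimension up to about \<open>1 / t\<close>. Precisely, \<open>coefficient_integral\<close> writes the
  characteristic function of \<open>t N\<close> under \<open>P\<^sub>n\<close> as the quotient of two integrals over \<open>\<theta> \<in> [-pi, pi]\<close>, for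
  \<open>u\<close> and for 0, of \<open>char_fn u \<theta> * cis (- n \<theta>)\<close>, where \<open>char_fn\<close> is the joint characteristic function
  of \<open>t N\<close> and the dimension in the independent model. The integrals are concentrated on \<open>\<theta>\<close> of order
  \<open>1 / sd\<close>, where \<open>sd\<close> is the standard deviation of the dimension, and \<open>sd * t\<close> tends to infinity. For
  such \<open>\<theta>\<close> the function splits asymptotically into \<open>M (\<i> u)\<close> and a Gaussian (\<open>char_fn_twist_split\<close>,
  \<open>char_fn_gaussian_limit\<close>). For \<open>\<bar>\<theta>\<bar>\<close> up to a multiple of \<open>t\<close> it has a Gaussian majorant
  (\<open>norm_char_fn_inner\<close>). Beyond that it is negligible: up to \<open>sqrt t\<close> because there are many small
  dimensions (\<open>norm_char_fn_middle\<close>), and further out because the dimensions do not cluster at the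
  multiples of one number (\<open>norm_char_fn_outer\<close>). Hence the quotient tends to
  \<open>M (\<i> u)\<close>, and Levy's continuity theorem applies.

  No asymptotic count of the irreducible representations enters. All moments are compared with the sum
  \<open>exp_sum t = \<Sum> exp (- t a(k))\<close>, and they are comparable with each other by the doubling property
  \<open>exp_sum (t / 2) = O (exp_sum t)\<close>, which follows from the map \<open>k \<mapsto> \<lceil>k / 2\<rceil>\<close>. The analytic part is
  formulated for integer families \<open>a\<close> with this property, with \<open>\<Sum> 1 / a(k)\<close> finite, with polynomially many
  small members, and with an aperiodicity that controls \<open>\<theta>\<close> of constant order (locale \<open>part_system\<close>).
  For \<open>sl\<^bsub>r+1\<^esub>\<close> the last two come from \<open>k = (1, \<dots>, 1, j)\<close>, where \<open>a(k)\<close> is a binomial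
  coefficient whose \<open>r\<close>-th differences are 1. That the Weyl formula yields integers is proved by comparing
  multiplicities of primes.

  The limit law is determined by \<open>M\<close> on \<open>(-1, 1)\<close>: the transform \<open>z \<mapsto> E exp (z X)\<close> is holomorphic on
  \<open>\<bar>Re z\<bar> < 1\<close>, so its values on the real interval fix those on the imaginary axis.
\<close>

section \<open>Integrality of the Weyl dimension formula\<close>

text \<open>
  Ordered pairs of points that are congruent modulo \<open>d\<close> are fewest when the points are spread
  evenly over the residue classes, as consecutive integers are; their number is the left-hand
  side. The induction removes a point of a largest class: by the pigeonhole principle it has at
  least \<open>n div d\<close> partners, and it forms two ordered pairs with each of them and one with itself.
\<close>

lemma pairs_congruent_lower_bound:
  fixes x :: "'a \<Rightarrow> int" and d :: nat
  assumes "finite S" "d > 0"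
  shows "2 * (\<Sum>m<card S. m div d) + card S \<le> card {(i, j) \<in> S \<times> S. int d dvd x j - x i}"
  using assms(1)
proof (induction "card S" arbitrary: S)
  case 0
  then show ?case by simp
next
  case (Suc n)
  let ?f = "\<lambda>i. nat (x i mod int d)"
  have fS: "?f \<in> S \<rightarrow> {..<d}"
    using assms(2) by (auto simp: nat_less_iff)
  have "S \<noteq> {}" using Suc(2) by auto
  \<comment> \<open>Otherwise the \<open>d\<close> classes would hold at most \<open>d * (n div d) \<le> n\<close> of the \<open>n + 1\<close> indices.\<close>
  have "\<exists>i\<in>S. n div d < card {j\<in>S. ?f j = ?f i}"
  proof (rule ccontr)
    assume "\<not> ?thesis"
    hence le: "card {j\<in>S. ?f j = ?f i} \<le> n div d" if "i \<in> S" for i using that by auto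
    have le': "card {j\<in>S. ?f j = c} \<le> n div d" for c
    proof (cases "\<exists>i\<in>S. ?f i = c")
      case True then show ?thesis using le by auto
    next
      case False
      hence "{j\<in>S. ?f j = c} = {}" by auto
      then show ?thesis by (simp only: card.empty le0)
    qed
    have "S = (\<Union>c<d. {j\<in>S. ?f j = c})" using fS by (auto simp: Pi_iff)
    hence "card S = card (\<Union>c<d. {j\<in>S. ?f j = c})" by simp
    also have "\<dots> \<le> (\<Sum>c<d. card {j\<in>S. ?f j = c})" by (rule card_UN_le) auto
    also have "\<dots> \<le> (\<Sum>c<d. n div d)" by (intro sum_mono le')
    also have "\<dots> \<le> n" by simp
    finally show False using Suc(2) by simp
  qed
  then obtain i where i: "i \<in> S" "n div d < card {j\<in>S. ?f j = ?f i}" by blast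
  have eqv: "?f j = ?f k \<longleftrightarrow> int d dvd x k - x j" for j k
    using assms(2) by (simp add: mod_eq_dvd_iff eq_commute[of "x j mod _"] nat_eq_iff2)
  define C where "C = {j\<in>S. ?f j = ?f i} - {i}"
  have "{j\<in>S. ?f j = ?f i} = insert i C" "finite C" "i \<notin> C"
    using i(1) Suc.prems by (auto simp: C_def)
  hence C: "n div d \<le> card C" "finite C" "i \<notin> C" using i(2) by auto
  let ?Q = "\<lambda>S. {(i, j) \<in> S \<times> S. int d dvd x j - x i}"
  have sub: "?Q (S - {i}) \<union> ((\<lambda>j. (i, j)) ` C \<union> (\<lambda>j. (j, i)) ` C \<union> {(i, i)}) \<subseteq> ?Q S"
    using i(1) eqv by (auto simp: C_def) (metis eqv)+
  have fin: "finite (?Q S)" by (rule finite_subset[of _ "S \<times> S"]) (use Suc.prems in auto)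
  have c2: "card ((\<lambda>j. (i, j)) ` C \<union> (\<lambda>j. (j, i)) ` C \<union> {(i, i)}) = 2 * card C + 1"
  proof -
    have "card ((\<lambda>j. (i, j)) ` C) = card C" "card ((\<lambda>j. (j, i)) ` C) = card C"
      by (auto intro!: card_image simp: inj_on_def)
    moreover have "card ((\<lambda>j. (i, j)) ` C \<union> (\<lambda>j. (j, i)) ` C) = card ((\<lambda>j. (i, j)) ` C) + card ((\<lambda>j. (j, i)) ` C)"
      by (rule card_Un_disjoint) (use C in auto)
    moreover have "card (((\<lambda>j. (i, j)) ` C \<union> (\<lambda>j. (j, i)) ` C) \<union> {(i, i)})
       = card ((\<lambda>j. (i, j)) ` C \<union> (\<lambda>j. (j, i)) ` C) + card {(i,i)}"
      by (rule card_Un_disjoint) (use C in auto)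
    ultimately show ?thesis by simp
  qed
  have n: "n = card (S - {i})" using Suc(2) i(1) Suc.prems by (simp add: card_Diff_singleton)
  have IH: "2 * (\<Sum>m<n. m div d) + n \<le> card (?Q (S - {i}))"
    using Suc(1)[OF n] Suc.prems n by simp
  have "card (?Q (S - {i}) \<union> ((\<lambda>j. (i, j)) ` C \<union> (\<lambda>j. (j, i)) ` C \<union> {(i, i)}))
     = card (?Q (S - {i})) + card ((\<lambda>j. (i, j)) ` C \<union> (\<lambda>j. (j, i)) ` C \<union> {(i, i)})"
  proof (rule card_Un_disjoint)
    show "finite (?Q (S - {i}))" by (rule finite_subset[OF _ fin]) auto
  qed (use C in auto)
  with card_mono[OF fin sub] c2 IH C(1)
  have "2 * (\<Sum>m<n. m div d) + n + (2 * (n div d) + 1) \<le> card (?Q S)" by linarith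
  then show ?case using Suc(2)[symmetric] by simp
qed

text \<open>
  Passing from ordered pairs to \<open>i < j\<close> halves the count after the diagonal is removed, which
  contributes the summand \<open>card S\<close> of the previous bound.
\<close>

lemma pairs_less_congruent_lower_bound:
  fixes x :: "nat \<Rightarrow> int" and d :: nat
  assumes "d > 0"
  shows "(\<Sum>m\<le>r. m div d) \<le> card {(i, j). i < j \<and> j \<le> r \<and> int d dvd x j - x i}"
proof -
  let ?L = "{(i, j). i < j \<and> j \<le> r \<and> int d dvd x j - x i}"
  let ?G = "(\<lambda>(i, j). (j, i)) ` ?L"
  let ?E = "(\<lambda>i. (i, i)) ` {..r}"
  have fin: "finite ?L" by (rule finite_subset[of _ "{..r} \<times> {..r}"]) auto
  have "{(i, j) \<in> {..r} \<times> {..r}. int d dvd x j - x i} \<subseteq> ?L \<union> ?G \<union> ?E"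
  proof (clarify, goal_cases)
    case (1 i j)
    then show ?case
      by (cases i j rule: linorder_cases) (auto simp: image_iff dvd_diff_commute)
  qed
  hence "card {(i, j) \<in> {..r} \<times> {..r}. int d dvd x j - x i} \<le> card (?L \<union> ?G \<union> ?E)"
    by (intro card_mono) (use fin in auto)
  also have "\<dots> \<le> card ?L + card ?G + card ?E"
    by (meson add_mono card_Un_le le_refl order_trans)
  also have "card ?G \<le> card ?L" by (rule card_image_le[OF fin])
  also have "card ?E \<le> card {..r}" by (rule card_image_le) simp
  finally have "card {(i, j) \<in> {..r} \<times> {..r}. int d dvd x j - x i} \<le> 2 * card ?L + Suc r" by simp
  with pairs_congruent_lower_bound[of "{..r}" d x] assms show ?thesis
    by (simp add: lessThan_Suc_atMost)
qed

lemma multiplicity_eq_sum_dvd: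
  fixes p s :: nat
  assumes "prime p" "s > 0" "s \<le> E"
  shows "multiplicity p s = (\<Sum>e=1..E. if p ^ e dvd s then 1 else 0)"
proof -
  have p: "p > 1" using assms(1) prime_gt_1_nat by blast
  have "multiplicity p s < p ^ multiplicity p s" using power_gt_expt[of p "multiplicity p s"] p by simp
  also have "\<dots> \<le> s" using assms(2) by (intro dvd_imp_le multiplicity_dvd) auto
  finally have "multiplicity p s \<le> E" using assms(3) by simp
  moreover have "p ^ e dvd s \<longleftrightarrow> e \<le> multiplicity p s" for e
    using assms p by (intro power_dvd_iff_le_multiplicity) auto
  ultimately have "{e\<in>{1..E}. p ^ e dvd s} = {1..multiplicity p s}"
    by (simp only: set_eq_iff mem_Collect_eq atLeastAtMost_iff) linarith
  moreover have "(\<Sum>e=1..E. if p ^ e dvd s then 1 else 0) = card {e\<in>{1..E}. p ^ e dvd s}"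
    by (simp add: sum.If_cases Int_def)
  ultimately show ?thesis by simp
qed

lemma sum_indicator_dvd: "(d::nat) > 0 \<Longrightarrow> (\<Sum>i=1..m. if d dvd i then 1 else 0) = m div d"
proof (induction m)
  case (Suc m)
  then show ?case by (auto simp: div_Suc dvd_eq_mod_eq_0)
qed simp

text \<open>
  With the partial sums \<open>x\<^sub>j = k\<^sub>1 + \<dots> + k\<^sub>j\<close> the factors on the right are the differences
  \<open>x\<^sub>j - x\<^sub>i\<close>, \<open>i < j\<close>. For a prime \<open>p\<close> the multiplicity of \<open>p\<close> in either side is a sum over \<open>e\<close>
  of the number of factors divisible by \<open>p\<^sup>e\<close>. On the left that number is the sum of
  \<open>m div p\<^sup>e\<close> over \<open>m \<le> r\<close>, the minimum found above.
\<close>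

lemma superfactorial_dvd_interval_sums:
  fixes k :: "nat \<Rightarrow> nat"
  assumes k: "\<And>i. 1 \<le> i \<Longrightarrow> i \<le> r \<Longrightarrow> k i \<ge> 1"
  shows "(\<Prod>m=1..r. fact m) dvd (\<Prod>l=1..r. \<Prod>j=l..r. \<Sum>i=l..j. k i)"
proof -
  define s where "s = (\<lambda>l j. \<Sum>i=l..j. k i)"
  define V where "V = (\<Prod>l=1..r. \<Prod>j=l..r. s l j)"
  have spos: "s l j > 0" if "1 \<le> l" "l \<le> j" "j \<le> r" for l j
  proof -
    have "k l \<le> s l j" unfolding s_def by (rule member_le_sum) (use that in auto)
    thus ?thesis using k[of l] that by linarith
  qed
  have sne: "s l j \<noteq> 0 \<and> 0 < s l j" if "Suc 0 \<le> l" "l \<le> j" "j \<le> r" for l j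
    using spos[of l j] that by simp
  have Vpos: "V > 0" unfolding V_def by (intro prod_pos ballI) (auto simp: sne)
  have sle: "s l j \<le> V" if "1 \<le> l" "l \<le> j" "j \<le> r" for l j
  proof (rule dvd_imp_le[OF _ Vpos])
    have "s l j dvd (\<Prod>j=l..r. s l j)" by (rule dvd_prodI) (use that in auto)
    also have "\<dots> dvd V" unfolding V_def by (rule dvd_prodI) (use that in auto)
    finally show "s l j dvd V" .
  qed
  have "(\<Prod>m=1..r. fact m) dvd V"
  proof (rule multiplicity_le_imp_dvd)
    fix p :: nat assume p: "prime p"
    define E where "E = V + r"
    have p0: "p ^ e > 0" for e using p prime_gt_0_nat by simp
    have D: "multiplicity p (\<Prod>m=1..r. fact m :: nat) = (\<Sum>e=1..E. \<Sum>m\<le>r. m div p ^ e)"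
    proof -
      have "multiplicity p (\<Prod>m=1..r. fact m :: nat) = (\<Sum>m=1..r. multiplicity p (fact m :: nat))"
        using p by (intro prime_elem_multiplicity_prod_distrib) auto
      also have "\<dots> = (\<Sum>m=1..r. \<Sum>i=1..m. multiplicity p i)"
        unfolding fact_prod using p
        by (intro sum.cong refl, simp, subst prime_elem_multiplicity_prod_distrib) auto
      also have "\<dots> = (\<Sum>m=1..r. \<Sum>i=1..m. \<Sum>e=1..E. if p ^ e dvd i then 1 else 0)"
        by (intro sum.cong refl multiplicity_eq_sum_dvd p) (auto simp: E_def)
      also have "\<dots> = (\<Sum>m=1..r. \<Sum>e=1..E. m div p ^ e)"
      proof (rule sum.cong[OF refl])
        fix m
        have "(\<Sum>i=1..m. \<Sum>e=1..E. if p ^ e dvd i then 1 else 0) = (\<Sum>e=1..E. \<Sum>i=1..m. if p ^ e dvd i then 1 else (0::nat))"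
          by (rule sum.swap)
        also have "\<dots> = (\<Sum>e=1..E. m div p ^ e)"
          by (rule sum.cong[OF refl]) (rule sum_indicator_dvd[OF p0])
        finally show "(\<Sum>i=1..m. \<Sum>e=1..E. if p ^ e dvd i then 1 else 0) = (\<Sum>e=1..E. m div p ^ e)" .
      qed
      also have "\<dots> = (\<Sum>e=1..E. \<Sum>m=1..r. m div p ^ e)" by (rule sum.swap)
      also have "\<dots> = (\<Sum>e=1..E. \<Sum>m\<le>r. m div p ^ e)"
        by (intro sum.cong refl sum.mono_neutral_left) (auto simp: Suc_le_eq)
      finally show ?thesis .
    qed
    have N: "multiplicity p V = (\<Sum>e=1..E. \<Sum>l=1..r. \<Sum>j=l..r. if p ^ e dvd s l j then 1 else 0)"
    proof -
      have "multiplicity p V = (\<Sum>l=1..r. multiplicity p (\<Prod>j=l..r. s l j))"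
        unfolding V_def using p
        by (intro prime_elem_multiplicity_prod_distrib) (auto simp: sne)
      also have "\<dots> = (\<Sum>l=1..r. \<Sum>j=l..r. multiplicity p (s l j))"
        using p by (intro sum.cong refl prime_elem_multiplicity_prod_distrib) (auto simp: sne)
      also have "\<dots> = (\<Sum>l=1..r. \<Sum>j=l..r. \<Sum>e=1..E. if p ^ e dvd s l j then 1 else 0)"
        by (intro sum.cong refl multiplicity_eq_sum_dvd p) (auto simp: E_def sne intro!: trans_le_add1[OF sle])
      also have "\<dots> = (\<Sum>l=1..r. \<Sum>e=1..E. \<Sum>j=l..r. if p ^ e dvd s l j then 1 else 0)"
        by (intro sum.cong refl sum.swap)
      also have "\<dots> = (\<Sum>e=1..E. \<Sum>l=1..r. \<Sum>j=l..r. if p ^ e dvd s l j then 1 else 0)"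
        by (rule sum.swap)
      finally show ?thesis .
    qed
    have "(\<Sum>m\<le>r. m div p ^ e) \<le> (\<Sum>l=1..r. \<Sum>j=l..r. if p ^ e dvd s l j then 1 else 0)" for e
    proof -
      define d where "d = p ^ e"
      define x :: "nat \<Rightarrow> int" where "x = (\<lambda>j. int (\<Sum>i=1..j. k i))"
      have xs: "x j - x i = int (s (Suc i) j)" if "i < j" for i j
      proof -
        have "{1..j} = {1..i} \<union> {Suc i..j}" using that by auto
        hence "(\<Sum>i=1..j. k i) = (\<Sum>i=1..i. k i) + s (Suc i) j"
          unfolding s_def by (simp add: sum.union_disjoint)
        thus ?thesis unfolding x_def by (simp only: of_nat_add add_diff_cancel_left')
      qed
      have "(\<Sum>m\<le>r. m div d) \<le> card {(i, j). i < j \<and> j \<le> r \<and> int d dvd x j - x i}"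
        using p0[of e] by (intro pairs_less_congruent_lower_bound) (simp add: d_def)
      also have "{(i, j). i < j \<and> j \<le> r \<and> int d dvd x j - x i}
          = {(i, j). i < j \<and> j \<le> r \<and> d dvd s (Suc i) j}"
        using xs by auto
      also have "card \<dots> = card {p \<in> (SIGMA l:{1..r}. {l..r}). d dvd s (fst p) (snd p)}"
      proof (rule bij_betw_same_card[of "\<lambda>(i, j). (Suc i, j)"])
        show "bij_betw (\<lambda>(i, j). (Suc i, j)) {(i, j). i < j \<and> j \<le> r \<and> d dvd s (Suc i) j}
          {p \<in> (SIGMA l:{1..r}. {l..r}). d dvd s (fst p) (snd p)}"
          by (rule bij_betwI[of _ _ _ "\<lambda>(i, j). (i - 1, j)"]) auto
      qed
      also have "\<dots> = (\<Sum>p\<in>(SIGMA l:{1..r}. {l..r}). if d dvd s (fst p) (snd p) then 1 else 0)"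
        by (subst sum.inter_filter[symmetric]) auto
      also have "\<dots> = (\<Sum>l=1..r. \<Sum>j=l..r. if d dvd s l j then 1 else 0)"
        by (subst sum.Sigma) (auto simp: case_prod_unfold)
      finally show ?thesis by (simp add: d_def)
    qed
    thus "multiplicity p (\<Prod>m=1..r. fact m :: nat) \<le> multiplicity p V"
      unfolding D N by (rule sum_mono)
  qed (use Vpos in auto)
  thus ?thesis by (simp add: V_def s_def)
qed

lemma irr_dim_in_Nats:
  assumes "k \<in> weights r"
  shows "irr_dim r k \<in> \<nat>"
proof -
  have "(\<Prod>m=1..r. fact m) dvd (\<Prod>l=1..r. \<Prod>j=l..r. \<Sum>i=l..j. k i)"
    using assms by (intro superfactorial_dvd_interval_sums) (auto simp: weights_def PiE_iff)
  then obtain m where m: "(\<Prod>l=1..r. \<Prod>j=l..r. \<Sum>i=l..j. k i) = (\<Prod>m=1..r. fact m) * m" by blast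
  have "(\<Prod>l=1..r. \<Prod>j=l..r. \<Sum>i=l..j. real (k i)) = real (\<Prod>l=1..r. \<Prod>j=l..r. \<Sum>i=l..j. k i)"
    by simp
  also have "\<dots> = c_const r * real m" unfolding m by (simp add: c_const_def)
  finally have "irr_dim r k = real m" 
    by (simp add: weyl_def c_const_def)
  thus ?thesis by simp
qed

section \<open>Moment generating functions determine laws\<close>

text \<open>
  Near \<open>z0\<close> one expands \<open>exp ((z - z0) x)\<close> into its power series and integrates termwise. For
  \<open>\<bar>z - z0\<bar> < 1 - \<bar>Re z0\<bar>\<close> the series of absolute values is dominated by \<open>exp (c \<bar>x\<bar>)\<close> with
  some \<open>c < 1\<close>, which is integrable by hypothesis.
\<close>

lemma exp_transform_holomorphic_on_strip:
  fixes M :: "real measure"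
  assumes M: "real_distribution M"
    and int: "\<And>u. -1 < u \<Longrightarrow> u < 1 \<Longrightarrow> integrable M (\<lambda>x. exp (u * x))"
  shows "(\<lambda>z. \<integral>x. exp (z * complex_of_real x) \<partial>M) holomorphic_on {z. -1 < Re z \<and> Re z < 1}"
    (is "?f holomorphic_on ?S")
proof -
  interpret real_distribution M by fact
  have op: "open ?S"
    by (intro open_Collect_conj open_halfspace_Re_gt open_halfspace_Re_lt)
  have "?f field_differentiable at z0" if z0: "z0 \<in> ?S" for z0
  proof -
    define d where "d = 1 - \<bar>Re z0\<bar>"
    have d: "d > 0" using z0 by (auto simp: d_def abs_if)
    define a where "a n = (\<integral>x. complex_of_real x ^ n / fact n * exp (z0 * of_real x) \<partial>M)" for n
    have "(\<lambda>n. a n * (w - z0) ^ n) sums ?f w" if w: "w \<in> ball z0 d" for w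
    proof -
      define h where "h = w - z0"
      have h: "norm h < d" using w by (simp add: h_def dist_norm norm_minus_commute)
      define c where "c = norm h + \<bar>Re z0\<bar>"
      have c: "0 \<le> c" "c < 1" using h by (auto simp: c_def d_def)
      define g where "g x = exp (c * x) + exp (- c * x)" for x :: real
      have g: "integrable M g"
        unfolding g_def using c by (intro Bochner_Integration.integrable_add int) auto
      define f where "f n x = (h * of_real x) ^ n / fact n * exp (z0 * of_real x)" for n and x :: real
      have [measurable]: "f n \<in> borel_measurable M" for n
        unfolding f_def by measurable
      have nf: "norm (f n x) = (norm h * \<bar>x\<bar>) ^ n / fact n * exp (Re z0 * x)" for n x
        by (simp add: f_def norm_mult norm_divide norm_power)
      have sumf: "(\<lambda>n. norm (f n x)) sums (exp (norm h * \<bar>x\<bar>) * exp (Re z0 * x))" for x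
        unfolding nf using exp_converges[of "norm h * \<bar>x\<bar>"]
        by (intro sums_mult2) (simp add: divide_inverse mult.commute scaleR_conv_of_real)
      have gb: "exp (norm h * \<bar>x\<bar>) * exp (Re z0 * x) \<le> g x" for x
      proof -
        have "norm h * \<bar>x\<bar> + Re z0 * x \<le> c * \<bar>x\<bar>"
          using abs_ge_self[of "Re z0 * x"] by (simp add: c_def abs_mult algebra_simps)
        hence "exp (norm h * \<bar>x\<bar>) * exp (Re z0 * x) \<le> exp (c * \<bar>x\<bar>)"
          by (simp flip: exp_add)
        also have "\<dots> \<le> g x" by (auto simp: g_def abs_if)
        finally show ?thesis .
      qed
      have part: "(\<Sum>i<n. norm (f i x)) \<le> g x" for n x
        using sum_le_suminf[OF sums_summable[OF sumf[of x]], of "{..<n}"] sums_unique[OF sumf[of x]] gb[of x]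
        by simp
      have fint: "integrable M (f n)" for n
      proof (rule Bochner_Integration.integrable_bound[OF g])
        have "norm (f n x) \<le> g x" for x
        proof -
          have "norm (f n x) \<le> (\<Sum>i<Suc n. norm (f i x))" by (rule member_le_sum) auto
          also note part
          finally show ?thesis .
        qed
        thus "AE x in M. norm (f n x) \<le> norm (g x)" by (auto simp: g_def intro!: AE_I2 order_trans[OF _ abs_ge_self])
      qed auto
      have "(\<lambda>n. integral\<^sup>L M (f n)) sums (\<integral>x. (\<Sum>n. f n x) \<partial>M)"
      proof (rule sums_integral)
        show "AE x in M. summable (\<lambda>i. norm (f i x))" using sumf by (auto simp: sums_iff)
        show "summable (\<lambda>i. \<integral>x. norm (f i x) \<partial>M)"
        proof (rule summableI_nonneg_bounded)
          show "(\<Sum>i<n. \<integral>x. norm (f i x) \<partial>M) \<le> integral\<^sup>L M g" for n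
          proof -
            have "(\<Sum>i<n. \<integral>x. norm (f i x) \<partial>M) = (\<integral>x. (\<Sum>i<n. norm (f i x)) \<partial>M)"
              using fint by (subst Bochner_Integration.integral_sum) auto
            also have "\<dots> \<le> integral\<^sup>L M g"
              using fint g by (intro integral_mono part Bochner_Integration.integrable_sum) auto
            finally show ?thesis .
          qed
        qed auto
      qed (use fint in auto)
      moreover have "(\<Sum>n. f n x) = exp (w * of_real x)" for x
      proof -
        have "(\<lambda>n. f n x) sums (exp (h * of_real x) * exp (z0 * of_real x))"
          unfolding f_def using exp_converges[of "h * complex_of_real x"]
          by (intro sums_mult2) (simp add: divide_inverse mult.commute scaleR_conv_of_real)
        also have "exp (h * of_real x) * exp (z0 * of_real x) = exp (w * of_real x)"
          by (simp add: h_def algebra_simps flip: exp_add)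
        finally show ?thesis by (simp add: sums_iff)
      qed
      moreover have "integral\<^sup>L M (f n) = a n * (w - z0) ^ n" for n
      proof -
        have "f n = (\<lambda>x. (complex_of_real x ^ n / fact n * exp (z0 * of_real x)) * h ^ n)"
          by (simp add: f_def fun_eq_iff power_mult_distrib)
        thus ?thesis unfolding a_def h_def by (simp only: integral_mult_left_zero)
      qed
      ultimately show ?thesis by simp
    qed
    hence "?f holomorphic_on ball z0 d" by (rule power_series_holomorphic)
    thus ?thesis using d by (simp add: holomorphic_on_imp_differentiable_at)
  qed
  thus ?thesis using op by (simp add: holomorphic_on_def field_differentiable_at_within)
qed

text \<open>
  By the identity theorem two transforms that agree on the real interval agree on the whole
  strip, in particular on the imaginary axis, where they are the characteristic functions.
\<close>

lemma mgf_on_interval_unique: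
  fixes M N :: "real measure"
  assumes M: "real_distribution M" and N: "real_distribution N"
    and mgfM: "has_mgf_on M f {-1<..<1}" and mgfN: "has_mgf_on N f {-1<..<1}"
  shows "M = N"
proof (rule Levy_uniqueness[OF M N])
  let ?S = "{z. -1 < Re z \<and> Re z < 1}"
  let ?L = "\<lambda>M z. \<integral>x. exp (z * complex_of_real x) \<partial>M"
  have op: "open ?S"
    by (intro open_Collect_conj open_halfspace_Re_gt open_halfspace_Re_lt)
  have cn: "connected ?S"
    by (intro convex_connected) (simp add: convex_halfspace_Re_gt convex_halfspace_Re_lt convex_Int Collect_conj_eq)
  have hol: "?L M holomorphic_on ?S" "?L N holomorphic_on ?S"
    by (rule exp_transform_holomorphic_on_strip[OF M], use mgfM in \<open>auto simp: has_mgf_on_def has_bochner_integral_iff\<close>)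
       (rule exp_transform_holomorphic_on_strip[OF N], use mgfN in \<open>auto simp: has_mgf_on_def has_bochner_integral_iff\<close>)
  have real: "?L K (complex_of_real u) = complex_of_real (f u)"
    if "has_mgf_on K f {-1<..<1}" "-1 < u" "u < 1" for K u
  proof -
    have "?L K (complex_of_real u) = (\<integral>x. complex_of_real (exp (u * x)) \<partial>K)"
      by (simp add: exp_of_real flip: of_real_mult)
    also have "\<dots> = complex_of_real (f u)"
      using that by (simp add: has_mgf_on_def has_bochner_integral_iff)
    finally show ?thesis .
  qed
  define U where "U = complex_of_real ` {-1<..<1}"
  have zero: "?L M w - ?L N w = 0" if "w \<in> ?S" for w
  proof (rule analytic_continuation[of "\<lambda>z. ?L M z - ?L N z" ?S U 0])
    show "(\<lambda>z. ?L M z - ?L N z) holomorphic_on ?S" by (intro holomorphic_intros hol)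
    show "0 islimpt U"
      unfolding islimpt_approachable
    proof (intro allI impI)
      fix e :: real assume "e > 0"
      then show "\<exists>x'\<in>U. x' \<noteq> 0 \<and> dist x' 0 < e"
        by (intro bexI[of _ "complex_of_real (min (e/2) (1/2))"]) (auto simp: U_def)
    qed
    show "?L M z - ?L N z = 0" if "z \<in> U" for z
      using that real[OF mgfM] real[OF mgfN] by (auto simp: U_def)
  qed (use op cn that in \<open>auto simp: U_def\<close>)
  show "char M = char N"
  proof
    fix t
    show "char M t = char N t"
      using zero[of "\<i> * of_real t"] by (simp add: char_def mult.assoc)
  qed
qed

text \<open>
  The absolute value is harmless, as the density vanishes on the negative half-line; it makes the
  partial sums in \<open>exponential_series_law\<close> monotone at every sample point.
\<close>

lemma exponential_complex_mgf:
  fixes z :: complex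
  assumes z: "Re z < 1"
  shows "has_bochner_integral (density lborel (exponential_density 1)) (\<lambda>x. exp (z * of_real \<bar>x\<bar>)) (1 / (1 - z))"
proof -
  let ?f = "\<lambda>x. exp ((z - 1) * complex_of_real x)"
  define l where "l = 1 - Re z"
  have l: "l > 0" using z by (simp add: l_def)
  have z1: "z - 1 \<noteq> 0" using z by auto
  have nf: "norm (?f x) = exp (- x * l)" for x by (simp add: l_def algebra_simps)
  interpret prob_space "density lborel (exponential_density l)"
    by (rule prob_space_exponential_density[OF l])
  have "integrable (density lborel (exponential_density l)) (\<lambda>x. 1::real)" by simp
  hence "integrable lborel (\<lambda>x. exponential_density l x *\<^sub>R (1::real))"
    by (subst (asm) integrable_density) (auto simp: exponential_density_nonneg[OF l])
  hence il: "integrable lborel (exponential_density l)" by simp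
  have si: "set_integrable lborel {0<..} ?f"
    unfolding set_integrable_def
  proof (rule Bochner_Integration.integrable_bound[OF integrable_mult_left[OF il, of "1/l"]])
    show "AE x in lborel. norm (indicat_real {0<..} x *\<^sub>R ?f x) \<le> norm (exponential_density l x * (1 / l))"
      using l by (intro AE_I2) (auto simp: exponential_density_def nf indicator_def simp del: norm_exp_eq_Re)
  qed measurable
  have "(LBINT x=0..\<infinity>. ?f x) = 0 - 1 / (z - 1)"
  proof (rule interval_integral_FTC_integrable[where F = "\<lambda>x. exp ((z - 1) * of_real x) / (z - 1)"])
    show "((\<lambda>x. exp ((z - 1) * complex_of_real x) / (z - 1)) has_vector_derivative ?f x) (at x)" for x
    proof -
      have "((\<lambda>w. exp ((z - 1) * w) / (z - 1)) has_field_derivative ?f x) (at (complex_of_real x))"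
        using z1 by (auto intro!: derivative_eq_intros)
      from has_vector_derivative_real_field[OF this] show ?thesis by simp
    qed
    show "set_integrable lborel (einterval 0 \<infinity>) ?f" using si by (simp add: einterval_def zero_ereal_def greaterThan_def)
    have "((\<lambda>x. exp ((z - 1) * complex_of_real x) / (z - 1)) \<longlongrightarrow> exp ((z - 1) * complex_of_real 0) / (z - 1)) (at_right 0)"
      by (intro tendsto_intros z1)
    thus "(((\<lambda>x. exp ((z - 1) * complex_of_real x) / (z - 1)) \<circ> real_of_ereal) \<longlongrightarrow> 1 / (z - 1)) (at_right 0)"
      by (simp add: zero_ereal_def ereal_tendsto_simps)
    have "((\<lambda>x. norm (?f x)) \<longlongrightarrow> 0) at_top" unfolding nf using l by real_asymp
    hence "(?f \<longlongrightarrow> 0) at_top" by (rule tendsto_norm_zero_cancel)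
    hence "((\<lambda>x. ?f x / (z - 1)) \<longlongrightarrow> 0 / (z - 1)) at_top" by (intro tendsto_divide tendsto_const z1)
    thus "(((\<lambda>x. exp ((z - 1) * complex_of_real x) / (z - 1)) \<circ> real_of_ereal) \<longlongrightarrow> 0) (at_left \<infinity>)"
      by (simp add: ereal_tendsto_simps)
  qed (auto intro!: continuous_intros)
  hence I: "(LINT x:{0<..}|lborel. ?f x) = 1 / (1 - z)"
    using z1 by (simp add: interval_lebesgue_integral_def einterval_def zero_ereal_def greaterThan_def field_simps)
  have ae: "AE x in lborel. indicat_real {0<..} x *\<^sub>R ?f x = exponential_density 1 x *\<^sub>R exp (z * of_real \<bar>x\<bar>)"
  proof -
    have "AE x in lborel. x \<noteq> (0::real)" by (rule AE_lborel_singleton)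
    thus ?thesis
    proof eventually_elim
      case (elim x)
      have "exp ((z - 1) * x) = exp (-x) * exp (z * complex_of_real x)"
        by (simp add: algebra_simps flip: exp_add exp_of_real)
      then show ?case using elim
        by (auto simp: exponential_density_def indicator_def scaleR_conv_of_real)
    qed
  qed
  have "has_bochner_integral lborel (\<lambda>x. indicat_real {0<..} x *\<^sub>R ?f x) (1 / (1 - z))"
    using si I by (simp add: has_bochner_integral_iff set_integrable_def set_lebesgue_integral_def)
  hence "has_bochner_integral lborel (\<lambda>x. exponential_density 1 x *\<^sub>R exp (z * of_real \<bar>x\<bar>)) (1 / (1 - z))"
    by (subst (asm) has_bochner_integral_cong_AE[OF _ _ ae]) auto
  thus ?thesis
    by (intro has_bochner_integral_density) (auto simp: exponential_density_nonneg)
qed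

section \<open>Series of independent exponential variables\<close>

lemma filterlim_finite_subsets_sequentially:
  assumes "\<And>n. finite (F n)" "\<And>n. F n \<subseteq> W"
    and "\<And>X. finite X \<Longrightarrow> X \<subseteq> W \<Longrightarrow> eventually (\<lambda>n. X \<subseteq> F n) sequentially"
  shows "filterlim F (finite_subsets_at_top W) sequentially"
  unfolding filterlim_iff
proof (intro allI impI)
  fix Q assume "eventually Q (finite_subsets_at_top W)"
  then obtain X where X: "finite X" "X \<subseteq> W" "\<And>Y. finite Y \<Longrightarrow> X \<subseteq> Y \<Longrightarrow> Y \<subseteq> W \<Longrightarrow> Q Y"
    by (auto simp: eventually_finite_subsets_at_top)
  show "eventually (\<lambda>n. Q (F n)) sequentially"
    using assms(3)[OF X(1,2)] by eventually_elim (use X assms in auto)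
qed

lemma summable_on_finite_superlevel:
  fixes f :: "'a \<Rightarrow> real"
  assumes f: "f summable_on W" and nonneg: "\<And>k. k \<in> W \<Longrightarrow> f k \<ge> 0" and e: "e > 0"
  shows "finite {k\<in>W. f k \<ge> e}"
proof (rule ccontr)
  assume inf: "infinite {k\<in>W. f k \<ge> e}"
  obtain n where n: "infsum f W / e < real n" using reals_Archimedean2 by blast
  obtain F where F: "finite F" "card F = n" "F \<subseteq> {k\<in>W. f k \<ge> e}"
    using infinite_arbitrarily_large[OF inf] by blast
  have "real n * e = (\<Sum>k\<in>F. e)" using F by simp
  also have "\<dots> \<le> (\<Sum>k\<in>F. f k)" using F by (intro sum_mono) auto
  also have "\<dots> \<le> infsum f W"
    using F nonneg by (intro finite_sum_le_infsum f) auto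
  finally show False using n e by (simp add: field_simps)
qed

text \<open>
  Outside a finite set of indices \<open>Ln (1 - z / a k) = O(1 / a k)\<close>, so the logarithms are
  summable, and the exponential of their sum is the unordered product.
\<close>

lemma prod_inverse_tendsto_finite_subsets:
  fixes a :: "'a \<Rightarrow> real"
  assumes a: "\<And>k. k \<in> W \<Longrightarrow> a k \<ge> 1" and sm: "(\<lambda>k. 1 / a k) summable_on W"
    and z: "\<bar>Re z\<bar> < 1"
  shows "\<exists>H. ((\<lambda>F. \<Prod>k\<in>F. 1 / (1 - z / complex_of_real (a k))) \<longlongrightarrow> H) (finite_subsets_at_top W)"
proof -
  define l where "l k = Ln (1 - z / complex_of_real (a k))" for k
  define e where "e = 1 / (2 * norm z + 1)"
  have e: "e > 0" by (simp add: e_def add_nonneg_pos)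
  define B where "B = {k\<in>W. 1 / a k \<ge> e}"
  have B: "finite B" unfolding B_def
    by (rule summable_on_finite_superlevel[OF sm _ e]) (use a in \<open>force intro: divide_nonneg_nonneg\<close>)
  have "l summable_on (W - B)"
  proof (rule abs_summable_summable[OF Infinite_Sum.abs_summable_on_comparison_test'])
    show "(\<lambda>k. 2 * norm z * (1 / a k)) summable_on (W - B)"
      by (intro summable_on_cmult_right summable_on_subset_banach[OF sm]) auto
    show "norm (l k) \<le> 2 * norm z * (1 / a k)" if "k \<in> W - B" for k
    proof -
      have k: "1 / a k < e" "a k \<ge> 1" using that a by (auto simp: B_def)
      have "norm (- (z / complex_of_real (a k))) = norm z * (1 / a k)"
        using k by (simp add: norm_divide)
      moreover have "norm z * (1 / a k) < 1 / 2"
      proof -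
        have "norm z * (1 / a k) \<le> norm z * e" using k by (intro mult_left_mono) auto
        also have "\<dots> < 1 / 2" by (simp add: e_def field_simps add_pos_nonneg)
        finally show ?thesis .
      qed
      ultimately show ?thesis
        using norm_Ln_le[of "- (z / complex_of_real (a k))"] by (simp add: l_def)
    qed
  qed
  hence "l summable_on ((W - B) \<union> B)" using B by (intro summable_on_Un_disjoint) auto
  moreover have "(W - B) \<union> B = W" by (auto simp: B_def)
  ultimately have "((\<lambda>F. \<Sum>k\<in>F. l k) \<longlongrightarrow> infsum l W) (finite_subsets_at_top W)"
    using has_sum_infsum has_sum_def by (metis (no_types, lifting))
  hence lim: "((\<lambda>F. exp (- (\<Sum>k\<in>F. l k))) \<longlongrightarrow> exp (- infsum l W)) (finite_subsets_at_top W)"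
    by (intro tendsto_intros)
  have "exp (- (\<Sum>k\<in>F. l k)) = (\<Prod>k\<in>F. 1 / (1 - z / complex_of_real (a k)))" if "finite F" "F \<subseteq> W" for F
  proof -
    have "exp (l k) = 1 - z / complex_of_real (a k)" if "k \<in> F" for k
    proof -
      have "a k \<ge> 1" using that \<open>F \<subseteq> W\<close> a by auto
      have "1 - z / complex_of_real (a k) \<noteq> 0"
      proof
        assume "1 - z / complex_of_real (a k) = 0"
        hence "z = complex_of_real (a k)" using \<open>a k \<ge> 1\<close> by (auto simp: field_simps)
        thus False using \<open>a k \<ge> 1\<close> z by simp
      qed
      thus ?thesis by (simp add: l_def)
    qed
    thus ?thesis using that
      by (simp add: exp_minus exp_sum inverse_eq_divide prod_dividef)
  qed
  hence "eventually (\<lambda>F. exp (- (\<Sum>k\<in>F. l k)) = (\<Prod>k\<in>F. 1 / (1 - z / complex_of_real (a k)))) (finite_subsets_at_top W)"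
    by (intro eventually_finite_subsets_at_top_weakI)
  from tendsto_cong[OF this] lim show ?thesis by blast
qed

text \<open>
  The law is that of \<open>\<Sum>i. b i * E\<^sub>i\<close> with independent standard exponential variables \<open>E\<^sub>i\<close>. The
  product formula for finitely many summands passes to the limit: for a real argument in \<open>[0, 1)\<close> by
  monotone convergence, and then for complex \<open>z\<close> by dominated convergence, the dominating
  function being the one at \<open>\<bar>Re z\<bar>\<close>.
\<close>

lemma exponential_series_law:
  fixes b :: "nat \<Rightarrow> real"
  assumes b: "\<And>i. 0 \<le> b i" "\<And>i. b i \<le> 1" "summable b"
    and H: "\<And>z. \<bar>Re z\<bar> < 1 \<Longrightarrow> (\<lambda>m. \<Prod>i<m. 1 / (1 - z * complex_of_real (b i))) \<longlonglongrightarrow> H z"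
  shows "\<exists>\<mu>. real_distribution \<mu> \<and>
    (\<forall>z. \<bar>Re z\<bar> < 1 \<longrightarrow> has_bochner_integral \<mu> (\<lambda>x. exp (z * complex_of_real x)) (H z))"
proof -
  define E where "E = density lborel (exponential_density 1)"
  interpret E: prob_space E unfolding E_def by (rule prob_space_exponential_density) simp
  define Q where "Q = PiM (UNIV :: nat set) (\<lambda>_. E)"
  interpret P: product_prob_space "\<lambda>_. E" "UNIV :: nat set" ..
  interpret Q: prob_space Q unfolding Q_def by (rule P.prob_space_axioms)
  have setsE [measurable_cong, simp]: "sets E = sets borel" by (simp add: E_def)
  have [measurable]: "(\<lambda>\<omega>. \<omega> i) \<in> borel_measurable Q" for i :: nat
  proof -
    have "(\<lambda>\<omega>. \<omega> i) \<in> measurable Q E" unfolding Q_def by (rule measurable_component_singleton) simp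
    thus ?thesis by (simp cong: measurable_cong_sets)
  qed
  have distr: "distr Q borel (\<lambda>\<omega>. \<omega> i) = E" for i
  proof -
    have "distr Q borel (\<lambda>\<omega>. \<omega> i) = distr Q E (\<lambda>\<omega>. \<omega> i)" by (rule distr_cong) auto
    also have "\<dots> = E" unfolding Q_def using P.PiM_component[of i] by simp
    finally show ?thesis .
  qed
  have indep: "Q.indep_vars (\<lambda>_. borel) (\<lambda>i \<omega>. \<omega> i) UNIV"
  proof (subst Q.indep_vars_iff_distr_eq_PiM')
    have "distr Q (PiM UNIV (\<lambda>_. borel)) (\<lambda>x. \<lambda>i\<in>UNIV. x i) = distr Q Q (\<lambda>x. x)"
    proof (rule distr_cong)
      show "sets (PiM UNIV (\<lambda>_. borel)) = sets Q" unfolding Q_def by (rule sets_PiM_cong) auto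
    qed auto
    thus "distr Q (PiM UNIV (\<lambda>_. borel)) (\<lambda>x. \<lambda>i\<in>UNIV. x i) = PiM UNIV (\<lambda>i. distr Q borel (\<lambda>\<omega>. \<omega> i))"
      unfolding distr by (simp add: Q_def)
  qed auto
  define Y where "Y i \<omega> = b i * \<bar>\<omega> i\<bar>" for i :: nat and \<omega> :: "nat \<Rightarrow> real"
  have [measurable]: "Y i \<in> borel_measurable Q" for i unfolding Y_def by measurable
  have Y0: "Y i \<omega> \<ge> 0" for i \<omega> using b by (simp add: Y_def)
  have single: "has_bochner_integral Q (\<lambda>\<omega>. exp (z * complex_of_real (Y i \<omega>))) (1 / (1 - z * complex_of_real (b i)))"
    if z: "\<bar>Re z\<bar> < 1" for z i
  proof -
    have "\<bar>Re z * b i\<bar> \<le> \<bar>Re z\<bar> * 1" unfolding abs_mult using b[of] by (intro mult_mono) auto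
    hence "Re (z * complex_of_real (b i)) < 1" using z by simp
    from exponential_complex_mgf[OF this]
    have "has_bochner_integral (distr Q borel (\<lambda>\<omega>. \<omega> i)) (\<lambda>x. exp (z * complex_of_real (b i) * of_real \<bar>x\<bar>)) (1 / (1 - z * complex_of_real (b i)))"
      unfolding distr by (simp add: E_def)
    thus ?thesis by (simp add: has_bochner_integral_iff integral_distr integrable_distr_eq Y_def mult.assoc)
  qed
  have fin: "has_bochner_integral Q (\<lambda>\<omega>. exp (z * complex_of_real (\<Sum>i<m. Y i \<omega>))) (\<Prod>i<m. 1 / (1 - z * complex_of_real (b i)))"
    if z: "\<bar>Re z\<bar> < 1" for z m
  proof -
    have ind: "Q.indep_vars (\<lambda>_. borel) (\<lambda>i \<omega>. exp (z * complex_of_real (Y i \<omega>))) {..<m}"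
      using Q.indep_vars_compose2[OF Q.indep_vars_subset[OF indep, of "{..<m}"], of "\<lambda>i x. exp (z * complex_of_real (b i * \<bar>x\<bar>))" "\<lambda>_. borel"]
      by (simp add: Y_def)
    have i: "integrable Q (\<lambda>\<omega>. exp (z * complex_of_real (Y i \<omega>)))" for i
      using single[OF z] by (simp add: has_bochner_integral_iff)
    have "exp (z * complex_of_real (\<Sum>i<m. Y i \<omega>)) = (\<Prod>i<m. exp (z * complex_of_real (Y i \<omega>)))" for \<omega>
      by (simp add: sum_distrib_left exp_sum)
    thus ?thesis
      using Q.indep_vars_lebesgue_integral[OF _ ind i] Q.indep_vars_integrable[OF _ ind i] single[OF z]
      by (simp add: has_bochner_integral_iff)
  qed
  have EY: "(\<integral>\<^sup>+\<omega>. ennreal (Y i \<omega>) \<partial>Q) \<le> ennreal (4 * b i)" for i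
  proof -
    have "has_bochner_integral E (\<lambda>x. exp (of_real (1/2) * complex_of_real \<bar>x\<bar>)) (1 / (1 - of_real (1/2)))"
      unfolding E_def by (rule exponential_complex_mgf) simp
    hence "has_bochner_integral E (\<lambda>x. complex_of_real (exp (\<bar>x\<bar> / 2))) (of_real 2)"
      by (simp flip: exp_of_real)
    hence h: "has_bochner_integral E (\<lambda>x. exp (\<bar>x\<bar> / 2)) 2"
      by (simp only: has_bochner_integral_iff integral_complex_of_real of_real_eq_iff complex_of_real_integrable_eq)
    have "(\<integral>\<^sup>+\<omega>. ennreal (Y i \<omega>) \<partial>Q) = (\<integral>\<^sup>+x. ennreal (b i * \<bar>x\<bar>) \<partial>distr Q borel (\<lambda>\<omega>. \<omega> i))"
      by (simp add: nn_integral_distr Y_def)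
    also have "\<dots> \<le> (\<integral>\<^sup>+x. ennreal (b i * 2 * exp (\<bar>x\<bar> / 2)) \<partial>E)"
      unfolding distr
    proof (intro nn_integral_mono ennreal_leI)
      fix x :: real
      have "\<bar>x\<bar> \<le> 2 * exp (\<bar>x\<bar> / 2)" using exp_ge_add_one_self[of "\<bar>x\<bar> / 2"] by linarith
      thus "b i * \<bar>x\<bar> \<le> b i * 2 * exp (\<bar>x\<bar> / 2)" using b by (simp add: mult_left_mono mult.assoc)
    qed
    also have "\<dots> = ennreal (4 * b i)"
      using has_bochner_integral_mult_right[OF h, of "b i * 2"] b
      by (subst nn_integral_eq_integral) (auto simp: has_bochner_integral_iff)
    finally show ?thesis .
  qed
  have ae: "AE \<omega> in Q. summable (\<lambda>i. Y i \<omega>)"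
  proof -
    have "(\<integral>\<^sup>+\<omega>. (\<Sum>i. ennreal (Y i \<omega>)) \<partial>Q) = (\<Sum>i. \<integral>\<^sup>+\<omega>. ennreal (Y i \<omega>) \<partial>Q)"
      by (intro nn_integral_suminf) auto
    also have "\<dots> \<le> (\<Sum>i. ennreal (4 * b i))" by (intro suminf_le EY) auto
    also have "\<dots> = ennreal (\<Sum>i. 4 * b i)" using b by (intro suminf_ennreal2 summable_mult) auto
    finally have "(\<integral>\<^sup>+\<omega>. (\<Sum>i. ennreal (Y i \<omega>)) \<partial>Q) \<noteq> \<infinity>" by (auto simp: top_unique)
    hence "AE \<omega> in Q. (\<Sum>i. ennreal (Y i \<omega>)) \<noteq> \<infinity>" by (intro nn_integral_PInf_AE) auto
    thus ?thesis by eventually_elim (use Y0 in \<open>auto intro: summable_suminf_not_top\<close>)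
  qed
  define T where "T \<omega> = (\<Sum>i. Y i \<omega>)" for \<omega>
  have [measurable]: "T \<in> borel_measurable Q" unfolding T_def by measurable
  have conv: "AE \<omega> in Q. (\<lambda>m. \<Sum>i<m. Y i \<omega>) \<longlonglongrightarrow> T \<omega>"
    using ae by eventually_elim (simp add: T_def summable_LIMSEQ)
  have le: "AE \<omega> in Q. \<forall>m. (\<Sum>i<m. Y i \<omega>) \<le> T \<omega>"
    using ae by eventually_elim (auto simp: T_def intro!: sum_le_suminf Y0)
  have intT: "integrable Q (\<lambda>\<omega>. exp (u * T \<omega>))" if u: "0 \<le> u" "u < 1" for u :: real
  proof -
    have fr: "has_bochner_integral Q (\<lambda>\<omega>. exp (u * (\<Sum>i<m. Y i \<omega>))) (Re (\<Prod>i<m. 1 / (1 - of_real u * complex_of_real (b i))))" for m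
      using has_bochner_integral_Re[OF fin[of "of_real u" m]] u 
      by (simp del: of_real_sum add: Re_exp)
    have "has_bochner_integral Q (\<lambda>\<omega>. exp (u * T \<omega>)) (Re (H (of_real u)))"
    proof (rule has_bochner_integral_monotone_convergence)
      show "integrable Q (\<lambda>\<omega>. exp (u * (\<Sum>i<m. Y i \<omega>)))" for m
        using fr by (simp add: has_bochner_integral_iff)
      show "AE \<omega> in Q. mono (\<lambda>m. exp (u * (\<Sum>i<m. Y i \<omega>)))"
        using u Y0 by (intro AE_I2 monoI) (auto intro!: mult_left_mono sum_mono2)
      show "AE \<omega> in Q. (\<lambda>m. exp (u * (\<Sum>i<m. Y i \<omega>))) \<longlonglongrightarrow> exp (u * T \<omega>)"
        using conv by eventually_elim (intro tendsto_intros)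
      have "(\<lambda>m. Re (\<Prod>i<m. 1 / (1 - of_real u * complex_of_real (b i)))) \<longlonglongrightarrow> Re (H (of_real u))"
        using u by (intro tendsto_Re H) auto
      thus "(\<lambda>m. \<integral>\<omega>. exp (u * (\<Sum>i<m. Y i \<omega>)) \<partial>Q) \<longlonglongrightarrow> Re (H (of_real u))"
        using fr by (simp add: has_bochner_integral_iff)
    qed measurable
    thus ?thesis by (simp add: has_bochner_integral_iff)
  qed
  have lim: "has_bochner_integral Q (\<lambda>\<omega>. exp (z * complex_of_real (T \<omega>))) (H z)" if z: "\<bar>Re z\<bar> < 1" for z
  proof -
    have bd: "AE \<omega> in Q. norm (exp (z * complex_of_real (\<Sum>i<m. Y i \<omega>))) \<le> exp (\<bar>Re z\<bar> * T \<omega>)" for m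
      using le
    proof eventually_elim
      case (elim \<omega>)
      have "Re z * (\<Sum>i<m. Y i \<omega>) \<le> \<bar>Re z\<bar> * (\<Sum>i<m. Y i \<omega>)"
        using Y0 by (intro mult_right_mono sum_nonneg) auto
      also have "\<dots> \<le> \<bar>Re z\<bar> * T \<omega>" using elim by (intro mult_left_mono) auto
      finally show ?case by (simp del: of_real_sum)
    qed
    have cv: "AE \<omega> in Q. (\<lambda>m. exp (z * complex_of_real (\<Sum>i<m. Y i \<omega>))) \<longlonglongrightarrow> exp (z * complex_of_real (T \<omega>))"
      using conv by eventually_elim (intro tendsto_intros)
    note dct = _ _ intT[of "\<bar>Re z\<bar>"] cv bd
    have "(\<lambda>m. \<integral>\<omega>. exp (z * complex_of_real (\<Sum>i<m. Y i \<omega>)) \<partial>Q) \<longlonglongrightarrow> (\<integral>\<omega>. exp (z * complex_of_real (T \<omega>)) \<partial>Q)"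
      by (rule integral_dominated_convergence[OF dct]) (use z in auto)
    moreover have "(\<lambda>m. \<integral>\<omega>. exp (z * complex_of_real (\<Sum>i<m. Y i \<omega>)) \<partial>Q) \<longlonglongrightarrow> H z"
      using H[OF z] fin[OF z] by (simp add: has_bochner_integral_iff del: of_real_sum)
    ultimately have "(\<integral>\<omega>. exp (z * complex_of_real (T \<omega>)) \<partial>Q) = H z" by (rule LIMSEQ_unique)
    moreover have "integrable Q (\<lambda>\<omega>. exp (z * complex_of_real (T \<omega>)))"
      by (rule integrable_dominated_convergence[OF dct]) (use z in auto)
    ultimately show ?thesis by (simp add: has_bochner_integral_iff)
  qed
  show ?thesis
  proof (intro exI[of _ "distr Q borel T"] conjI allI impI)
    show "real_distribution (distr Q borel T)" by (rule Q.real_distribution_distr) simp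
    show "has_bochner_integral (distr Q borel T) (\<lambda>x. exp (z * complex_of_real x)) (H z)" if "\<bar>Re z\<bar> < 1" for z
      using lim[OF that] by (simp add: has_bochner_integral_iff integral_distr integrable_distr_eq)
  qed
qed

section \<open>Counting partitions by contour integrals\<close>

text \<open>
  The total is an integer so that the recurrence below needs no case distinction: there are no
  partitions of a negative total.
\<close>

definition partitions_into :: "('k \<Rightarrow> nat) \<Rightarrow> 'k set \<Rightarrow> int \<Rightarrow> 'k multiset set" where
  "partitions_into a F n = {\<rho>. set_mset \<rho> \<subseteq> F \<and> int (\<Sum>k\<in>#\<rho>. a k) = n}"

lemma finite_partitions_into:
  assumes "finite F" "\<And>k. k \<in> F \<Longrightarrow> a k \<ge> 1"
  shows "finite (partitions_into a F n)"
proof (rule finite_subset)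
  show "finite (mset ` {xs. set xs \<subseteq> F \<and> length xs \<le> nat n})"
    using assms(1) by (intro finite_imageI finite_lists_length_le)
  show "partitions_into a F n \<subseteq> mset ` {xs. set xs \<subseteq> F \<and> length xs \<le> nat n}"
  proof
    fix \<rho> assume \<rho>: "\<rho> \<in> partitions_into a F n"
    have "size \<rho> = (\<Sum>k\<in>#\<rho>. 1)" by simp
    also have "\<dots> \<le> (\<Sum>k\<in>#\<rho>. a k)"
      using \<rho> assms(2) by (intro sum_mset_mono) (auto simp: partitions_into_def)
    also have "\<dots> = nat n" using \<rho> unfolding partitions_into_def by (metis (mono_tags, lifting) mem_Collect_eq nat_int)
    finally have "size \<rho> \<le> nat n" .
    moreover obtain xs where "mset xs = \<rho>" using ex_mset by blast
    ultimately show "\<rho> \<in> mset ` {xs. set xs \<subseteq> F \<and> length xs \<le> nat n}"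
      using \<rho> by (auto simp: partitions_into_def image_iff intro!: exI[of _ xs])
  qed
qed

text \<open>
  Either the part \<open>k\<close> does not occur, or one copy of it can be removed.
\<close>

lemma sum_partitions_into_insert:
  fixes w :: "'k \<Rightarrow> complex"
  assumes "finite F" "\<And>j. j \<in> insert k F \<Longrightarrow> a j \<ge> 1" "k \<notin> F"
  shows "(\<Sum>\<rho>\<in>partitions_into a (insert k F) n. \<Prod>j\<in>#\<rho>. w j)
    = (\<Sum>\<rho>\<in>partitions_into a F n. \<Prod>j\<in>#\<rho>. w j)
      + w k * (\<Sum>\<rho>\<in>partitions_into a (insert k F) (n - int (a k)). \<Prod>j\<in>#\<rho>. w j)"
proof -
  let ?A = "partitions_into a F n" and ?B = "partitions_into a (insert k F) (n - int (a k))"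
  have split: "partitions_into a (insert k F) n = ?A \<union> add_mset k ` ?B"
  proof (intro equalityI subsetI)
    fix \<rho> assume \<rho>: "\<rho> \<in> partitions_into a (insert k F) n"
    show "\<rho> \<in> ?A \<union> add_mset k ` ?B"
    proof (cases "k \<in># \<rho>")
      case True
      then obtain \<sigma> where "\<rho> = add_mset k \<sigma>" by (meson multi_member_split)
      then show ?thesis using \<rho> by (auto simp: partitions_into_def image_iff)
    next
      case False
      then show ?thesis using \<rho> by (auto simp: partitions_into_def)
    qed
  qed (auto simp: partitions_into_def)
  have finA: "finite ?A" by (rule finite_partitions_into) (use assms in blast)+
  have finB: "finite ?B" by (rule finite_partitions_into) (use assms in blast)+
  note fin = finA finB
  have "k \<notin># \<rho>" if "\<rho> \<in> ?A" for \<rho>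
    using that assms(3) by (auto simp only: partitions_into_def mem_Collect_eq subset_iff)
  moreover have "k \<in># \<rho>" if "\<rho> \<in> add_mset k ` ?B" for \<rho>
    using that by (elim imageE) simp
  ultimately have "?A \<inter> add_mset k ` ?B = {}" by blast
  hence "(\<Sum>\<rho>\<in>partitions_into a (insert k F) n. \<Prod>j\<in>#\<rho>. w j)
      = (\<Sum>\<rho>\<in>?A. \<Prod>j\<in>#\<rho>. w j) + (\<Sum>\<rho>\<in>add_mset k ` ?B. \<Prod>j\<in>#\<rho>. w j)"
    unfolding split using fin by (intro sum.union_disjoint) auto
  also have "(\<Sum>\<rho>\<in>add_mset k ` ?B. \<Prod>j\<in>#\<rho>. w j) = (\<Sum>\<rho>\<in>?B. w k * (\<Prod>j\<in>#\<rho>. w j))"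
    by (subst sum.reindex) (auto simp: inj_on_def)
  finally show ?thesis by (simp add: sum_distrib_left)
qed

lemma integral_cis:
  fixes n :: int
  shows "integral {-pi..pi} (\<lambda>t. cis (of_int n * t)) = (if n = 0 then of_real (2 * pi) else 0)"
proof (cases "n = 0")
  case True
  then show ?thesis by (simp add: scaleR_conv_of_real)
next
  case False
  have "((\<lambda>t. cis (of_int n * t)) has_integral (cis (of_int n * pi) / (\<i> * of_int n) - cis (of_int n * (-pi)) / (\<i> * of_int n))) {-pi..pi}"
  proof (rule fundamental_theorem_of_calculus)
    show "((\<lambda>t. cis (of_int n * t) / (\<i> * of_int n)) has_vector_derivative cis (of_int n * t)) (at t within {-pi..pi})" for t
    proof -
      have "((\<lambda>z. exp (\<i> * of_int n * z) / (\<i> * of_int n)) has_field_derivative exp (\<i> * of_int n * complex_of_real t)) (at (complex_of_real t))"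
        using False by (auto intro!: derivative_eq_intros)
      from has_vector_derivative_real_field[OF this]
      show ?thesis by (simp add: cis_conv_exp mult_ac)
    qed
  qed simp
  moreover have "cis (of_int n * pi) = cis (of_int n * (-pi))"
  proof -
    have "cis (of_int n * pi) = cis (of_int n * (-pi)) * cis (2 * pi * of_int n)"
      by (simp add: cis_mult algebra_simps)
    thus ?thesis by simp
  qed
  ultimately show ?thesis using False by (simp add: integral_unique)
qed

lemma one_minus_mult_cis_neq_0: "norm (w :: complex) < 1 \<Longrightarrow> 1 - w * cis x \<noteq> 0"
proof
  assume "norm w < 1" "1 - w * cis x = 0"
  hence "w * cis x = 1" by simp
  hence "norm (w * cis x) = 1" by simp
  thus False using \<open>norm w < 1\<close> by (simp add: norm_mult)
qed

lemma geometric_products_continuous: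
  fixes w :: "'k \<Rightarrow> complex"
  assumes "\<And>j. j \<in> F \<Longrightarrow> norm (w j) < 1"
  shows "continuous_on S (\<lambda>t. (\<Prod>j\<in>F. 1 / (1 - w j * cis (a j * t))) * cis (b * t))"
  by (intro continuous_intros ballI one_minus_mult_cis_neq_0 assms)

text \<open>
  This extracts the coefficient of \<open>x\<^sup>n\<close> from \<open>\<Prod>j\<in>F. 1 / (1 - w j x\<^bsup>a j\<^esup>)\<close>. When a part \<open>k\<close> is added to
  \<open>F\<close>, both sides satisfy the recurrence \<open>f\<^sub>n = g\<^sub>n + w k f\<^bsub>n - a k\<^esub>\<close>, where \<open>g\<close> belongs to \<open>F\<close>, so their
  difference satisfies \<open>D n = w k ^ m * D (n - m * a k)\<close> for all \<open>m\<close>. The right-hand side tends to 0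
  as \<open>m\<close> grows: the integrals are bounded, the sums vanish for negative totals, and \<open>\<bar>w k\<bar> < 1\<close>.
\<close>

lemma coefficient_integral:
  fixes w :: "'k \<Rightarrow> complex"
  assumes "finite F" "\<And>j. j \<in> F \<Longrightarrow> a j \<ge> 1" "\<And>j. j \<in> F \<Longrightarrow> norm (w j) < 1"
  shows "integral {-pi..pi} (\<lambda>t. (\<Prod>j\<in>F. 1 / (1 - w j * cis (real (a j) * t))) * cis (of_int (-n) * t))
    = of_real (2 * pi) * (\<Sum>\<rho>\<in>partitions_into a F n. \<Prod>j\<in>#\<rho>. w j)"
  using assms
proof (induction F arbitrary: n rule: finite_induct)
  case empty
  have "partitions_into a {} n = (if n = 0 then {{#}} else {})"
    by (auto simp: partitions_into_def)
  then show ?case using integral_cis[of "-n"] by simp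
next
  case (insert k F n)
  define G where "G n t = (\<Prod>j\<in>F. 1 / (1 - w j * cis (real (a j) * t))) * cis (of_int (-n) * t)" for n t
  define I where "I n t = (\<Prod>j\<in>insert k F. 1 / (1 - w j * cis (real (a j) * t))) * cis (of_int (-n) * t)" for n t
  define c where "c n = (\<Sum>\<rho>\<in>partitions_into a (insert k F) n. \<Prod>j\<in>#\<rho>. w j)" for n
  define D where "D n = integral {-pi..pi} (I n) - of_real (2 * pi) * c n" for n
  have wk: "norm (w k) < 1" using insert.prems by auto
  have ak: "a k \<ge> 1" using insert.prems by auto
  have contG: "continuous_on S (G n)" and contI: "continuous_on S (I n)" for n S
    unfolding G_def I_def by (intro geometric_products_continuous; use insert.prems in blast)+
  have rec: "I n t = G n t + w k * I (n - int (a k)) t" for n t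
  proof -
    let ?x = "w k * cis (real (a k) * t)"
    define y where "y = 1 / (1 - ?x)"
    have y: "y = 1 + ?x * y"
      using one_minus_mult_cis_neq_0[OF wk, of "real (a k) * t"] by (simp add: y_def field_simps)
    have "cis (of_int (- (n - int (a k))) * t) = cis (of_int (-n) * t) * cis (real (a k) * t)"
      by (simp add: cis_mult algebra_simps)
    hence "I (n - int (a k)) t = y * (G n t * cis (real (a k) * t))"
      unfolding I_def G_def y_def by (simp only: prod.insert[OF insert.hyps] mult.assoc)
    moreover have "I n t = y * G n t"
      unfolding I_def G_def y_def by (simp only: prod.insert[OF insert.hyps] mult.assoc)
    moreover have "y * G n t = (1 + ?x * y) * G n t" using y by simp
    ultimately show ?thesis by (simp add: algebra_simps)
  qed
  have r1: "integral {-pi..pi} (I n) = integral {-pi..pi} (G n) + w k * integral {-pi..pi} (I (n - int (a k)))" for n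
    unfolding rec[of n, abs_def]
    by (subst integral_add)
       (auto intro!: integrable_continuous_interval continuous_on_mult_left contG contI)
  have r2: "integral {-pi..pi} (G n) = of_real (2 * pi) * (\<Sum>\<rho>\<in>partitions_into a F n. \<Prod>j\<in>#\<rho>. w j)" for n
    unfolding G_def by (rule insert.IH) (use insert.prems in auto)
  have r3: "c n = (\<Sum>\<rho>\<in>partitions_into a F n. \<Prod>j\<in>#\<rho>. w j) + w k * c (n - int (a k))" for n
    unfolding c_def by (rule sum_partitions_into_insert) (use insert in auto)
  have Drec: "D n = w k * D (n - int (a k))" for n
    unfolding D_def r1[of n] r2[of n] r3[of n] by (simp add: algebra_simps)
  have Dpow: "D n = w k ^ m * D (n - int m * int (a k))" for n m
  proof (induction m)
    case (Suc m)
    then show ?case using Drec[of "n - int m * int (a k)"] by (simp add: algebra_simps)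
  qed simp
  have "compact ((\<lambda>t. norm (I 0 t)) ` {-pi..pi})"
    by (intro compact_continuous_image continuous_on_norm contI) auto
  then obtain B where B: "\<And>t. t \<in> {-pi..pi} \<Longrightarrow> norm (I 0 t) \<le> B"
    by (force dest!: compact_imp_bounded simp: bounded_iff)
  have nI: "norm (I n t) = norm (I 0 t)" for n t by (simp add: I_def norm_mult)
  have Ib: "norm (integral {-pi..pi} (I n)) \<le> B * (2 * pi)" for n
  proof -
    have "norm (integral {-pi..pi} (I n)) \<le> B * (pi - (-pi))"
    proof (rule integral_bound)
      show "norm (I n t) \<le> B" if "t \<in> {-pi..pi}" for t
        using B[OF that] by (simp only: nI[of n t])
    qed (use contI in auto)
    thus ?thesis by simp
  qed
  have "(\<lambda>m. norm (w k) ^ m * (B * (2 * pi))) \<longlonglongrightarrow> 0 * (B * (2 * pi))"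
    using wk by (intro tendsto_mult tendsto_const LIMSEQ_power_zero) auto
  moreover have "eventually (\<lambda>m. norm (D n) \<le> norm (w k) ^ m * (B * (2 * pi))) sequentially"
    using eventually_gt_at_top[of "nat \<bar>n\<bar>"]
  proof eventually_elim
    case (elim m)
    have "int m * 1 \<le> int m * int (a k)" using ak by (intro mult_left_mono) auto
    hence "n - int m * int (a k) < 0" using elim by linarith
    hence "partitions_into a (insert k F) (n - int m * int (a k)) = {}"
      by (auto simp: partitions_into_def simp del: of_nat_sum_mset)
    hence "D n = w k ^ m * integral {-pi..pi} (I (n - int m * int (a k)))"
      using Dpow[of n m] by (simp add: D_def c_def)
    thus ?case using Ib by (simp add: norm_mult norm_power mult_left_mono)
  qed
  ultimately have "norm (D n) \<le> 0"
    by (intro tendsto_lowerbound[of _ 0 sequentially]) auto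
  hence "D n = 0" by simp
  thus ?case unfolding D_def c_def I_def[abs_def] by (simp only: right_minus_eq)
qed

section \<open>Characteristic functions of geometric laws\<close>

lemma norm_one_minus_cis: "norm (1 - cis y) ^ 2 = 2 * (1 - cos y)"
  unfolding cmod_power2 using sin_cos_squared_add[of y] by (simp add: power2_eq_square algebra_simps)

lemma norm_one_minus_mult_cis:
  "norm (1 - complex_of_real Q * cis y) ^ 2 = (1 - Q)\<^sup>2 + Q * norm (1 - cis y) ^ 2"
proof -
  have "norm (1 - complex_of_real Q * cis y) ^ 2 = (1 - Q * cos y)\<^sup>2 + (Q * sin y)\<^sup>2"
    unfolding cmod_power2 by simp
  also have "\<dots> = 1 - 2 * Q * cos y + Q\<^sup>2 * ((sin y)\<^sup>2 + (cos y)\<^sup>2)"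
    by algebra
  also have "\<dots> = (1 - Q)\<^sup>2 + Q * (2 * (1 - cos y))"
    by (simp add: power2_eq_square algebra_simps)
  finally show ?thesis by (simp add: norm_one_minus_cis)
qed

lemma one_minus_cos_ge:
  fixes y :: real
  assumes y: "\<bar>y\<bar> \<le> 1"
  shows "y\<^sup>2 / 4 \<le> 1 - cos y"
proof -
  have "Re (iexp y - (\<Sum>k\<le>3. (\<i> * y)^k / fact k)) = cos y - (1 - y\<^sup>2 / 2)"
    by (simp add: numeral_3_eq_3 Re_exp power2_eq_square)
  hence "cos y - (1 - y\<^sup>2 / 2) \<le> norm (iexp y - (\<Sum>k\<le>3. (\<i> * y)^k / fact k))"
    using complex_Re_le_cmod by metis
  also have "\<dots> \<le> \<bar>y\<bar>^Suc 3 / fact (Suc 3)"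
    by (rule iexp_approx1)
  also have "\<dots> = \<bar>y\<bar>^4 / 24" by (simp add: fact_numeral)
  finally have "cos y - (1 - y\<^sup>2 / 2) \<le> \<bar>y\<bar>^4 / 24" .
  moreover have "\<bar>y\<bar>^4 \<le> \<bar>y\<bar>^2" using y by (intro power_decreasing) auto
  moreover have "\<bar>y\<bar>\<^sup>2 = y\<^sup>2" "y\<^sup>2 \<ge> 0" by auto
  ultimately show ?thesis by linarith
qed

text \<open>
  The characteristic function of the law \<open>P(X = j) = (1 - Q) Q\<^sup>j\<close>.
\<close>

definition geo_char :: "real \<Rightarrow> real \<Rightarrow> complex" where
  "geo_char Q y = (1 - of_real Q) / (1 - of_real Q * cis y)"

lemma geo_denom_ge:
  assumes "0 < Q" "Q < 1"
  shows "norm (1 - complex_of_real Q * cis y) \<ge> 1 - Q"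
proof (rule power2_le_imp_le)
  show "(1 - Q)\<^sup>2 \<le> (norm (1 - complex_of_real Q * cis y))\<^sup>2"
    using assms by (simp add: norm_one_minus_mult_cis)
qed simp

lemma geo_denom_nonzero:
  assumes "0 < Q" "Q < 1"
  shows "1 - complex_of_real Q * cis y \<noteq> 0"
  using geo_denom_ge[OF assms, of y] assms by auto

lemma norm_geo_char_le_1:
  assumes "0 < Q" "Q < 1"
  shows "norm (geo_char Q y) \<le> 1"
proof -
  have "norm (1 - complex_of_real Q) = 1 - Q" using assms by (metis abs_of_pos diff_gt_0_iff_gt norm_of_real of_real_1 of_real_diff)
  thus ?thesis using geo_denom_ge[OF assms, of y] geo_denom_nonzero[OF assms, of y]
    by (simp add: geo_char_def norm_divide)
qed

lemma norm_geo_char_sq: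
  assumes "0 < Q" "Q < 1"
  shows "norm (geo_char Q y) ^ 2 = 1 / (1 + Q * norm (1 - cis y) ^ 2 / (1 - Q)\<^sup>2)"
proof -
  have "norm (1 - complex_of_real Q) = 1 - Q" using assms by (metis abs_of_pos diff_gt_0_iff_gt norm_of_real of_real_1 of_real_diff)
  hence "norm (geo_char Q y) ^ 2 = (1 - Q)\<^sup>2 / ((1 - Q)\<^sup>2 + Q * norm (1 - cis y) ^ 2)"
    by (simp add: geo_char_def norm_divide power_divide norm_one_minus_mult_cis)
  moreover have "A / (A + B) = 1 / (1 + B / A)" if "A > 0" "B \<ge> 0" for A B :: real
    using that by (simp add: field_simps)
  moreover have "(1 - Q)\<^sup>2 > 0" using assms by simp
  moreover have "Q * norm (1 - cis y) ^ 2 \<ge> 0" using assms by simp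
  ultimately show ?thesis by (simp only:)
qed

lemma norm_geo_char_le:
  assumes Q: "0 < Q" "Q < 1" and b: "0 < b" "b \<le> norm (1 - cis y)"
  shows "norm (geo_char Q y) \<le> (1 - Q) / (sqrt Q * b)"
proof (rule power2_le_imp_le)
  have "norm (geo_char Q y) ^ 2 \<le> 1 / (Q * norm (1 - cis y) ^ 2 / (1 - Q)\<^sup>2)"
    unfolding norm_geo_char_sq[OF Q] using Q b by (intro divide_left_mono mult_pos_pos divide_pos_pos add_pos_nonneg zero_less_power) auto
  also have "\<dots> \<le> 1 / (Q * b ^ 2 / (1 - Q)\<^sup>2)"
    using Q b by (intro divide_left_mono mult_pos_pos divide_pos_pos zero_less_power divide_right_mono mult_left_mono power_mono) auto
  also have "\<dots> = ((1 - Q) / (sqrt Q * b))\<^sup>2"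
    using Q by (simp add: power_divide power_mult_distrib)
  finally show "norm (geo_char Q y) ^ 2 \<le> ((1 - Q) / (sqrt Q * b))\<^sup>2" .
qed (use assms in auto)

lemma norm_exp_minus_1_le:
  fixes c :: complex
  assumes "Re c \<le> 0"
  shows "norm (exp c - 1) \<le> norm c"
proof -
  have "norm (exp c - exp 0) \<le> 1 * norm (c - 0)"
  proof (rule field_differentiable_bound[where S = "{z. Re z \<le> 0}" and f' = exp])
    show "convex {z. Re z \<le> 0}" by (rule convex_halfspace_Re_le)
  qed (use assms in \<open>auto intro!: derivative_eq_intros simp: norm_exp_eq_Re\<close>)
  thus ?thesis by simp
qed

text \<open>
  Here \<open>m\<close> is the mean and \<open>m (1 + m)\<close> the variance of the law. The point is that the error is
  of third order with a constant uniform in \<open>Q\<close> and \<open>y\<close>. For \<open>(1 + m) \<bar>y\<bar> \<ge> 1\<close> this is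
  cheap, because both terms differ from 1 by at most a multiple of the bound. Otherwise both are
  compared with one quadratic polynomial, the first as \<open>1 / (1 - w)\<close> with \<open>w = m (cis y - 1)\<close>, where \<open>\<bar>1 / (1 - w)\<bar> \<le> 1\<close>.
\<close>

lemma geo_char_gaussian_approx:
  assumes Q: "0 < Q" "Q < 1" and m: "m = Q / (1 - Q)"
  shows "norm (geo_char Q y - exp (\<i> * of_real (m * y) - of_real (m * (1 + m) * y\<^sup>2 / 2)))
    \<le> 20 * (m * (1 + m)\<^sup>2 * \<bar>y\<bar> ^ 3)"
proof -
  define w where "w = of_real m * (cis y - 1)"
  define c where "c = \<i> * of_real (m * y) - of_real (m * (1 + m) * y\<^sup>2 / 2)"
  define B where "B = m * (1 + m)\<^sup>2 * \<bar>y\<bar> ^ 3"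
  have m0: "m > 0" using Q m by simp
  have h: "geo_char Q y = 1 / (1 - w)"
  proof -
    have "1 - w = (1 - of_real Q * cis y) / (1 - of_real Q)"
      using Q unfolding w_def m by (simp add: field_simps)
    thus ?thesis by (simp add: geo_char_def)
  qed
  have w1: "1 - w \<noteq> 0"
  proof
    assume "1 - w = 0"
    hence "geo_char Q y = 0" unfolding h by simp
    thus False using geo_denom_nonzero[OF Q, of y] Q by (simp add: geo_char_def)
  qed
  have n1: "norm (1 / (1 - w)) \<le> 1" using norm_geo_char_le_1[OF Q, of y] by (simp add: h)
  have e0: "norm (cis y - 1) \<le> \<bar>y\<bar>" using iexp_approx1[of y 0] by (simp add: cis_conv_exp)
  have wb: "norm w \<le> m * \<bar>y\<bar>" unfolding w_def using e0 m0 by (simp add: norm_mult)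
  have Rec: "Re c \<le> 0" using m0 by (simp add: c_def)
  have nc: "norm c \<le> m * \<bar>y\<bar> + m * (1 + m) * y\<^sup>2 / 2"
  proof -
    have "norm c \<le> norm (\<i> * complex_of_real (m * y)) + norm (complex_of_real (m * (1 + m) * y\<^sup>2 / 2))"
      unfolding c_def by (rule norm_triangle_ineq4)
    also have "norm (\<i> * complex_of_real (m * y)) = m * \<bar>y\<bar>" using m0 by (simp add: norm_mult)
    also have "norm (complex_of_real (m * (1 + m) * y\<^sup>2 / 2)) = m * (1 + m) * y\<^sup>2 / 2"
      using m0 by (simp only: norm_of_real) (simp add: abs_mult)
    finally show ?thesis .
  qed
  have "norm (1 / (1 - w) - exp c) \<le> 20 * B"
  proof (cases "(1 + m) * \<bar>y\<bar> \<ge> 1")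
    case True
    \<comment> \<open>Here both terms differ from 1 by at most a multiple of \<open>B\<close>.\<close>
    have y2: "\<bar>y\<bar>\<^sup>2 = y\<^sup>2" by simp
    define u where "u = (1 + m) * \<bar>y\<bar>"
    have u: "u \<ge> 1" using True by (simp add: u_def)
    have B: "B = m * \<bar>y\<bar> * u\<^sup>2" by (simp add: B_def u_def power2_eq_square power3_eq_cube algebra_simps)
    have my: "m * \<bar>y\<bar> \<ge> 0" using m0 by simp
    have "m * \<bar>y\<bar> * 1 \<le> B" unfolding B using u my by (intro mult_left_mono one_le_power) auto
    moreover have "m * (1 + m) * y\<^sup>2 \<le> B"
    proof -
      have "m * (1 + m) * y\<^sup>2 = m * \<bar>y\<bar> * u" by (simp add: u_def power2_eq_square algebra_simps flip: y2)
      also have "\<dots> \<le> m * \<bar>y\<bar> * u\<^sup>2" using u my self_le_power[of u 2] by (intro mult_left_mono) auto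
      finally show ?thesis by (simp add: B)
    qed
    moreover have "norm (1 / (1 - w) - 1) \<le> m * \<bar>y\<bar>"
    proof -
      have "1 / (1 - w) - 1 = w * (1 / (1 - w))" using w1 by (simp add: field_simps)
      hence "norm (1 / (1 - w) - 1) \<le> norm w * 1" using n1 by (simp only: norm_mult) (intro mult_left_mono, auto)
      thus ?thesis using wb by simp
    qed
    moreover have "norm (exp c - 1) \<le> norm c" by (rule norm_exp_minus_1_le[OF Rec])
    moreover have "norm (1 / (1 - w) - exp c) \<le> norm (1 / (1 - w) - 1) + norm (exp c - 1)"
      using norm_triangle_ineq4[of "1 / (1 - w) - 1" "exp c - 1"] by simp
    ultimately show ?thesis using nc my by linarith
  next
    case False
    hence u1: "(1 + m) * \<bar>y\<bar> \<le> 1" by simp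
    have my: "0 \<le> m * \<bar>y\<bar>" "m * \<bar>y\<bar> \<le> (1 + m) * \<bar>y\<bar>" "\<bar>y\<bar> \<le> (1 + m) * \<bar>y\<bar>"
      using m0 by (auto simp: algebra_simps)
    define q where "q = 1 + \<i> * of_real (m * y) - of_real ((m / 2 + m\<^sup>2) * y\<^sup>2)"
    have B0: "B \<ge> 0" using m0 by (simp add: B_def)
    have Bm: "m * \<bar>y\<bar>^3 \<le> B" "m\<^sup>2 * \<bar>y\<bar>^3 \<le> B" "m ^ 3 * \<bar>y\<bar>^3 \<le> B"
    proof -
      have "B = m * \<bar>y\<bar>^3 + 2 * (m\<^sup>2 * \<bar>y\<bar>^3) + m ^ 3 * \<bar>y\<bar>^3"
        by (simp add: B_def power2_eq_square power3_eq_cube algebra_simps)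
      moreover have "0 \<le> m * \<bar>y\<bar>^3" "0 \<le> m\<^sup>2 * \<bar>y\<bar>^3" "0 \<le> m ^ 3 * \<bar>y\<bar>^3" using m0 by auto
      ultimately show "m * \<bar>y\<bar>^3 \<le> B" "m\<^sup>2 * \<bar>y\<bar>^3 \<le> B" "m ^ 3 * \<bar>y\<bar>^3 \<le> B" by linarith+
    qed
    have e1: "norm (cis y - 1 - \<i> * y) \<le> \<bar>y\<bar>\<^sup>2 / 2"
      using iexp_approx1[of y 1] by (simp add: cis_conv_exp algebra_simps numeral_2_eq_2)
    have e2: "norm (cis y - 1 - \<i> * y + of_real (y\<^sup>2 / 2)) \<le> \<bar>y\<bar>^3 / 6"
      using iexp_approx1[of y 2] by (simp add: cis_conv_exp numeral_2_eq_2 numeral_3_eq_3 power_mult_distrib algebra_simps)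
    have A1: "norm (1 / (1 - w) - (1 + w + w\<^sup>2)) \<le> m ^ 3 * \<bar>y\<bar>^3"
    proof -
      have "1 / (1 - w) - (1 + w + w\<^sup>2) = w ^ 3 * (1 / (1 - w))"
        using w1 by (simp add: field_simps power2_eq_square power3_eq_cube)
      hence "norm (1 / (1 - w) - (1 + w + w\<^sup>2)) \<le> norm w ^ 3 * 1"
        using n1 by (simp only: norm_mult norm_power) (intro mult_left_mono, auto)
      also have "\<dots> \<le> (m * \<bar>y\<bar>) ^ 3" using wb by (simp add: power_mono)
      finally show ?thesis by (simp add: power_mult_distrib)
    qed
    have A2: "norm (w - of_real m * (\<i> * y - of_real (y\<^sup>2 / 2))) \<le> m * \<bar>y\<bar>^3 / 6"
    proof -
      have "w - of_real m * (\<i> * y - of_real (y\<^sup>2 / 2)) = of_real m * (cis y - 1 - \<i> * y + of_real (y\<^sup>2 / 2))"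
        by (simp add: w_def algebra_simps)
      thus ?thesis using e2 m0 by (simp only: norm_mult) (simp add: mult_left_mono)
    qed
    have A3: "norm (w\<^sup>2 + of_real (m\<^sup>2 * y\<^sup>2)) \<le> m\<^sup>2 * \<bar>y\<bar>^3"
    proof -
      have eq: "(cis y - 1)\<^sup>2 + of_real (y\<^sup>2) = (cis y - 1 - \<i> * y) * (cis y - 1 + \<i> * y)"
        by (simp add: power2_eq_square algebra_simps)
      have "norm (cis y - 1 + \<i> * y) \<le> \<bar>y\<bar> + \<bar>y\<bar>"
        using norm_triangle_ineq[of "cis y - 1" "\<i> * y"] e0 by (simp add: norm_mult)
      hence "norm ((cis y - 1)\<^sup>2 + of_real (y\<^sup>2)) \<le> (\<bar>y\<bar>\<^sup>2 / 2) * (\<bar>y\<bar> + \<bar>y\<bar>)"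
        unfolding eq norm_mult using e1 by (intro mult_mono) auto
      also have "\<dots> = \<bar>y\<bar>^3" by (simp add: power2_eq_square power3_eq_cube)
      finally have b: "norm ((cis y - 1)\<^sup>2 + of_real (y\<^sup>2)) \<le> \<bar>y\<bar>^3" .
      have "w\<^sup>2 + of_real (m\<^sup>2 * y\<^sup>2) = of_real (m\<^sup>2) * ((cis y - 1)\<^sup>2 + of_real (y\<^sup>2))"
        unfolding w_def power_mult_distrib by (simp add: distrib_left power_mult_distrib)
      thus ?thesis using b by (simp only: norm_mult norm_of_real) (simp add: mult_left_mono)
    qed
    have A: "norm (1 / (1 - w) - q) \<le> 3 * B"
    proof -
      have "1 / (1 - w) - q = (1 / (1 - w) - (1 + w + w\<^sup>2)) + ((w - of_real m * (\<i> * y - of_real (y\<^sup>2 / 2)))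
          + (w\<^sup>2 + of_real (m\<^sup>2 * y\<^sup>2)))"
        by (simp add: q_def field_simps)
      also have "norm \<dots> \<le> norm (1 / (1 - w) - (1 + w + w\<^sup>2)) + (norm (w - of_real m * (\<i> * y - of_real (y\<^sup>2 / 2)))
          + norm (w\<^sup>2 + of_real (m\<^sup>2 * y\<^sup>2)))"
        by (intro norm_triangle_mono norm_triangle_ineq order_refl)
      finally show ?thesis using A1 A2 A3 Bm B0 by linarith
    qed
    \<comment> \<open>The same quadratic polynomial approximates the Gaussian.\<close>
    have y2: "y\<^sup>2 = \<bar>y\<bar> * \<bar>y\<bar>" by (simp add: power2_eq_square)
    have v: "m * (1 + m) * y\<^sup>2 \<le> m * \<bar>y\<bar>"
    proof -
      have "m * (1 + m) * y\<^sup>2 = m * \<bar>y\<bar> * ((1 + m) * \<bar>y\<bar>)" unfolding y2 by (simp add: algebra_simps)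
      also have "\<dots> \<le> m * \<bar>y\<bar> * 1" using u1 my by (intro mult_left_mono) auto
      finally show ?thesis by simp
    qed
    have nc2: "norm c \<le> 3 / 2 * (m * \<bar>y\<bar>)" using nc v by linarith
    have E1: "norm (exp c - (1 + c + c\<^sup>2 / 2)) \<le> 6 * B"
    proof -
      have "\<bar>Re c\<bar> \<le> 1 / 2"
      proof -
        have "\<bar>Re c\<bar> = m * (1 + m) * y\<^sup>2 / 2" using m0 by (simp add: c_def)
        thus ?thesis using v u1 my by linarith
      qed
      hence "exp \<bar>Re c\<bar> \<le> exp (1/2)" by simp
      also have "exp (1/2 :: real) \<le> 2" using exp_bound[of "1/2 :: real"] by (simp add: power2_eq_square)
      finally have "exp \<bar>Re c\<bar> \<le> 2" .
      have "norm (exp c - (\<Sum>k\<le>2. c ^ k / fact k)) \<le> exp \<bar>Re c\<bar> * norm c ^ Suc 2 / fact 2"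
        by (rule Taylor_exp)
      also have "(\<Sum>k\<le>2. c ^ k / fact k) = 1 + c + c\<^sup>2 / 2" by (simp add: numeral_2_eq_2)
      also have "exp \<bar>Re c\<bar> * norm c ^ Suc 2 / fact 2 \<le> 2 * (3 / 2 * (m * \<bar>y\<bar>)) ^ Suc 2 / fact 2"
        using nc2 \<open>exp \<bar>Re c\<bar> \<le> 2\<close> by (intro divide_right_mono mult_mono power_mono) auto
      also have "\<dots> = 27 / 8 * (m ^ 3 * \<bar>y\<bar>^3)" by (simp add: power_mult_distrib numeral_3_eq_3 power2_eq_square)
      finally show ?thesis using Bm B0 by linarith
    qed
    have E2: "norm ((1 + c + c\<^sup>2 / 2) - q) \<le> 2 * B"
    proof -
      define d where "d = m * (1 + m) * y\<^sup>2 / 2"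
      have d: "0 \<le> d" "d \<le> m * \<bar>y\<bar> / 2" using v m0 by (auto simp: d_def)
      have eq: "(1 + c + c\<^sup>2 / 2) - q = of_real d * (of_real (d / 2) - \<i> * of_real (m * y))"
        by (simp add: c_def q_def d_def power2_eq_square field_simps)
      have "norm (of_real (d / 2) - \<i> * complex_of_real (m * y)) \<le> d / 2 + m * \<bar>y\<bar>"
        using norm_triangle_ineq4[of "complex_of_real (d / 2)" "\<i> * complex_of_real (m * y)"] d m0
        by (simp add: norm_mult abs_mult)
      also have "\<dots> \<le> 2 * (m * \<bar>y\<bar>)" using d my by linarith
      finally have "norm ((1 + c + c\<^sup>2 / 2) - q) \<le> d * (2 * (m * \<bar>y\<bar>))"
        unfolding eq norm_mult using d by (intro mult_mono) auto
      also have "\<dots> = m\<^sup>2 * \<bar>y\<bar>^3 + m^3 * \<bar>y\<bar>^3" unfolding d_def y2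
        by (simp add: power2_eq_square power3_eq_cube algebra_simps)
      finally show ?thesis using Bm by linarith
    qed
    have "norm (1 / (1 - w) - exp c) \<le> norm (1 / (1 - w) - q) + (norm (exp c - (1 + c + c\<^sup>2 / 2)) + norm ((1 + c + c\<^sup>2 / 2) - q))"
    proof -
      have "1 / (1 - w) - exp c = (1 / (1 - w) - q) - ((exp c - (1 + c + c\<^sup>2 / 2)) + ((1 + c + c\<^sup>2 / 2) - q))"
        by simp
      also have "norm \<dots> \<le> norm (1 / (1 - w) - q) + norm ((exp c - (1 + c + c\<^sup>2 / 2)) + ((1 + c + c\<^sup>2 / 2) - q))"
        by (rule norm_triangle_ineq4)
      also have "\<dots> \<le> norm (1 / (1 - w) - q) + (norm (exp c - (1 + c + c\<^sup>2 / 2)) + norm ((1 + c + c\<^sup>2 / 2) - q))"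
        by (intro add_left_mono norm_triangle_ineq)
      finally show ?thesis .
    qed
    thus ?thesis using A E1 E2 B0 by linarith
  qed
  thus ?thesis by (simp add: h c_def B_def)
qed

text \<open>
  \<open>Y\<close> will be \<open>t a(k)\<close>. Everything follows from \<open>1 \<le> Y / (1 - Q) \<le> 1 + Y\<close>. The bounds place the
  contributions of \<open>k\<close> to the variance and to the third moments of the dimension between multiples
  of \<open>exp (- Y)\<close> and \<open>exp (- (Y / 2))\<close>, so that both are controlled by the same exponential sums.
\<close>

lemma geo_weight_bounds:
  fixes Y :: real
  assumes Y: "Y > 0" and Q: "Q = exp (- Y)" and m: "m = Q / (1 - Q)"
  shows "exp (- Y) \<le> Y\<^sup>2 * (m * (1 + m))"
    and "Y\<^sup>2 * (m * (1 + m)) \<le> 16 * exp (- (Y / 2))"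
    and "Y ^ 3 * (m * (1 + m)\<^sup>2) \<le> 216 * exp (- (Y / 2))"
    and "m \<le> 1 / Y"
proof -
  have Q01: "0 < Q" "Q < 1" using Y by (auto simp: Q)
  define r where "r = Y / (1 - Q)"
  have e: "exp Y \<ge> 1 + Y" by (rule exp_ge_add_one_self)
  have QY: "1 - Q \<le> Y" using exp_ge_add_one_self[of "- Y"] by (simp add: Q)
  have r1: "1 \<le> r" unfolding r_def using Q01 QY by (simp add: field_simps)
  have "Q * (1 + Y) \<le> Q * exp Y" using e Q01 by (intro mult_left_mono) auto
  also have "Q * exp Y = 1" by (simp add: Q flip: exp_add)
  finally have r2: "r \<le> 1 + Y" unfolding r_def using Q01 by (simp add: field_simps)
  have m1: "1 + m = 1 / (1 - Q)" unfolding m using Q01 by (simp add: field_simps)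
  have v: "Y\<^sup>2 * (m * (1 + m)) = Q * r\<^sup>2" unfolding m1 unfolding m r_def by (simp add: power2_eq_square)
  have th: "Y ^ 3 * (m * (1 + m)\<^sup>2) = Q * r ^ 3" unfolding m1 unfolding m r_def
    by (simp add: power2_eq_square power3_eq_cube mult_ac)
  have "Q * 1 \<le> Q * r\<^sup>2" using r1 Q01 by (intro mult_left_mono one_le_power) auto
  thus "exp (- Y) \<le> Y\<^sup>2 * (m * (1 + m))" by (simp add: v Q)
  have "1 + Y \<le> 4 * exp (Y / 4)" using exp_ge_add_one_self[of "Y / 4"] by linarith
  hence "r\<^sup>2 \<le> (4 * exp (Y / 4))\<^sup>2" using r1 r2 by (intro power_mono) auto
  hence "Q * r\<^sup>2 \<le> Q * (4 * exp (Y / 4))\<^sup>2" using Q01 by (intro mult_left_mono) auto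
  also have "\<dots> = 16 * exp (- (Y / 2))"
    by (simp add: Q power_mult_distrib flip: exp_of_nat_mult exp_add)
  finally show "Y\<^sup>2 * (m * (1 + m)) \<le> 16 * exp (- (Y / 2))" by (simp add: v)
  have "1 + Y \<le> 6 * exp (Y / 6)" using exp_ge_add_one_self[of "Y / 6"] by linarith
  hence "r ^ 3 \<le> (6 * exp (Y / 6)) ^ 3" using r1 r2 by (intro power_mono) auto
  hence "Q * r ^ 3 \<le> Q * (6 * exp (Y / 6)) ^ 3" using Q01 by (intro mult_left_mono) auto
  also have "\<dots> = 216 * exp (- (Y / 2))"
    by (simp add: Q power_mult_distrib flip: exp_of_nat_mult exp_add)
  finally show "Y ^ 3 * (m * (1 + m)\<^sup>2) \<le> 216 * exp (- (Y / 2))" by (simp add: th)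
  have "m = 1 / (exp Y - 1)" unfolding m Q using Y by (simp add: exp_minus field_simps)
  also have "\<dots> \<le> 1 / Y"
  proof -
    have "Y \<le> exp Y - 1" using e by linarith
    thus ?thesis using Y by (intro divide_left_mono mult_pos_pos) auto
  qed
  finally show "m \<le> 1 / Y" .
qed

lemma norm_geo_denom_ratio:
  assumes Q: "0 < Q" "Q < 1"
  shows "norm ((1 - complex_of_real Q * cis y) / (1 - complex_of_real Q * cis (y + s)) - 1) \<le> Q / (1 - Q) * \<bar>s\<bar>"
proof -
  let ?d = "\<lambda>y. 1 - complex_of_real Q * cis y"
  have d: "?d (y + s) \<noteq> 0" using geo_denom_nonzero[OF Q] by auto
  have "?d y = ?d (y + s) + of_real Q * (cis s - 1) * cis y"
    by (simp add: algebra_simps flip: cis_mult)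
  hence "?d y / ?d (y + s) - 1 = of_real Q * (cis s - 1) * cis y / ?d (y + s)"
    using d by (simp add: field_simps)
  hence "norm (?d y / ?d (y + s) - 1) = Q * norm (cis s - 1) / norm (?d (y + s))"
    using Q by (simp add: norm_mult norm_divide)
  also have "\<dots> \<le> Q * \<bar>s\<bar> / (1 - Q)"
  proof -
    have "norm (cis s - 1) \<le> \<bar>s\<bar>" using iexp_approx1[of s 0] by (simp add: cis_conv_exp)
    thus ?thesis using geo_denom_ge[OF Q, of "y + s"] Q
      by (intro frac_le mult_left_mono) auto
  qed
  finally show ?thesis by simp
qed

text \<open>
  A shift of the angle by \<open>s = u t\<close> costs a factor \<open>1 + O(1 / a(k))\<close>, because \<open>Q / (1 - Q) \<le> 1 / (t a(k))\<close>.
  The product of these factors over all \<open>k\<close> is bounded.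
\<close>

lemma norm_geo_char_shift:
  assumes Q: "0 < Q" "Q < 1"
  shows "norm (geo_char Q (y + s)) \<le> norm (geo_char Q y) * (1 + Q / (1 - Q) * \<bar>s\<bar>)"
proof -
  define R where "R = (1 - complex_of_real Q * cis y) / (1 - complex_of_real Q * cis (y + s))"
  have "norm R \<le> 1 + Q / (1 - Q) * \<bar>s\<bar>"
    using norm_triangle_ineq[of 1 "R - 1"] norm_geo_denom_ratio[OF Q, of y s] by (simp add: R_def)
  moreover have "geo_char Q (y + s) = geo_char Q y * R"
    using geo_denom_nonzero[OF Q] by (simp add: geo_char_def R_def)
  ultimately show ?thesis by (simp only: norm_mult) (intro mult_left_mono, auto)
qed

lemma norm_prod_le_power:
  fixes f :: "'a \<Rightarrow> 'b :: {real_normed_field}"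
  assumes "finite F" "G \<subseteq> F" "\<And>k. k \<in> F \<Longrightarrow> norm (f k) \<le> 1"
    "\<And>k. k \<in> G \<Longrightarrow> norm (f k) \<le> \<rho>"
  shows "norm (\<Prod>k\<in>F. f k) \<le> \<rho> ^ card G"
proof -
  have "norm (\<Prod>k\<in>F. f k) = (\<Prod>k\<in>F - G. norm (f k)) * (\<Prod>k\<in>G. norm (f k))"
    using assms by (subst prod_norm[symmetric], subst prod.subset_diff[of G]) auto
  also have "\<dots> \<le> 1 * (\<Prod>k\<in>G. norm (f k))"
    using assms by (intro mult_right_mono prod_le_1 prod_nonneg) auto
  also have "\<dots> \<le> (\<Prod>k\<in>G. \<rho>)" unfolding mult_1 using assms by (intro prod_mono) auto
  finally show ?thesis by simp
qed

text \<open>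
  Dominated convergence for sums over varying finite sets.
\<close>

lemma sum_finite_sets_tendsto_0:
  fixes d :: "nat \<Rightarrow> 'a \<Rightarrow> real"
  assumes F: "\<And>n. finite (F n)" "\<And>n. F n \<subseteq> W"
    and d0: "\<And>n k. k \<in> W \<Longrightarrow> d n k \<ge> 0"
    and dM: "\<And>n k. k \<in> W \<Longrightarrow> d n k \<le> M k" and M: "M summable_on W"
    and lim: "\<And>k. k \<in> W \<Longrightarrow> (\<lambda>n. d n k) \<longlonglongrightarrow> 0"
  shows "(\<lambda>n. \<Sum>k\<in>F n. d n k) \<longlonglongrightarrow> 0"
proof (rule order_tendstoI)
  have FW: "k \<in> W" if "k \<in> F n" for k n using F(2) that by blast
  show "eventually (\<lambda>n. e < (\<Sum>k\<in>F n. d n k)) sequentially" if "e < 0" for e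
  proof -
    have "0 \<le> (\<Sum>k\<in>F n. d n k)" for n using FW d0 by (intro sum_nonneg) blast
    from order_less_le_trans[OF that this] show ?thesis by simp
  qed
  fix e :: real assume e: "e > 0"
  have FW: "k \<in> W" if "k \<in> F n" for k n using F(2) that by blast
  have M0: "M k \<ge> 0" if "k \<in> W" for k using d0[OF that, of 0] dM[OF that, of 0] by linarith
  have "((\<lambda>X. \<Sum>k\<in>X. M k) \<longlongrightarrow> infsum M W) (finite_subsets_at_top W)"
    using has_sum_infsum[OF M] by (simp add: has_sum_def)
  hence "eventually (\<lambda>X. infsum M W - e / 2 < (\<Sum>k\<in>X. M k)) (finite_subsets_at_top W)"
    using e by (intro order_tendstoD) auto
  then obtain X where X: "finite X" "X \<subseteq> W" "infsum M W - e / 2 < (\<Sum>k\<in>X. M k)"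
    by (auto simp: eventually_finite_subsets_at_top)
  have "(\<lambda>n. \<Sum>k\<in>X. d n k) \<longlonglongrightarrow> (\<Sum>k\<in>X. 0)"
    using X lim by (intro tendsto_sum) auto
  hence "eventually (\<lambda>n. (\<Sum>k\<in>X. d n k) < e / 2) sequentially"
    using e by (intro order_tendstoD) auto
  thus "eventually (\<lambda>n. (\<Sum>k\<in>F n. d n k) < e) sequentially"
  proof eventually_elim
    case (elim n)
    have "(\<Sum>k\<in>F n. d n k) = (\<Sum>k\<in>F n \<inter> X. d n k) + (\<Sum>k\<in>F n - X. d n k)"
      by (rule sum.Int_Diff[OF F(1)])
    moreover have "(\<Sum>k\<in>F n \<inter> X. d n k) \<le> (\<Sum>k\<in>X. d n k)"
      using X d0 by (intro sum_mono2) auto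
    moreover have "(\<Sum>k\<in>F n - X. d n k) \<le> (\<Sum>k\<in>F n - X. M k)"
      using FW dM by (intro sum_mono) blast
    moreover have "(\<Sum>k\<in>F n - X. M k) + (\<Sum>k\<in>X. M k) = (\<Sum>k\<in>(F n - X) \<union> X. M k)"
      using F X by (subst sum.union_disjoint) auto
    moreover have "(\<Sum>k\<in>(F n - X) \<union> X. M k) \<le> infsum M W"
      using F X M0 by (intro finite_sum_le_infsum M) auto
    ultimately show ?case using elim X(3) by linarith
  qed
qed

lemma exp_minus_1_over_tendsto:
  fixes p :: "nat \<Rightarrow> complex"
  assumes t: "\<And>n. t n > 0" "t \<longlonglongrightarrow> 0" and p: "(\<lambda>n. p n / of_real (t n)) \<longlonglongrightarrow> c"
  shows "(\<lambda>n. (exp (p n) - 1) / of_real (t n)) \<longlonglongrightarrow> c"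
proof -
  have "(\<lambda>n. p n / of_real (t n) * of_real (t n)) \<longlonglongrightarrow> c * of_real 0"
    by (intro tendsto_intros p t)
  hence p0: "p \<longlonglongrightarrow> 0" using t(1) by (simp add: less_imp_neq[THEN not_sym])
  have "(\<lambda>n. exp \<bar>Re (p n)\<bar> * norm (p n / of_real (t n)) * norm (p n)) \<longlonglongrightarrow> exp \<bar>Re 0\<bar> * norm c * norm (0::complex)"
    by (intro tendsto_intros p p0)
  hence "(\<lambda>n. exp \<bar>Re (p n)\<bar> * norm (p n / of_real (t n)) * norm (p n)) \<longlonglongrightarrow> 0" by simp
  hence "(\<lambda>n. (exp (p n) - 1) / of_real (t n) - p n / of_real (t n)) \<longlonglongrightarrow> 0"
  proof (rule Lim_null_comparison[rotated], intro always_eventually allI)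
    fix n
    have "(exp (p n) - 1) / of_real (t n) - p n / of_real (t n) = (exp (p n) - (1 + p n)) / of_real (t n)"
      by (simp add: diff_divide_distrib add_divide_distrib)
    hence "norm ((exp (p n) - 1) / of_real (t n) - p n / of_real (t n)) = norm (exp (p n) - (1 + p n)) / t n"
      using t(1)[of n] by (simp add: norm_divide)
    also have "norm (exp (p n) - (1 + p n)) \<le> exp \<bar>Re (p n)\<bar> * norm (p n) ^ 2"
      using Taylor_exp[of "p n" 1] by (simp add: numeral_2_eq_2)
    finally show "norm ((exp (p n) - 1) / of_real (t n) - p n / of_real (t n)) \<le> exp \<bar>Re (p n)\<bar> * norm (p n / of_real (t n)) * norm (p n)"
      using t(1)[of n] by (simp add: norm_divide divide_right_mono power2_eq_square mult.assoc)
  qed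
  from tendsto_add[OF this p] show ?thesis by simp
qed

lemma gaussian_integrable:
  assumes "c > 0"
  shows "integrable lborel (\<lambda>x::real. exp (- (c * x\<^sup>2)))"
proof -
  define s where "s = sqrt (1 / (2 * c))"
  have "s > 0" using assms by (simp add: s_def)
  hence "integrable lborel (\<lambda>x. sqrt (2 * pi * s\<^sup>2) * normal_density 0 s x)"
    by (intro integrable_mult_right integrable_normal_density)
  moreover have "sqrt (2 * pi * s\<^sup>2) * normal_density 0 s x = exp (- (c * x\<^sup>2))" for x
    using assms by (simp add: normal_density_def s_def field_simps)
  ultimately show ?thesis by simp
qed

lemma gaussian_integral: "(\<integral>x. exp (- (x::real)\<^sup>2 / 2) \<partial>lborel) = sqrt (2 * pi)"
proof -
  have "(\<integral>x. exp (- (x::real)\<^sup>2 / 2) \<partial>lborel) = (\<integral>x. sqrt (2 * pi) * normal_density 0 1 x \<partial>lborel)"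
    by (intro Bochner_Integration.integral_cong) (auto simp: std_normal_density_def)
  thus ?thesis by (simp only: integral_mult_right_zero integral_normal_density mult_1_right)
qed

lemma tendsto_mult_cis_zero:
  assumes "(X \<longlongrightarrow> 0) G"
  shows "((\<lambda>n. X n * cis (y n)) \<longlongrightarrow> 0) G"
  by (rule tendsto_norm_zero_cancel) (use tendsto_norm_zero[OF assms] in \<open>simp add: norm_mult\<close>)

section \<open>Systems of parts\<close>

text \<open>
  The probabilistic argument uses only a few properties of the dimensions. It is carried out for
  an arbitrary family of positive integers \<open>a k\<close>, \<open>k \<in> W\<close>, the parts.
\<close>

locale summable_parts =
  fixes W :: "'k set" and a :: "'k \<Rightarrow> nat"
  assumes a_pos: "k \<in> W \<Longrightarrow> a k \<ge> 1"
    and summable_inverse: "(\<lambda>k. 1 / real (a k)) summable_on W"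
begin

definition inv_sum :: real where "inv_sum = (\<Sum>\<^sub>\<infinity>k\<in>W. 1 / real (a k))"
definition exp_sum :: "real \<Rightarrow> real" where "exp_sum t = (\<Sum>\<^sub>\<infinity>k\<in>W. exp (- (t * real (a k))))"
definition part_count :: "real \<Rightarrow> nat" where "part_count x = card {k\<in>W. real (a k) \<le> x}"

lemma a_ge_1: "k \<in> W \<Longrightarrow> real (a k) \<ge> 1"
  using a_pos[of k] by simp

lemma finite_parts_le: "finite {k\<in>W. real (a k) \<le> x}"
proof (rule finite_subset)
  show "finite {k\<in>W. 1 / real (a k) \<ge> 1 / max x 1}"
    by (rule summable_on_finite_superlevel[OF summable_inverse]) auto
  show "{k\<in>W. real (a k) \<le> x} \<subseteq> {k\<in>W. 1 / real (a k) \<ge> 1 / max x 1}"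
    using a_ge_1 by (force intro!: divide_left_mono mult_pos_pos)
qed

lemma exp_le_inverse: "t > 0 \<Longrightarrow> k \<in> W \<Longrightarrow> exp (- (t * real (a k))) \<le> (1 / t) * (1 / real (a k))"
proof -
  assume t: "t > 0" and k: "k \<in> W"
  have "t * real (a k) \<le> exp (t * real (a k))" using exp_ge_add_one_self[of "t * real (a k)"] by linarith
  hence "1 / exp (t * real (a k)) \<le> 1 / (t * real (a k))"
    using t a_ge_1[OF k] by (intro divide_left_mono mult_pos_pos) auto
  thus ?thesis by (simp add: exp_minus inverse_eq_divide)
qed

lemma exp_summable: "t > 0 \<Longrightarrow> (\<lambda>k. exp (- (t * real (a k)))) summable_on W"
  by (rule summable_on_comparison_test[OF summable_on_cmult_right[OF summable_inverse, of "1 / t"]])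
     (rule exp_le_inverse, auto)

lemma exp_sum_le: "t > 0 \<Longrightarrow> exp_sum t \<le> inv_sum / t"
proof -
  assume t: "t > 0"
  have "exp_sum t \<le> (\<Sum>\<^sub>\<infinity>k\<in>W. (1 / t) * (1 / real (a k)))"
    unfolding exp_sum_def by (intro infsum_mono exp_summable summable_on_cmult_right summable_inverse exp_le_inverse t)
  also have "\<dots> = inv_sum / t" unfolding inv_sum_def by (subst infsum_cmult_right') auto
  finally show ?thesis .
qed

lemma sum_le_exp_sum: "t > 0 \<Longrightarrow> finite F \<Longrightarrow> F \<subseteq> W \<Longrightarrow> (\<Sum>k\<in>F. exp (- (t * real (a k)))) \<le> exp_sum t"
  unfolding exp_sum_def by (intro finite_sum_le_infsum exp_summable) auto

lemma exp_sum_ge: "t > 0 \<Longrightarrow> exp (- (t * x)) * real (part_count x) \<le> exp_sum t"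
proof -
  assume t: "t > 0"
  have "exp (- (t * x)) * real (part_count x) = (\<Sum>k\<in>{k\<in>W. real (a k) \<le> x}. exp (- (t * x)))" by (simp add: part_count_def)
  also have "\<dots> \<le> (\<Sum>k\<in>{k\<in>W. real (a k) \<le> x}. exp (- (t * real (a k))))"
    using t by (intro sum_mono) auto
  also have "\<dots> \<le> exp_sum t" using t by (intro sum_le_exp_sum finite_parts_le) auto
  finally show ?thesis .
qed

lemma exp_sum_nonneg: "exp_sum t \<ge> 0" unfolding exp_sum_def by (intro infsum_nonneg) auto

end

text \<open>
  \<open>exp_sum t\<close> is a smooth version of the number of parts up to \<open>1 / t\<close>, and \<open>doubling\<close> is what
  makes variance, third moments and counts of parts all of the same order \<open>exp_sum t\<close>, up to powers
  of \<open>t\<close>. \<open>growth\<close> makes this order polynomially large. \<open>aperiodic\<close> says that, even after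
  finitely many parts are discarded, for every \<open>\<theta>\<close> one of finitely many angles \<open>a k * \<theta>\<close> is away from the
  multiples of \<open>2 * pi\<close> by at least a fixed multiple of the distance of \<open>\<theta>\<close> itself.
\<close>

locale part_system = summable_parts W a for W :: "'k set" and a +
  assumes doubling: "\<exists>K. \<forall>t. 0 < t \<longrightarrow> t \<le> 1 \<longrightarrow> exp_sum (t / 2) \<le> K * exp_sum t"
    and growth: "\<exists>c>0. \<exists>\<beta>>0. \<forall>x\<ge>1. c * x powr \<beta> \<le> real (part_count x)"
    and aperiodic: "finite G0 \<Longrightarrow> \<exists>G \<eta>. finite G \<and> G \<subseteq> W - G0 \<and> \<eta> > 0 \<and>
      (\<forall>\<theta>. \<exists>k\<in>G. \<eta> * norm (cis \<theta> - 1) \<le> norm (cis (real (a k) * \<theta>) - 1))"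
begin

text \<open>
  Parts above \<open>L / t\<close> contribute at most \<open>exp (- (L / 2)) * exp_sum (t / 2)\<close> to \<open>exp_sum t\<close>. By
  doubling this is at most one half of \<open>exp_sum t\<close> once \<open>L\<close> is large, and then the parts up to
  \<open>L / t\<close> account for the other half.
\<close>

lemma scale_constants:
  obtains L K where "L \<ge> 1" "K > 0" "\<And>t. 0 < t \<Longrightarrow> t \<le> 1 \<Longrightarrow> exp_sum (t / 2) \<le> K * exp_sum t"
    "\<And>t. 0 < t \<Longrightarrow> t \<le> 1 \<Longrightarrow> exp_sum t \<le> 2 * real (part_count (L / t))"
proof -
  obtain K0 where K0: "\<And>t. 0 < t \<Longrightarrow> t \<le> 1 \<Longrightarrow> exp_sum (t / 2) \<le> K0 * exp_sum t"
    using doubling by blast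
  define K where "K = max K0 1"
  have K: "K > 0" "\<And>t. 0 < t \<Longrightarrow> t \<le> 1 \<Longrightarrow> exp_sum (t / 2) \<le> K * exp_sum t"
    using exp_sum_nonneg unfolding K_def by (auto intro!: order_trans[OF K0] mult_right_mono)
  \<comment> \<open>\<open>L\<close> is chosen so that \<open>exp (- (L / 2)) * K \<le> 1 / 2\<close>.\<close>
  define L where "L = max 1 (2 * ln (2 * K))"
  have "exp (- (L / 2)) \<le> exp (- ln (2 * K))" by (simp add: L_def)
  also have "\<dots> = 1 / (2 * K)" using K by (simp add: exp_minus inverse_eq_divide)
  finally have eL: "exp (- (L / 2)) * K \<le> 1 / 2" using K by (simp add: field_simps)
  have "exp_sum t \<le> 2 * real (part_count (L / t))" if t: "0 < t" "t \<le> 1" for t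
  proof -
    let ?G = "{k\<in>W. real (a k) \<le> L / t}"
    have "exp_sum t = (\<Sum>k\<in>?G. exp (- (t * real (a k)))) + (\<Sum>\<^sub>\<infinity>k\<in>W - ?G. exp (- (t * real (a k))))"
    proof -
      have "exp_sum t = (\<Sum>\<^sub>\<infinity>k\<in>?G \<union> (W - ?G). exp (- (t * real (a k))))"
        unfolding exp_sum_def by (rule arg_cong[where f = "infsum _"]) auto
      also have "\<dots> = (\<Sum>\<^sub>\<infinity>k\<in>?G. exp (- (t * real (a k)))) + (\<Sum>\<^sub>\<infinity>k\<in>W - ?G. exp (- (t * real (a k))))"
        using t by (intro infsum_Un_disjoint summable_on_subset_banach[OF exp_summable[of t]]) auto
      finally show ?thesis using finite_parts_le by simp
    qed
    also have "(\<Sum>k\<in>?G. exp (- (t * real (a k)))) \<le> (\<Sum>k\<in>?G. 1)" using t by (intro sum_mono) auto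
    also have "(\<Sum>k\<in>?G. (1::real)) = real (part_count (L / t))" by (simp add: part_count_def)
    also have "(\<Sum>\<^sub>\<infinity>k\<in>W - ?G. exp (- (t * real (a k)))) \<le> (\<Sum>\<^sub>\<infinity>k\<in>W - ?G. exp (- (L / 2)) * exp (- (t / 2 * real (a k))))"
    proof (rule infsum_mono)
      show "exp (- (t * real (a k))) \<le> exp (- (L / 2)) * exp (- (t / 2 * real (a k)))" if "k \<in> W - ?G" for k
        using that t by (auto simp: field_simps simp flip: exp_add)
      show "(\<lambda>k. exp (- (L / 2)) * exp (- (t / 2 * real (a k)))) summable_on (W - ?G)"
        using t by (intro summable_on_cmult_right summable_on_subset_banach[OF exp_summable]) auto
      show "(\<lambda>k. exp (- (t * real (a k)))) summable_on (W - ?G)"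
        using t by (intro summable_on_subset_banach[OF exp_summable]) auto
    qed
    also have "\<dots> = exp (- (L / 2)) * (\<Sum>\<^sub>\<infinity>k\<in>W - ?G. exp (- (t / 2 * real (a k))))"
      by (rule infsum_cmult_right')
    also have "(\<Sum>\<^sub>\<infinity>k\<in>W - ?G. exp (- (t / 2 * real (a k)))) \<le> exp_sum (t / 2)"
      unfolding exp_sum_def
    proof (rule infsum_mono_neutral)
      show "(\<lambda>k. exp (- (t / 2 * real (a k)))) summable_on (W - ?G)"
        using t by (intro summable_on_subset_banach[OF exp_summable]) auto
      show "(\<lambda>k. exp (- (t / 2 * real (a k)))) summable_on W" using t by (intro exp_summable) auto
    qed auto
    also have "exp_sum (t / 2) \<le> K * exp_sum t" using K t by auto
    finally have "exp_sum t \<le> real (part_count (L / t)) + exp (- (L / 2)) * (K * exp_sum t)" by (simp add: mult_left_mono)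
    also have "exp (- (L / 2)) * (K * exp_sum t) \<le> 1 / 2 * exp_sum t"
      unfolding mult.assoc[symmetric] by (intro mult_right_mono eL exp_sum_nonneg)
    finally show ?thesis by simp
  qed
  thus thesis using that[of L K] K by (auto simp: L_def)
qed

text \<open>
  In the unconditioned model with parameter \<open>q = exp (- t)\<close> the multiplicity of \<open>k\<close> is geometric
  with ratio \<open>q\<^bsup>a k\<^esup>\<close>. The definitions are this ratio, the mean multiplicity, the
  variance of the total of the parts in \<open>F\<close>, and the joint characteristic function of this total
  (at \<open>\<theta>\<close>) and of \<open>t\<close> times the number of parts (at \<open>u\<close>).
\<close>

definition weight :: "real \<Rightarrow> 'k \<Rightarrow> real" where "weight t k = exp (- (t * real (a k)))"
definition mean_mult :: "real \<Rightarrow> 'k \<Rightarrow> real" where "mean_mult t k = weight t k / (1 - weight t k)"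
definition dim_var :: "real \<Rightarrow> 'k set \<Rightarrow> real" where
  "dim_var t F = (\<Sum>k\<in>F. (real (a k))\<^sup>2 * (mean_mult t k * (1 + mean_mult t k)))"
definition char_fn :: "real \<Rightarrow> 'k set \<Rightarrow> real \<Rightarrow> real \<Rightarrow> complex" where
  "char_fn t F u \<theta> = (\<Prod>k\<in>F. geo_char (weight t k) (real (a k) * \<theta> + u * t))"

lemma weight_in_01: "t > 0 \<Longrightarrow> k \<in> W \<Longrightarrow> 0 < weight t k \<and> weight t k < 1"
  using a_ge_1[of k] by (auto simp: weight_def)

lemma mean_mult_bounds:
  assumes t: "t > 0" and k: "k \<in> W"
  shows "exp (- (t * real (a k))) / t\<^sup>2 \<le> (real (a k))\<^sup>2 * (mean_mult t k * (1 + mean_mult t k))"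
    and "(real (a k))\<^sup>2 * (mean_mult t k * (1 + mean_mult t k)) \<le> 16 * exp (- (t / 2 * real (a k))) / t\<^sup>2"
    and "real (a k) ^ 3 * (mean_mult t k * (1 + mean_mult t k)\<^sup>2) \<le> 216 * exp (- (t / 2 * real (a k))) / t ^ 3"
    and "mean_mult t k \<le> 1 / (t * real (a k))" and "mean_mult t k > 0"
proof -
  have Y: "t * real (a k) > 0" using t a_ge_1[OF k] by simp
  note b = geo_weight_bounds[OF Y refl refl, folded weight_def mean_mult_def]
  show "exp (- (t * real (a k))) / t\<^sup>2 \<le> (real (a k))\<^sup>2 * (mean_mult t k * (1 + mean_mult t k))"
    using b(1) t unfolding weight_def by (simp add: field_simps power_mult_distrib)
  show "(real (a k))\<^sup>2 * (mean_mult t k * (1 + mean_mult t k)) \<le> 16 * exp (- (t / 2 * real (a k))) / t\<^sup>2"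
    using b(2) t by (simp add: field_simps power_mult_distrib)
  show "real (a k) ^ 3 * (mean_mult t k * (1 + mean_mult t k)\<^sup>2) \<le> 216 * exp (- (t / 2 * real (a k))) / t ^ 3"
    using b(3) t by (simp add: field_simps power_mult_distrib)
  show "mean_mult t k \<le> 1 / (t * real (a k))" by (rule b(4))
  show "mean_mult t k > 0" using weight_in_01[OF t k] by (simp add: mean_mult_def)
qed

lemma third_moment_sum_le:
  assumes t: "t > 0" and F: "finite F" "F \<subseteq> W"
  shows "(\<Sum>k\<in>F. real (a k) ^ 3 * (mean_mult t k * (1 + mean_mult t k)\<^sup>2)) \<le> 216 * exp_sum (t / 2) / t ^ 3"
proof -
  have "(\<Sum>k\<in>F. real (a k) ^ 3 * (mean_mult t k * (1 + mean_mult t k)\<^sup>2)) \<le> (\<Sum>k\<in>F. 216 * exp (- (t / 2 * real (a k))) / t ^ 3)"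
    using F t by (intro sum_mono mean_mult_bounds) auto
  also have "\<dots> = 216 * (\<Sum>k\<in>F. exp (- (t / 2 * real (a k)))) / t ^ 3"
    by (simp add: sum_distrib_left sum_divide_distrib)
  also have "\<dots> \<le> 216 * exp_sum (t / 2) / t ^ 3"
    using t F by (intro divide_right_mono mult_left_mono sum_le_exp_sum) auto
  finally show ?thesis .
qed

lemma dim_var_le:
  assumes t: "t > 0" and F: "finite F" "F \<subseteq> W"
  shows "dim_var t F \<le> 16 * exp_sum (t / 2) / t\<^sup>2"
proof -
  have "dim_var t F \<le> (\<Sum>k\<in>F. 16 * exp (- (t / 2 * real (a k))) / t\<^sup>2)"
    unfolding dim_var_def using F t by (intro sum_mono mean_mult_bounds) auto
  also have "\<dots> = 16 * (\<Sum>k\<in>F. exp (- (t / 2 * real (a k)))) / t\<^sup>2"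
    by (simp add: sum_distrib_left sum_divide_distrib)
  also have "\<dots> \<le> 16 * exp_sum (t / 2) / t\<^sup>2"
    using t F by (intro divide_right_mono mult_left_mono sum_le_exp_sum) auto
  finally show ?thesis .
qed

lemma dim_var_ge:
  assumes t: "t > 0" and F: "finite F" "F \<subseteq> W" "{k\<in>W. real (a k) \<le> x} \<subseteq> F"
  shows "exp (- (t * x)) * real (part_count x) / t\<^sup>2 \<le> dim_var t F"
proof -
  have "exp (- (t * x)) * real (part_count x) / t\<^sup>2 = (\<Sum>k\<in>{k\<in>W. real (a k) \<le> x}. exp (- (t * x)) / t\<^sup>2)" by (simp add: part_count_def)
  also have "\<dots> \<le> (\<Sum>k\<in>{k\<in>W. real (a k) \<le> x}. (real (a k))\<^sup>2 * (mean_mult t k * (1 + mean_mult t k)))"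
  proof (rule sum_mono)
    fix k assume k: "k \<in> {k\<in>W. real (a k) \<le> x}"
    have "exp (- (t * x)) / t\<^sup>2 \<le> exp (- (t * real (a k))) / t\<^sup>2" using k t by (intro divide_right_mono) auto
    also have "\<dots> \<le> (real (a k))\<^sup>2 * (mean_mult t k * (1 + mean_mult t k))" using k t by (intro mean_mult_bounds) auto
    finally show "exp (- (t * x)) / t\<^sup>2 \<le> (real (a k))\<^sup>2 * (mean_mult t k * (1 + mean_mult t k))" .
  qed
  also have "\<dots> \<le> dim_var t F" unfolding dim_var_def
    using F t mean_mult_bounds(5)[OF t] by (intro sum_mono2) (force intro!: mult_nonneg_nonneg simp: less_imp_le)+
  finally show ?thesis .
qed

lemma norm_char_fn_twist:
  assumes t: "t > 0" and F: "finite F" "F \<subseteq> W"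
  shows "norm (char_fn t F u \<theta>) \<le> norm (char_fn t F 0 \<theta>) * exp (\<bar>u\<bar> * inv_sum)"
proof -
  have "norm (char_fn t F u \<theta>) \<le> (\<Prod>k\<in>F. norm (geo_char (weight t k) (real (a k) * \<theta>)) * (1 + \<bar>u\<bar> * (1 / real (a k))))"
    unfolding char_fn_def prod_norm[symmetric]
  proof (rule prod_mono, intro conjI)
    fix k assume "k \<in> F"
    hence k: "k \<in> W" using F by auto
    have "norm (geo_char (weight t k) (real (a k) * \<theta> + u * t)) \<le>
       norm (geo_char (weight t k) (real (a k) * \<theta>)) * (1 + mean_mult t k * \<bar>u * t\<bar>)"
      using weight_in_01[OF t k] unfolding mean_mult_def by (intro norm_geo_char_shift) auto
    also have "\<dots> \<le> norm (geo_char (weight t k) (real (a k) * \<theta>)) * (1 + \<bar>u\<bar> * (1 / real (a k)))"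
    proof -
      have "mean_mult t k * \<bar>u * t\<bar> \<le> 1 / (t * real (a k)) * \<bar>u * t\<bar>" using mean_mult_bounds(4)[OF t k] by (intro mult_right_mono) auto
      also have "\<dots> = \<bar>u\<bar> * (1 / real (a k))" using t by (simp add: abs_mult)
      finally show ?thesis by (intro mult_left_mono add_left_mono) auto
    qed
    finally show "norm (geo_char (weight t k) (real (a k) * \<theta> + u * t)) \<le>
       norm (geo_char (weight t k) (real (a k) * \<theta>)) * (1 + \<bar>u\<bar> * (1 / real (a k)))" .
  qed auto
  also have "\<dots> = norm (char_fn t F 0 \<theta>) * (\<Prod>k\<in>F. 1 + \<bar>u\<bar> * (1 / real (a k)))"
    by (simp add: char_fn_def prod.distrib prod_norm)
  also have "(\<Prod>k\<in>F. 1 + \<bar>u\<bar> * (1 / real (a k))) \<le> (\<Prod>k\<in>F. exp (\<bar>u\<bar> * (1 / real (a k))))"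
    by (intro prod_mono conjI exp_ge_add_one_self) auto
  also have "\<dots> = exp (\<bar>u\<bar> * (\<Sum>k\<in>F. 1 / real (a k)))"
    using F by (simp add: exp_sum sum_distrib_left)
  also have "\<dots> \<le> exp (\<bar>u\<bar> * inv_sum)"
    unfolding inv_sum_def using F by (auto intro!: mult_left_mono finite_sum_le_infsum summable_inverse)
  finally show ?thesis by (simp add: mult_left_mono)
qed

lemma norm_factor_small_angle:
  assumes t: "t > 0" and k: "k \<in> W" and y: "\<bar>real (a k) * \<theta>\<bar> \<le> 1" and b: "t * real (a k) \<le> b"
  shows "norm (geo_char (weight t k) (real (a k) * \<theta>)) ^ 2 \<le> 1 / (1 + exp (- b) / 2 * (\<theta>\<^sup>2 / t\<^sup>2))"
proof -
  let ?Q = "weight t k" and ?a = "real (a k)"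
  have Q: "0 < ?Q" "?Q < 1" using weight_in_01[OF t k] by auto
  have QY: "1 - ?Q \<le> t * ?a" using exp_ge_add_one_self[of "- (t * ?a)"] by (simp add: weight_def)
  have "exp (- b) / 2 * (\<theta>\<^sup>2 / t\<^sup>2) = exp (- b) * ((?a * \<theta>)\<^sup>2 / 2) / (t * ?a)\<^sup>2"
    using a_ge_1[OF k] t by (simp add: power_mult_distrib field_simps)
  also have "\<dots> \<le> ?Q * norm (1 - cis (?a * \<theta>)) ^ 2 / (1 - ?Q)\<^sup>2"
  proof (rule frac_le)
    show "exp (- b) * ((?a * \<theta>)\<^sup>2 / 2) \<le> ?Q * norm (1 - cis (?a * \<theta>)) ^ 2"
      using one_minus_cos_ge[OF y] b unfolding norm_one_minus_cis weight_def by (intro mult_mono) auto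
    show "(1 - ?Q)\<^sup>2 \<le> (t * ?a)\<^sup>2" using QY Q by (intro power_mono) auto
  qed (use Q in auto)
  finally have le: "exp (- b) / 2 * (\<theta>\<^sup>2 / t\<^sup>2) \<le> ?Q * norm (1 - cis (?a * \<theta>)) ^ 2 / (1 - ?Q)\<^sup>2" .
  have "0 \<le> exp (- b) / 2 * (\<theta>\<^sup>2 / t\<^sup>2)" by simp
  moreover have "0 \<le> ?Q * norm (1 - cis (?a * \<theta>)) ^ 2 / (1 - ?Q)\<^sup>2" using Q by simp
  ultimately show ?thesis unfolding norm_geo_char_sq[OF Q] using le by (intro divide_left_mono mult_pos_pos add_pos_nonneg) auto
qed

text \<open>
  For \<open>\<bar>\<theta>\<bar> \<le> t / L\<close> the angles \<open>a k * \<theta>\<close> of all parts up to \<open>L / t\<close> are at most 1, so each of these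
  parts contributes a Gaussian factor.
\<close>

lemma norm_char_fn_inner:
  assumes t: "0 < t" "t \<le> 1" and L: "L \<ge> 1" and F: "finite F" "F \<subseteq> W" "{k\<in>W. real (a k) \<le> L / t} \<subseteq> F"
    and \<theta>: "\<bar>\<theta>\<bar> \<le> t / L"
  shows "norm (char_fn t F 0 \<theta>) \<le> exp (- (exp (- L) / 8 * (\<theta>\<^sup>2 / t\<^sup>2) * real (part_count (L / t))))"
proof -
  define x where "x = exp (- L) / 2 * (\<theta>\<^sup>2 / t\<^sup>2)"
  have x0: "x \<ge> 0" by (simp add: x_def)
  have "\<bar>\<theta>\<bar> \<le> t" using \<theta> divide_left_mono[of 1 L t] t L by simp
  hence "\<theta>\<^sup>2 \<le> t\<^sup>2" using t by (simp add: abs_le_square_iff[symmetric])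
  hence r: "\<theta>\<^sup>2 / t\<^sup>2 \<le> 1" using t by simp
  have e1: "exp (- L) \<le> 1" using L by simp
  have e2: "exp (- L) / 2 \<le> 1" using e1 by linarith
  have "exp (- L) / 2 * (\<theta>\<^sup>2 / t\<^sup>2) \<le> 1 * 1" by (rule mult_mono[OF e2 r]) auto
  hence x1: "x \<le> 1" by (simp add: x_def)
  have ex: "exp (x / 2) \<le> 1 + x"
  proof -
    have "exp (x / 2) \<le> 1 + x / 2 + (x / 2)\<^sup>2" using x0 x1 by (intro exp_bound) auto
    also have "(x / 2)\<^sup>2 \<le> x / 2" using x0 x1 power_decreasing[of 1 2 "x / 2"] by simp
    finally show ?thesis by simp
  qed
  have "norm (char_fn t F 0 \<theta>) \<le> exp (- (x / 4)) ^ card {k\<in>W. real (a k) \<le> L / t}"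
    unfolding char_fn_def
  proof (rule norm_prod_le_power)
    show "norm (geo_char (weight t k) (real (a k) * \<theta> + 0 * t)) \<le> 1" if "k \<in> F" for k
      using weight_in_01[OF t(1), of k] that F by (intro norm_geo_char_le_1) auto
    fix k assume k: "k \<in> {k\<in>W. real (a k) \<le> L / t}"
    have "\<bar>real (a k) * \<theta>\<bar> \<le> (L / t) * (t / L)" unfolding abs_mult using k \<theta> t L by (intro mult_mono) auto
    also have "\<dots> = 1" using t L by simp
    finally have y: "\<bar>real (a k) * \<theta>\<bar> \<le> 1" .
    have b: "t * real (a k) \<le> L" using k t by (simp add: field_simps)
    have "norm (geo_char (weight t k) (real (a k) * \<theta>)) ^ 2 \<le> 1 / (1 + x)"
      unfolding x_def using k by (intro norm_factor_small_angle t y b) auto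
    also have "\<dots> \<le> 1 / exp (x / 2)" using ex x0 by (intro divide_left_mono) auto
    also have "\<dots> = exp (- (x / 4)) ^ 2" by (simp add: exp_minus inverse_eq_divide power_one_over flip: exp_of_nat_mult)
    finally have "norm (geo_char (weight t k) (real (a k) * \<theta>)) \<le> exp (- (x / 4))" by (rule power2_le_imp_le) simp
    thus "norm (geo_char (weight t k) (real (a k) * \<theta> + 0 * t)) \<le> exp (- (x / 4))" by simp
  qed (use F in auto)
  also have "\<dots> = exp (- (exp (- L) / 8 * (\<theta>\<^sup>2 / t\<^sup>2) * real (part_count (L / t))))"
    by (simp add: part_count_def x_def mult_ac flip: exp_of_nat_mult)
  finally show ?thesis .
qed

text \<open>
  For larger \<open>\<theta>\<close> only the parts up to \<open>1 / sqrt t\<close> are sure not to wrap around; each of them gives a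
  constant factor below 1, and their number is polynomially large.
\<close>

lemma norm_char_fn_middle:
  assumes t: "0 < t" "t \<le> 1" and L: "L \<ge> 1" and F: "finite F" "F \<subseteq> W" "{k\<in>W. real (a k) \<le> 1 / sqrt t} \<subseteq> F"
    and \<theta>: "t / L \<le> \<bar>\<theta>\<bar>" "\<bar>\<theta>\<bar> \<le> sqrt t"
  shows "norm (char_fn t F 0 \<theta>) \<le> exp (- (ln (1 + exp (- 1) / (2 * L\<^sup>2)) / 2 * real (part_count (1 / sqrt t))))"
proof -
  define x where "x = exp (- 1) / (2 * L\<^sup>2)"
  have x0: "x > 0" using L by (simp add: x_def)
  define d where "d = ln (1 + x) / 2"
  have "norm (char_fn t F 0 \<theta>) \<le> exp (- d) ^ card {k\<in>W. real (a k) \<le> 1 / sqrt t}"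
    unfolding char_fn_def
  proof (rule norm_prod_le_power)
    show "norm (geo_char (weight t k) (real (a k) * \<theta> + 0 * t)) \<le> 1" if "k \<in> F" for k
      using weight_in_01[OF t(1), of k] that F by (intro norm_geo_char_le_1) auto
    fix k assume k: "k \<in> {k\<in>W. real (a k) \<le> 1 / sqrt t}"
    have "\<bar>real (a k) * \<theta>\<bar> \<le> (1 / sqrt t) * sqrt t" unfolding abs_mult using k \<theta> t by (intro mult_mono) auto
    also have "\<dots> = 1" using t by simp
    finally have y: "\<bar>real (a k) * \<theta>\<bar> \<le> 1" .
    have "t * real (a k) \<le> t * (1 / sqrt t)" using k t by (intro mult_left_mono) auto
    also have "\<dots> = sqrt t" using t by (simp add: real_div_sqrt)
    also have "\<dots> \<le> 1" using t by simp
    finally have b: "t * real (a k) \<le> 1" .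
    have "(t / L)\<^sup>2 \<le> \<theta>\<^sup>2" using \<theta> t L by (subst power2_abs[symmetric, of \<theta>]) (intro power_mono, auto)
    hence "1 / L\<^sup>2 \<le> \<theta>\<^sup>2 / t\<^sup>2" using t L by (simp add: field_simps power_divide)
    hence "exp (- 1) / 2 * (1 / L\<^sup>2) \<le> exp (- 1) / 2 * (\<theta>\<^sup>2 / t\<^sup>2)" by (intro mult_left_mono) auto
    hence xx: "x \<le> exp (- 1) / 2 * (\<theta>\<^sup>2 / t\<^sup>2)" by (simp add: x_def)
    have "norm (geo_char (weight t k) (real (a k) * \<theta>)) ^ 2 \<le> 1 / (1 + exp (- 1) / 2 * (\<theta>\<^sup>2 / t\<^sup>2))"
      using k by (intro norm_factor_small_angle t y b) auto
    also have "\<dots> \<le> 1 / (1 + x)" using xx x0 by (intro divide_left_mono mult_pos_pos add_pos_nonneg) auto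
    also have "\<dots> = exp (- d) ^ 2" using x0 by (simp add: d_def exp_minus inverse_eq_divide power_one_over flip: exp_of_nat_mult)
    finally have "norm (geo_char (weight t k) (real (a k) * \<theta>)) \<le> exp (- d)" by (rule power2_le_imp_le) simp
    thus "norm (geo_char (weight t k) (real (a k) * \<theta> + 0 * t)) \<le> exp (- d)" by simp
  qed (use F in auto)
  also have "\<dots> = exp (- (d * real (part_count (1 / sqrt t))))"
    by (simp add: part_count_def mult_ac flip: exp_of_nat_mult)
  finally show ?thesis by (simp add: d_def x_def)
qed

text \<open>
  Aperiodicity can be used repeatedly, each time avoiding the parts found before.
\<close>

lemma many_aperiodic:
  "\<exists>G \<eta>. finite G \<and> G \<subseteq> W \<and> \<eta> > 0 \<and>
    (\<forall>\<theta>. \<exists>X. X \<subseteq> G \<and> card X = J \<and> (\<forall>k\<in>X. \<eta> * norm (cis \<theta> - 1) \<le> norm (cis (real (a k) * \<theta>) - 1)))"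
proof (induction J)
  case 0
  show ?case by (intro exI[of _ "{}"] exI[of _ 1]) auto
next
  case (Suc J)
  then obtain G \<eta> where G: "finite G" "G \<subseteq> W" "\<eta> > 0"
    "\<And>\<theta>. \<exists>X. X \<subseteq> G \<and> card X = J \<and> (\<forall>k\<in>X. \<eta> * norm (cis \<theta> - 1) \<le> norm (cis (real (a k) * \<theta>) - 1))"
    by blast
  obtain G' \<eta>' where G': "finite G'" "G' \<subseteq> W - G" "\<eta>' > 0"
    "\<And>\<theta>. \<exists>k\<in>G'. \<eta>' * norm (cis \<theta> - 1) \<le> norm (cis (real (a k) * \<theta>) - 1)"
    using aperiodic[OF G(1)] by blast
  define e where "e = min \<eta> \<eta>'"
  have e: "e * norm (cis \<theta> - 1) \<le> \<eta> * norm (cis \<theta> - 1)" "e * norm (cis \<theta> - 1) \<le> \<eta>' * norm (cis \<theta> - 1)" for \<theta>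
    by (auto simp: e_def intro!: mult_right_mono)
  have "\<exists>X. X \<subseteq> G \<union> G' \<and> card X = Suc J \<and> (\<forall>k\<in>X. e * norm (cis \<theta> - 1) \<le> norm (cis (real (a k) * \<theta>) - 1))" for \<theta>
  proof -
    obtain X where X: "X \<subseteq> G" "card X = J" "\<forall>k\<in>X. \<eta> * norm (cis \<theta> - 1) \<le> norm (cis (real (a k) * \<theta>) - 1)"
      using G(4) by blast
    obtain k where k: "k \<in> G'" "\<eta>' * norm (cis \<theta> - 1) \<le> norm (cis (real (a k) * \<theta>) - 1)" using G'(4) by blast
    have "finite X" "k \<notin> X" using X(1) G(1) k G'(2) finite_subset by auto
    thus ?thesis using X k e[of \<theta>] by (intro exI[of _ "insert k X"]) (auto intro: order_trans)
  qed
  thus ?case using G G' by (intro exI[of _ "G \<union> G'"] exI[of _ e]) (auto simp: e_def)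
qed

lemma norm_cis_minus_1_ge:
  assumes "0 < t" "t \<le> 1" "sqrt t \<le> \<bar>\<theta>\<bar>" "\<bar>\<theta>\<bar> \<le> pi"
  shows "sqrt (t / 2) \<le> norm (cis \<theta> - 1)"
proof (rule power2_le_imp_le)
  have "cos \<bar>\<theta>\<bar> \<le> cos (sqrt t)" using assms by (intro cos_monotone_0_pi_le) auto
  moreover have "(sqrt t)\<^sup>2 / 4 \<le> 1 - cos (sqrt t)" using assms by (intro one_minus_cos_ge) auto
  ultimately have "t / 4 \<le> 1 - cos \<theta>" using assms by simp
  thus "(sqrt (t / 2))\<^sup>2 \<le> (norm (cis \<theta> - 1))\<^sup>2"
    using assms by (simp add: norm_minus_commute[of "cis \<theta>"] norm_one_minus_cis)
qed simp

text \<open>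
  A part of bounded size whose angle is away from the multiples of \<open>2 * pi\<close> by at least a multiple of
  \<open>\<bar>\<theta>\<bar>\<close> gives a factor \<open>O(t / \<bar>\<theta>\<bar>) = O(sqrt t)\<close>. Four such parts give \<open>t\<^sup>2\<close>, which beats the
  size \<open>t powr (- 3 / 2)\<close> of the standard deviation; three would only match it.
\<close>

lemma norm_char_fn_outer:
  "\<exists>B C. \<forall>t F \<theta>. 0 < t \<longrightarrow> t \<le> 1 \<longrightarrow> finite F \<longrightarrow> F \<subseteq> W \<longrightarrow> {k\<in>W. real (a k) \<le> B} \<subseteq> F \<longrightarrow>
     sqrt t \<le> \<bar>\<theta>\<bar> \<longrightarrow> \<bar>\<theta>\<bar> \<le> pi \<longrightarrow> norm (char_fn t F 0 \<theta>) \<le> C * t\<^sup>2"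
proof -
  obtain G \<eta> where G: "finite G" "G \<subseteq> W" "\<eta> > 0"
    "\<And>\<theta>. \<exists>X. X \<subseteq> G \<and> card X = 4 \<and> (\<forall>k\<in>X. \<eta> * norm (cis \<theta> - 1) \<le> norm (cis (real (a k) * \<theta>) - 1))"
    using many_aperiodic[of 4] by blast
  define B where "B = real (\<Sum>k\<in>G. a k)"
  have GB: "real (a k) \<le> B" if "k \<in> G" for k
    unfolding B_def of_nat_le_iff using G(1) that by (intro member_le_sum) auto
  have B0: "B \<ge> 0" by (simp add: B_def sum_nonneg)
  define c where "c = B * exp (B / 2) * sqrt 2 / \<eta>"
  have c0: "c \<ge> 0" using B0 G by (simp add: c_def)
  have "norm (char_fn t F 0 \<theta>) \<le> c ^ 4 * t\<^sup>2"
    if t: "0 < t" "t \<le> 1" and F: "finite F" "F \<subseteq> W" "{k\<in>W. real (a k) \<le> B} \<subseteq> F"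
      and \<theta>: "sqrt t \<le> \<bar>\<theta>\<bar>" "\<bar>\<theta>\<bar> \<le> pi" for t F \<theta>
  proof -
    from G(4)[of \<theta>] obtain X where X: "X \<subseteq> G" "card X = 4"
      "\<forall>k\<in>X. \<eta> * norm (cis \<theta> - 1) \<le> norm (cis (real (a k) * \<theta>) - 1)"
      by blast
    have "norm (char_fn t F 0 \<theta>) \<le> (c * sqrt t) ^ card X"
      unfolding char_fn_def
    proof (rule norm_prod_le_power)
      show "X \<subseteq> F" using X(1) G(2) F(3) GB by blast
      show "norm (geo_char (weight t k) (real (a k) * \<theta> + 0 * t)) \<le> 1" if "k \<in> F" for k
        using weight_in_01[OF t(1), of k] that F by (intro norm_geo_char_le_1) auto
      fix k assume k: "k \<in> X"
      hence kW: "k \<in> W" and kB: "real (a k) \<le> B" using X G GB by auto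
      have Q: "0 < weight t k" "weight t k < 1" using weight_in_01[OF t(1) kW] by auto
      define b where "b = \<eta> * sqrt (t / 2)"
      have b0: "b > 0" using G t by (simp add: b_def)
      have "b \<le> \<eta> * norm (cis \<theta> - 1)" unfolding b_def
        using G norm_cis_minus_1_ge[OF t \<theta>] by (intro mult_left_mono) auto
      also have "\<dots> \<le> norm (1 - cis (real (a k) * \<theta>))" using bspec[OF X(3) k] by (simp only: norm_minus_commute[of 1])
      finally have b: "b \<le> norm (1 - cis (real (a k) * \<theta>))" .
      have tB: "t * real (a k) \<le> B" using t kB B0 mult_mono[of t 1 "real (a k)" B] by simp
      have Q1: "1 - weight t k \<le> t * B"
      proof -
        have "1 - weight t k \<le> t * real (a k)" using exp_ge_add_one_self[of "- (t * real (a k))"] by (simp add: weight_def)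
        also have "\<dots> \<le> t * B" using kB t by (intro mult_left_mono) auto
        finally show ?thesis .
      qed
      have Q2: "exp (- (B / 2)) \<le> sqrt (weight t k)"
      proof (rule real_le_rsqrt)
        have "(exp (- (B / 2)))\<^sup>2 = exp (- B)" by (simp flip: exp_of_nat_mult)
        thus "(exp (- (B / 2)))\<^sup>2 \<le> weight t k" using tB by (simp add: weight_def)
      qed
      have "norm (geo_char (weight t k) (real (a k) * \<theta>)) \<le> (1 - weight t k) / (sqrt (weight t k) * b)"
        by (rule norm_geo_char_le[OF Q b0 b])
      also have "\<dots> \<le> (t * B) / (exp (- (B / 2)) * b)"
        using Q1 Q2 b0 Q B0 t by (intro frac_le mult_right_mono mult_pos_pos) auto
      also have "\<dots> = c * (t / sqrt t)"
        using G t by (simp add: c_def b_def exp_minus real_sqrt_divide field_simps)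
      also have "\<dots> = c * sqrt t" using t by (simp add: real_div_sqrt)
      finally show "norm (geo_char (weight t k) (real (a k) * \<theta> + 0 * t)) \<le> c * sqrt t" by simp
    qed (use F in auto)
    also have "\<dots> = c ^ 4 * ((sqrt t)\<^sup>2)\<^sup>2" using X(2) by (simp add: power_mult_distrib flip: power_mult)
    also have "\<dots> = c ^ 4 * t\<^sup>2" using t by simp
    finally show ?thesis .
  qed
  thus ?thesis by blast
qed

lemma norm_char_fn_off_peak:
  assumes L: "L \<ge> 1"
  shows "\<exists>T d \<beta> C. T > 0 \<and> T \<le> 1 \<and> d > 0 \<and> \<beta> > 0 \<and> (\<forall>t F \<theta>. 0 < t \<longrightarrow> t \<le> T \<longrightarrow> finite F \<longrightarrow> F \<subseteq> W \<longrightarrow>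
     {k\<in>W. real (a k) \<le> 1 / t\<^sup>2} \<subseteq> F \<longrightarrow> t / L \<le> \<bar>\<theta>\<bar> \<longrightarrow> \<bar>\<theta>\<bar> \<le> pi \<longrightarrow>
     norm (char_fn t F 0 \<theta>) \<le> exp (- (d * t powr - \<beta>)) + C * t\<^sup>2)"
proof -
  obtain B C where BC: "\<And>t F \<theta>. 0 < t \<Longrightarrow> t \<le> 1 \<Longrightarrow> finite F \<Longrightarrow> F \<subseteq> W \<Longrightarrow> {k\<in>W. real (a k) \<le> B} \<subseteq> F \<Longrightarrow>
     sqrt t \<le> \<bar>\<theta>\<bar> \<Longrightarrow> \<bar>\<theta>\<bar> \<le> pi \<Longrightarrow> norm (char_fn t F 0 \<theta>) \<le> C * t\<^sup>2"
    using norm_char_fn_outer by blast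
  obtain c \<beta> where c: "c > 0" "\<beta> > 0" "\<And>x. x \<ge> 1 \<Longrightarrow> c * x powr \<beta> \<le> real (part_count x)"
    using growth by blast
  define e where "e = ln (1 + exp (- 1) / (2 * L\<^sup>2)) / 2"
  have e0: "e > 0" using L by (simp add: e_def ln_gt_zero)
  define T where "T = 1 / max 1 B"
  have T: "T > 0" "T \<le> 1" by (auto simp: T_def)
  have "norm (char_fn t F 0 \<theta>) \<le> exp (- ((e * c) * t powr - (\<beta> / 2))) + max 0 C * t\<^sup>2"
    if t: "0 < t" "t \<le> T" and F: "finite F" "F \<subseteq> W" "{k\<in>W. real (a k) \<le> 1 / t\<^sup>2} \<subseteq> F"
      and \<theta>: "t / L \<le> \<bar>\<theta>\<bar>" "\<bar>\<theta>\<bar> \<le> pi" for t F \<theta>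
  proof -
    have t1: "t \<le> 1" using t T by simp
    have tt: "t\<^sup>2 \<le> t" using t t1 power_decreasing[of 1 2 t] by simp
    show ?thesis
    proof (cases "\<bar>\<theta>\<bar> \<le> sqrt t")
      case True
      have "t\<^sup>2 \<le> sqrt t" using tt t t1 by (smt (verit) real_sqrt_le_1_iff real_sqrt_ge_0_iff mult_left_le real_sqrt_mult_self)
      hence "1 / sqrt t \<le> 1 / t\<^sup>2" using t by (intro divide_left_mono) auto
      hence sub: "{k\<in>W. real (a k) \<le> 1 / sqrt t} \<subseteq> F" using F(3) by auto
      have "norm (char_fn t F 0 \<theta>) \<le> exp (- (e * real (part_count (1 / sqrt t))))"
        unfolding e_def by (rule norm_char_fn_middle[OF t(1) t1 L F(1,2) sub \<theta>(1) True])
      also have "\<dots> \<le> exp (- (e * (c * (1 / sqrt t) powr \<beta>)))"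
        using c(3)[of "1 / sqrt t"] t t1 e0 by simp
      also have "(1 / sqrt t) powr \<beta> = t powr - (\<beta> / 2)"
        using t by (simp add: powr_half_sqrt[symmetric] powr_powr powr_minus_divide powr_divide)
      finally show ?thesis by (simp add: mult.assoc add_increasing2)
    next
      case False
      have "B \<le> 1 / T" by (simp add: T_def)
      also have "\<dots> \<le> 1 / t" using t by (intro divide_left_mono) auto
      also have "\<dots> \<le> 1 / t\<^sup>2" using t tt by (intro divide_left_mono) auto
      finally have sub: "{k\<in>W. real (a k) \<le> B} \<subseteq> F" using F(3) by auto
      have "norm (char_fn t F 0 \<theta>) \<le> C * t\<^sup>2" using False by (intro BC[OF t(1) t1 F(1,2) sub _ \<theta>(2)]) auto
      also have "\<dots> \<le> max 0 C * t\<^sup>2" by (intro mult_right_mono) auto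
      finally show ?thesis by (simp add: add_increasing)
    qed
  qed
  thus ?thesis using T e0 c by (intro exI[of _ T] exI[of _ "e * c"] exI[of _ "\<beta> / 2"] exI[of _ "max 0 C"]) auto
qed

lemma exp_sum_at_top: "filterlim exp_sum at_top (at_right 0)"
proof -
  obtain c \<beta> where c: "c > 0" "\<beta> > 0" "\<And>x. x \<ge> 1 \<Longrightarrow> c * x powr \<beta> \<le> real (part_count x)"
    using growth by blast
  have "filterlim (\<lambda>t::real. exp (- 1) * (c * (1 / t) powr \<beta>)) at_top (at_right 0)"
    using c by real_asymp
  moreover have "eventually (\<lambda>t. exp (- 1) * (c * (1 / t) powr \<beta>) \<le> exp_sum t) (at_right 0)"
  proof -
    have "eventually (\<lambda>t::real. t \<in> {0<..<1}) (at_right 0)" by (rule eventually_at_right_real) simp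
    thus ?thesis
    proof eventually_elim
      case (elim t)
      have "exp (- 1) * (c * (1 / t) powr \<beta>) \<le> exp (- 1) * real (part_count (1 / t))"
        using elim by (intro mult_left_mono c) auto
      also have "\<dots> \<le> exp_sum t" using exp_sum_ge[of t "1 / t"] elim by simp
      finally show ?case .
    qed
  qed
  ultimately show ?thesis by (rule filterlim_at_top_mono)
qed

section \<open>The saddle point equation\<close>

text \<open>
  \<open>mean_mult t k = 1 / (exp Y - 1)\<close> with \<open>Y = t * a k\<close>, and \<open>exp Y - 1 \<ge> Y\<^sup>2 / 2\<close>.
\<close>

lemma weighted_mean_le:
  assumes t: "t > 0" and k: "k \<in> W"
  shows "real (a k) * mean_mult t k \<le> 2 / t\<^sup>2 * (1 / real (a k))"
proof -
  have a: "real (a k) > 0" using a_ge_1[OF k] by simp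
  define Y where "Y = t * real (a k)"
  have Y: "Y > 0" using a t by (simp add: Y_def)
  have "1 + Y + Y\<^sup>2 / 2 \<le> exp Y" using Y by (intro exp_lower_Taylor_quadratic) auto
  hence e: "Y\<^sup>2 / 2 \<le> exp Y - 1" using Y by linarith
  have "mean_mult t k = 1 / (exp Y - 1)"
    using Y unfolding mean_mult_def weight_def by (simp add: Y_def exp_minus field_simps)
  also have "\<dots> \<le> 1 / (Y\<^sup>2 / 2)" using e Y by (intro divide_left_mono mult_pos_pos) auto
  finally have "real (a k) * mean_mult t k \<le> real (a k) * (1 / (Y\<^sup>2 / 2))" using a by (intro mult_left_mono) auto
  also have "\<dots> = 2 / t\<^sup>2 * (1 / real (a k))" using a t by (simp add: Y_def power2_eq_square field_simps)
  finally show ?thesis .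
qed

lemma weighted_mean_nonneg: "t > 0 \<Longrightarrow> k \<in> W \<Longrightarrow> 0 \<le> real (a k) * mean_mult t k"
  using mean_mult_bounds(5)[of t k] by (simp add: less_imp_le)

lemma weighted_mean_summable: "t > 0 \<Longrightarrow> (\<lambda>k. real (a k) * mean_mult t k) summable_on W"
  by (rule summable_on_comparison_test[OF summable_on_cmult_right[OF summable_inverse, of "2 / t\<^sup>2"]])
     (rule weighted_mean_le weighted_mean_nonneg; assumption)+

text \<open>
  The expected total; its equation \<open>mean_dim t = n\<close> is the one that defines \<open>q\<^sub>n = exp (- t)\<close>.
\<close>

definition mean_dim :: "real \<Rightarrow> real" where "mean_dim t = (\<Sum>\<^sub>\<infinity>k\<in>W. real (a k) * mean_mult t k)"

lemma mean_mult_antimono: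
  assumes "0 < s" "s < t" "k \<in> W"
  shows "mean_mult t k < mean_mult s k"
proof -
  have a: "real (a k) > 0" using a_ge_1[OF assms(3)] by simp
  have st: "s * real (a k) < t * real (a k)" "0 < s * real (a k)" using assms a by auto
  have "mean_mult u k = 1 / (exp (u * real (a k)) - 1)" if "u > 0" for u
    using that a unfolding mean_mult_def weight_def by (simp add: exp_minus field_simps)
  moreover have "1 / (exp (t * real (a k)) - 1) < 1 / (exp (s * real (a k)) - 1)"
    using st by (intro divide_strict_left_mono mult_pos_pos) auto
  ultimately show ?thesis using assms by auto
qed

lemma mean_dim_strict_antimono:
  assumes "0 < s" "s < t" "W \<noteq> {}"
  shows "mean_dim t < mean_dim s"
proof -
  obtain k0 where k0: "k0 \<in> W" using assms by blast
  let ?h = "\<lambda>t k. real (a k) * mean_mult t k"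
  have t: "t > 0" using assms by simp
  have sm: "?h u summable_on (W - {k0})" if "u > 0" for u
    using weighted_mean_summable[OF that] by (rule summable_on_subset_banach) auto
  have split: "mean_dim u = ?h u k0 + (\<Sum>\<^sub>\<infinity>k\<in>W - {k0}. ?h u k)" if "u > 0" for u
  proof -
    have "mean_dim u = infsum (?h u) ({k0} \<union> (W - {k0}))" unfolding mean_dim_def using k0 by (simp add: insert_absorb)
    also have "\<dots> = infsum (?h u) {k0} + infsum (?h u) (W - {k0})"
      by (rule infsum_Un_disjoint) (use sm[OF that] in auto)
    finally show ?thesis by simp
  qed
  have "(\<Sum>\<^sub>\<infinity>k\<in>W - {k0}. ?h t k) \<le> (\<Sum>\<^sub>\<infinity>k\<in>W - {k0}. ?h s k)"
    using mean_mult_antimono[OF assms(1,2)] by (intro infsum_mono sm t assms mult_left_mono) (auto simp: less_imp_le)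
  moreover have "?h t k0 < ?h s k0"
    using mean_mult_antimono[OF assms(1,2) k0] a_ge_1[OF k0] by (intro mult_strict_left_mono) auto
  ultimately show ?thesis using split[OF t] split[OF assms(1)] by linarith
qed

lemma mean_dim_continuous:
  assumes "t0 > 0"
  shows "continuous_on {t0..} mean_dim"
  unfolding mean_dim_def
proof (rule uniform_limit_theorem)
  show "uniform_limit {t0..} (\<lambda>X t. \<Sum>k\<in>X. real (a k) * mean_mult t k) (\<lambda>t. \<Sum>\<^sub>\<infinity>k\<in>W. real (a k) * mean_mult t k) (finite_subsets_at_top W)"
  proof (rule Weierstrass_m_test_general)
    show "norm (real (a k) * mean_mult t k) \<le> 2 / t0\<^sup>2 * (1 / real (a k))" if "k \<in> W" "t \<in> {t0..}" for k t
    proof -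
      have t: "t > 0" "t0 \<le> t" using that assms by auto
      have "norm (real (a k) * mean_mult t k) = real (a k) * mean_mult t k" using weighted_mean_nonneg[OF t(1) that(1)] by simp
      also have "\<dots> \<le> 2 / t\<^sup>2 * (1 / real (a k))" by (rule weighted_mean_le[OF t(1) that(1)])
      also have "\<dots> \<le> 2 / t0\<^sup>2 * (1 / real (a k))"
        using t assms by (intro mult_right_mono divide_left_mono power_mono mult_pos_pos) auto
      finally show ?thesis .
    qed
    show "(\<lambda>k. 2 / t0\<^sup>2 * (1 / real (a k))) summable_on W" by (intro summable_on_cmult_right summable_inverse)
  qed
  have "continuous_on {t0..} (\<lambda>t. \<Sum>k\<in>X. real (a k) * mean_mult t k)" if "X \<subseteq> W" for X
  proof (intro continuous_on_sum continuous_on_mult_left)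
    fix k assume k: "k \<in> X"
    have "1 - weight t k \<noteq> 0" if "t \<in> {t0..}" for t using weight_in_01[of t k] k \<open>X \<subseteq> W\<close> that assms by force
    thus "continuous_on {t0..} (\<lambda>t. mean_mult t k)" unfolding mean_mult_def weight_def by (intro continuous_intros) auto
  qed
  thus "\<forall>\<^sub>F X in finite_subsets_at_top W. continuous_on {t0..} (\<lambda>t. \<Sum>k\<in>X. real (a k) * mean_mult t k)"
    by (intro eventually_finite_subsets_at_top_weakI)
qed simp

text \<open>
  The intermediate value theorem between a \<open>t1\<close> at which one part alone contributes \<open>x\<close> and a \<open>t2\<close>
  at which the quadratic bound on the summands gives a total of at most 1.
\<close>

lemma mean_dim_solution:
  assumes n: "x \<ge> (1::real)" and ne: "W \<noteq> {}"
  shows "\<exists>t>0. mean_dim t = x"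
proof -
  obtain k0 where k0: "k0 \<in> W" using ne by blast
  have a0: "real (a k0) > 0" using a_ge_1[OF k0] by simp
  define t1 where "t1 = ln (1 + real (a k0) / x) / real (a k0)"
  have q: "real (a k0) / x > 0" using a0 n by simp
  have t1: "t1 > 0" using a0 q by (simp add: t1_def)
  have e1: "exp (t1 * real (a k0)) = 1 + real (a k0) / x" using a0 q by (simp add: t1_def)
  have "mean_mult t1 k0 = 1 / (exp (t1 * real (a k0)) - 1)"
    using t1 a0 unfolding mean_mult_def weight_def by (simp add: exp_minus field_simps)
  hence "real (a k0) * mean_mult t1 k0 = x" unfolding e1 using a0 n by simp
  moreover have "(\<Sum>k\<in>{k0}. real (a k) * mean_mult t1 k) \<le> mean_dim t1"
    unfolding mean_dim_def using k0 weighted_mean_nonneg[OF t1] by (intro finite_sum_le_infsum weighted_mean_summable t1) auto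
  ultimately have lo: "x \<le> mean_dim t1" by simp
  have Z0: "inv_sum \<ge> 0" unfolding inv_sum_def by (intro infsum_nonneg) auto
  define t2 where "t2 = max t1 (sqrt (2 * inv_sum) + 1)"
  have t2: "t2 > 0" "t1 \<le> t2" using t1 by (auto simp: t2_def)
  have "sqrt (2 * inv_sum) \<le> t2" by (simp add: t2_def)
  hence "2 * inv_sum \<le> t2\<^sup>2" using Z0 by (metis real_sqrt_le_iff real_sqrt_abs abs_of_pos t2(1))
  hence "2 / t2\<^sup>2 * inv_sum \<le> 1" using t2 by (simp add: field_simps)
  moreover have "mean_dim t2 \<le> (\<Sum>\<^sub>\<infinity>k\<in>W. 2 / t2\<^sup>2 * (1 / real (a k)))"
    unfolding mean_dim_def using t2
    by (intro infsum_mono weighted_mean_summable weighted_mean_le summable_on_cmult_right summable_inverse) auto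
  moreover have "(\<Sum>\<^sub>\<infinity>k\<in>W. 2 / t2\<^sup>2 * (1 / real (a k))) = 2 / t2\<^sup>2 * inv_sum"
    unfolding inv_sum_def by (rule infsum_cmult_right')
  ultimately have hi: "mean_dim t2 \<le> x" using n by linarith
  have "continuous_on {t1..t2} mean_dim" using mean_dim_continuous[OF t1] by (rule continuous_on_subset) auto
  then obtain t where "t1 \<le> t" "t \<le> t2" "mean_dim t = x" using IVT2'[of mean_dim t2 x t1] hi lo t2(2) by blast
  thus ?thesis using t1 by (intro exI[of _ t]) auto
qed

lemma mean_dim_has_sum_iff:
  "t > 0 \<Longrightarrow> ((\<lambda>k. real (a k) * mean_mult t k) has_sum x) W \<longleftrightarrow> mean_dim t = x"
  unfolding mean_dim_def using weighted_mean_summable[of t] by (auto simp: has_sum_iff)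

lemma mean_dim_solution_unique:
  assumes "W \<noteq> {}" "s > 0" "t > 0" "mean_dim s = mean_dim t"
  shows "s = t"
  using mean_dim_strict_antimono[of s t] mean_dim_strict_antimono[of t s] assms by (cases s t rule: linorder_cases) auto

lemma mean_dim_solutions_tendsto_0:
  assumes ne: "W \<noteq> {}" and t: "\<And>n. t n > 0" and mt: "filterlim (\<lambda>n. mean_dim (t n)) at_top sequentially"
  shows "t \<longlonglongrightarrow> 0"
proof (rule order_tendstoI)
  show "eventually (\<lambda>n. e < t n) sequentially" if "e < 0" for e
    using t order_less_trans[OF that] by (intro always_eventually) auto
  fix e :: real assume e: "e > 0"
  have "eventually (\<lambda>n. mean_dim e < mean_dim (t n)) sequentially"
    using mt by (simp add: filterlim_at_top_dense)
  thus "eventually (\<lambda>n. t n < e) sequentially"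
  proof eventually_elim
    case (elim n)
    show ?case
    proof (rule ccontr)
      assume "\<not> t n < e"
      hence "mean_dim (t n) \<le> mean_dim e"
        using mean_dim_strict_antimono[OF e, of "t n"] ne by (cases "e = t n") auto
      thus False using elim by simp
    qed
  qed
qed

end

section \<open>The local limit theorem\<close>

text \<open>
  The finite sets \<open>F n\<close> replace \<open>W\<close>, so that all products are finite. They are taken so large
  that the expected total over \<open>F n\<close> is within 1 of the target \<open>m n\<close>, an error
  that is small compared with the standard deviation.
\<close>

locale part_sequence = part_system W a for W :: "'k set" and a +
  fixes t :: "nat \<Rightarrow> real" and F :: "nat \<Rightarrow> 'k set" and m :: "nat \<Rightarrow> int"
  assumes t_pos: "\<And>n. t n > 0" and t_lim: "t \<longlonglongrightarrow> 0"
    and F_fin: "\<And>n. finite (F n)" and F_sub: "\<And>n. F n \<subseteq> W"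
    and F_large: "\<And>n. {k\<in>W. real (a k) \<le> 1 / (t n)\<^sup>2} \<subseteq> F n"
    and mean: "\<And>n. \<bar>(\<Sum>k\<in>F n. real (a k) * mean_mult (t n) k) - of_int (m n)\<bar> \<le> 1"
begin

lemma t_right: "filterlim t (at_right 0) sequentially"
  using t_lim t_pos unfolding filterlim_at by (auto simp: less_imp_neq[THEN not_sym])

lemma eventually_t_le: "e > 0 \<Longrightarrow> eventually (\<lambda>n. t n \<le> e) sequentially"
  using order_tendstoD(2)[OF t_lim, of e] by (auto elim: eventually_mono)

lemma F_exhausts: "filterlim F (finite_subsets_at_top W) sequentially"
proof (rule filterlim_finite_subsets_sequentially[OF F_fin F_sub])
  fix X assume X: "finite X" "X \<subseteq> W"
  define B where "B = max 1 (real (\<Sum>k\<in>X. a k))"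
  have "real (a k) \<le> B" if "k \<in> X" for k
  proof -
    have "a k \<le> (\<Sum>k\<in>X. a k)" using X that by (intro member_le_sum) auto
    hence "real (a k) \<le> real (\<Sum>k\<in>X. a k)" by (simp only: of_nat_le_iff)
    thus ?thesis by (simp add: B_def)
  qed
  moreover have "eventually (\<lambda>n. B \<le> 1 / (t n)\<^sup>2) sequentially"
    using eventually_t_le[of "1 / B"]
  proof (rule eventually_mono)
    show "1 / B > 0" by (simp add: B_def)
    fix n assume n: "t n \<le> 1 / B"
    have B: "B \<ge> 1" by (simp add: B_def)
    have "1 / B \<le> 1" using B by simp
    hence "(t n)\<^sup>2 \<le> t n" using n t_pos[of n] power_decreasing[of 1 2 "t n"] by simp
    hence "(t n)\<^sup>2 \<le> 1 / B" using n by simp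
    thus "B \<le> 1 / (t n)\<^sup>2" using t_pos[of n] B by (simp add: field_simps)
  qed
  ultimately show "eventually (\<lambda>n. X \<subseteq> F n) sequentially"
  proof -
    assume B: "\<And>k. k \<in> X \<Longrightarrow> real (a k) \<le> B" and ev: "eventually (\<lambda>n. B \<le> 1 / (t n)\<^sup>2) sequentially"
    show ?thesis using ev
    proof (rule eventually_mono)
      fix n assume n: "B \<le> 1 / (t n)\<^sup>2"
      have "X \<subseteq> {k\<in>W. real (a k) \<le> 1 / (t n)\<^sup>2}" using X(2) order_trans[OF B n] by blast
      thus "X \<subseteq> F n" using F_large by blast
    qed
  qed
qed

text \<open>
  The estimates that hold once \<open>t n\<close> is small: \<open>t\<^sup>2\<close> times the variance is of the order of \<open>exp_sum t\<close>.
\<close>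

definition scaling :: "real \<Rightarrow> real \<Rightarrow> real \<Rightarrow> real \<Rightarrow> nat \<Rightarrow> bool" where
  "scaling L c1 c2 K n \<longleftrightarrow> t n \<le> 1 \<and> {k\<in>W. real (a k) \<le> L / t n} \<subseteq> F n \<and>
     exp_sum (t n) \<le> 2 * real (part_count (L / t n)) \<and> exp_sum (t n / 2) \<le> K * exp_sum (t n) \<and>
     c1 * exp_sum (t n) \<le> dim_var (t n) (F n) * (t n)\<^sup>2 \<and> dim_var (t n) (F n) * (t n)\<^sup>2 \<le> c2 * exp_sum (t n) \<and> exp_sum (t n) \<ge> 1"

lemma sd_asymptotics:
  obtains L c1 c2 K where "L \<ge> 1" "c1 > 0" "c2 > 0" "K > 0"
    "eventually (scaling L c1 c2 K) sequentially"
proof -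
  obtain L K where LK: "L \<ge> 1" "K > 0" "\<And>t. 0 < t \<Longrightarrow> t \<le> 1 \<Longrightarrow> exp_sum (t / 2) \<le> K * exp_sum t"
    "\<And>t. 0 < t \<Longrightarrow> t \<le> 1 \<Longrightarrow> exp_sum t \<le> 2 * real (part_count (L / t))"
    using scale_constants by blast
  have S1: "eventually (\<lambda>n. exp_sum (t n) \<ge> 1) sequentially"
    using filterlim_compose[OF exp_sum_at_top t_right] by (simp add: filterlim_at_top)
  have "1 / L > 0" using LK by simp
  from eventually_t_le[OF this] S1
  have "eventually (\<lambda>n. t n \<le> 1 \<and> {k\<in>W. real (a k) \<le> L / t n} \<subseteq> F n \<and>
       exp_sum (t n) \<le> 2 * real (part_count (L / t n)) \<and> exp_sum (t n / 2) \<le> K * exp_sum (t n) \<and>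
       exp (- L) / 2 * exp_sum (t n) \<le> dim_var (t n) (F n) * (t n)\<^sup>2 \<and> dim_var (t n) (F n) * (t n)\<^sup>2 \<le> (16 * K) * exp_sum (t n) \<and> exp_sum (t n) \<ge> 1) sequentially"
  proof eventually_elim
    case (elim n)
    have L1: "1 / L \<le> 1" using LK by simp
    have t1: "t n \<le> 1" using elim L1 by linarith
    have "L * (t n)\<^sup>2 = (L * t n) * t n" by (simp add: power2_eq_square)
    also have "\<dots> \<le> 1 * t n" using elim LK t_pos[of n] by (intro mult_right_mono) (auto simp: field_simps)
    finally have "L / t n \<le> 1 / (t n)\<^sup>2" using t_pos[of n] by (simp add: field_simps power2_eq_square)
    hence sub: "{k\<in>W. real (a k) \<le> L / t n} \<subseteq> F n" using F_large[of n] by auto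
    have SA: "exp_sum (t n) \<le> 2 * real (part_count (L / t n))" using LK t1 t_pos by auto
    have SK: "exp_sum (t n / 2) \<le> K * exp_sum (t n)" using LK t1 t_pos by auto
    have "exp (- (t n * (L / t n))) * real (part_count (L / t n)) / (t n)\<^sup>2 \<le> dim_var (t n) (F n)"
      by (rule dim_var_ge[OF t_pos F_fin F_sub sub])
    hence "exp (- L) * real (part_count (L / t n)) \<le> dim_var (t n) (F n) * (t n)\<^sup>2" using t_pos[of n] by (simp add: field_simps)
    moreover have "exp (- L) * (exp_sum (t n) / 2) \<le> exp (- L) * real (part_count (L / t n))" using SA by (intro mult_left_mono) auto
    moreover have "exp (- L) / 2 * exp_sum (t n) = exp (- L) * (exp_sum (t n) / 2)" by simp
    ultimately have lo: "exp (- L) / 2 * exp_sum (t n) \<le> dim_var (t n) (F n) * (t n)\<^sup>2" by linarith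
    have "dim_var (t n) (F n) \<le> 16 * exp_sum (t n / 2) / (t n)\<^sup>2" by (rule dim_var_le[OF t_pos F_fin F_sub])
    hence "dim_var (t n) (F n) * (t n)\<^sup>2 \<le> 16 * exp_sum (t n / 2)" using t_pos[of n] by (simp add: field_simps)
    also have "\<dots> \<le> (16 * K) * exp_sum (t n)" using SK by simp
    finally show ?case using t1 sub SA SK lo elim by auto
  qed
  hence "eventually (scaling L (exp (- L) / 2) (16 * K) K) sequentially"
    unfolding scaling_def[abs_def] .
  with LK show thesis by (intro that[of L "exp (- L) / 2" "16 * K" K]) auto
qed

definition sd :: "nat \<Rightarrow> real" where "sd n = sqrt (dim_var (t n) (F n))"

lemma sd_sq: "sd n ^ 2 = dim_var (t n) (F n)"
proof -
  have "dim_var (t n) (F n) \<ge> 0" unfolding dim_var_def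
    using F_sub mean_mult_bounds(5)[OF t_pos] by (intro sum_nonneg mult_nonneg_nonneg) (auto simp: less_imp_le subset_iff add_nonneg_nonneg)
  thus ?thesis by (simp add: sd_def)
qed

lemma sd_nonneg: "sd n \<ge> 0"
  using sd_sq[of n] by (simp add: sd_def)

text \<open>
  The decisive comparison of scales: the conditioning lives at angles of order \<open>1 / sd\<close>, and these are
  small compared with \<open>t\<close>, the scale on which the number of parts depends on the angle.
\<close>

lemma sd_t_at_top: "filterlim (\<lambda>n. sd n * t n) at_top sequentially"
proof -
  obtain L c1 c2 K where c: "L \<ge> 1" "c1 > 0" "c2 > 0" "K > 0"
    "eventually (scaling L c1 c2 K) sequentially"
    by (rule sd_asymptotics)
  note ev = c(5)[unfolded scaling_def[abs_def]]
  have "filterlim (\<lambda>n. sqrt (c1 * exp_sum (t n))) at_top sequentially"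
    using filterlim_compose[OF exp_sum_at_top t_right] c(2)
    by (intro filterlim_compose[OF sqrt_at_top] filterlim_tendsto_pos_mult_at_top[OF tendsto_const]) auto
  moreover have "eventually (\<lambda>n. sqrt (c1 * exp_sum (t n)) \<le> sd n * t n) sequentially"
    using ev
  proof eventually_elim
    case (elim n)
    have "sqrt (c1 * exp_sum (t n)) \<le> sqrt (dim_var (t n) (F n) * (t n)\<^sup>2)" using elim by simp
    also have "\<dots> = sd n * t n" using t_pos[of n] by (simp add: sd_def real_sqrt_mult)
    finally show ?case .
  qed
  ultimately show ?thesis by (rule filterlim_at_top_mono)
qed

lemma sd_at_top: "filterlim sd at_top sequentially"
proof (rule filterlim_at_top_mono[OF sd_t_at_top])
  show "eventually (\<lambda>n. sd n * t n \<le> sd n) sequentially"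
    using eventually_t_le[of 1, simplified] by eventually_elim (use sd_nonneg in \<open>simp add: mult_left_le\<close>)
qed

lemma F_in_W: "k \<in> F n \<Longrightarrow> k \<in> W" using F_sub by blast

lemma weight_mult_cis: "of_real (weight (t n) k) * cis y = exp (Complex (- (t n * real (a k))) y)"
  by (simp add: weight_def exp_eq_polar)

text \<open>
  The integration variable on the scale of the peak.
\<close>

definition angle :: "real \<Rightarrow> nat \<Rightarrow> real" where "angle x n = x / sd n"

lemma angle_over_t: "(\<lambda>n. angle x n / t n) \<longlonglongrightarrow> 0"
proof -
  have "(\<lambda>n. x / (sd n * t n)) \<longlonglongrightarrow> 0"
    by (rule real_tendsto_divide_at_top[OF tendsto_const sd_t_at_top])
  thus ?thesis by (simp add: angle_def)
qed

lemma angle_tendsto_0: "angle x \<longlonglongrightarrow> 0"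
  unfolding angle_def[abs_def] by (rule real_tendsto_divide_at_top[OF tendsto_const sd_at_top])

lemma factor_ratio_tendsto:
  assumes k: "k \<in> W"
  shows "(\<lambda>n. (1 - of_real (weight (t n) k) * cis (real (a k) * angle x n)) /
      (1 - of_real (weight (t n) k) * cis (real (a k) * angle x n + u * t n)))
    \<longlonglongrightarrow> 1 / (1 - (\<i> * of_real u) / of_real (real (a k)))"
proof -
  let ?a = "real (a k)"
  have a: "?a > 0" using a_ge_1[OF k] by simp
  define p where "p n = Complex (- (t n * ?a)) (?a * angle x n)" for n
  define p' where "p' n = Complex (- (t n * ?a)) (?a * angle x n + u * t n)" for n
  have p: "(\<lambda>n. p n / of_real (t n)) \<longlonglongrightarrow> - of_real ?a"
  proof -
    have "(\<lambda>n. - of_real ?a + \<i> * of_real (?a * (angle x n / t n))) \<longlonglongrightarrow> - of_real ?a + \<i> * of_real (?a * 0)"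
      by (intro tendsto_intros angle_over_t)
    moreover have "p n / of_real (t n) = - of_real ?a + \<i> * of_real (?a * (angle x n / t n))" for n
      using t_pos[of n] by (simp add: p_def complex_eq_iff Re_divide_of_real Im_divide_of_real)
    ultimately show ?thesis by simp
  qed
  have p': "(\<lambda>n. p' n / of_real (t n)) \<longlonglongrightarrow> - of_real ?a + \<i> * of_real u"
  proof -
    have "(\<lambda>n. p n / of_real (t n) + \<i> * of_real u) \<longlonglongrightarrow> - of_real ?a + \<i> * of_real u"
      by (intro tendsto_intros p)
    moreover have "p' n / of_real (t n) = p n / of_real (t n) + \<i> * of_real u" for n
      using t_pos[of n] by (simp add: p_def p'_def complex_eq_iff Re_divide_of_real Im_divide_of_real field_simps)
    ultimately show ?thesis by simp
  qed
  have nz: "- of_real ?a + \<i> * of_real u \<noteq> (0 :: complex)" using a by (simp add: complex_eq_iff)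
  have "(\<lambda>n. ((exp (p n) - 1) / of_real (t n)) / ((exp (p' n) - 1) / of_real (t n))) \<longlonglongrightarrow>
      - of_real ?a / (- of_real ?a + \<i> * of_real u)"
    by (intro tendsto_divide exp_minus_1_over_tendsto t_pos t_lim p p' nz)
  moreover have "((exp (p n) - 1) / of_real (t n)) / ((exp (p' n) - 1) / of_real (t n)) = (1 - exp (p n)) / (1 - exp (p' n))" for n
  proof -
    have "((exp (p n) - 1) / of_real (t n)) / ((exp (p' n) - 1) / of_real (t n)) = (exp (p n) - 1) / (exp (p' n) - 1)"
      using t_pos[of n] by simp
    also have "\<dots> = (- (exp (p n) - 1)) / (- (exp (p' n) - 1))" by (rule minus_divide_divide[symmetric])
    finally show ?thesis by simp
  qed
  moreover have "- of_real ?a / (- of_real ?a + \<i> * of_real u) = 1 / (1 - (\<i> * of_real u) / complex_of_real ?a)"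
  proof -
    have "1 - (\<i> * of_real u) / complex_of_real ?a = (- of_real ?a + \<i> * of_real u) / (- of_real ?a)"
      using a by (simp add: field_simps)
    thus ?thesis by (simp only: divide_divide_eq_right mult_1)
  qed
  ultimately show ?thesis unfolding weight_mult_cis p_def p'_def by simp
qed

text \<open>
  At the scale of the peak the two variables decouple: the argument \<open>u\<close> contributes the factors of the
  limit law of the number of parts. Factor by factor this is \<open>factor_ratio_tendsto\<close>, and the
  errors are dominated by \<open>2 * \<bar>u\<bar> / a k\<close>, which is summable.
\<close>

lemma char_fn_twist_split:
  "(\<lambda>n. char_fn (t n) (F n) u (angle x n) - char_fn (t n) (F n) 0 (angle x n) *
     (\<Prod>k\<in>F n. 1 / (1 - (\<i> * of_real u) / of_real (real (a k))))) \<longlonglongrightarrow> 0"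
proof -
  define c where "c k = 1 / (1 - (\<i> * of_real u) / complex_of_real (real (a k)))" for k
  define R where "R n k = (1 - of_real (weight (t n) k) * cis (real (a k) * angle x n)) /
      (1 - of_real (weight (t n) k) * cis (real (a k) * angle x n + u * t n))" for n k
  define g where "g n k = geo_char (weight (t n) k) (real (a k) * angle x n)" for n k
  have weight: "0 < weight (t n) k" "weight (t n) k < 1" if "k \<in> W" for n k using weight_in_01[OF t_pos that] by auto
  have g1: "norm (g n k) \<le> 1" if "k \<in> W" for n k unfolding g_def by (intro norm_geo_char_le_1 weight that)
  have den: "norm (1 - (\<i> * of_real u) / complex_of_real (real (a k))) \<ge> 1" for k
    using complex_Re_le_cmod[of "1 - (\<i> * of_real u) / complex_of_real (real (a k))"] by (simp add: Re_divide_of_real)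
  have c1: "norm (c k) \<le> 1" for k
  proof -
    have "1 / norm (1 - (\<i> * of_real u) / complex_of_real (real (a k))) \<le> 1 / 1"
      using den[of k] by (intro divide_left_mono) auto
    thus ?thesis by (simp add: c_def norm_divide)
  qed
  have cb: "norm (c k - 1) \<le> \<bar>u\<bar> * (1 / real (a k))" if "k \<in> W" for k
  proof -
    let ?w = "(\<i> * of_real u) / complex_of_real (real (a k))"
    have "1 - ?w \<noteq> 0" using den[of k] by auto
    hence "c k - 1 = ?w / (1 - ?w)" by (simp add: c_def field_simps)
    hence "norm (c k - 1) = norm ?w / norm (1 - ?w)" by (simp only: norm_divide)
    also have "\<dots> \<le> norm ?w / 1" using den[of k] by (intro divide_left_mono) auto
    finally show ?thesis by (simp add: norm_divide norm_mult)
  qed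
  have Rb: "norm (R n k - 1) \<le> \<bar>u\<bar> * (1 / real (a k))" if k: "k \<in> W" for n k
  proof -
    have "norm (R n k - 1) \<le> mean_mult (t n) k * \<bar>u * t n\<bar>"
      unfolding R_def mean_mult_def by (rule norm_geo_denom_ratio[OF weight[OF k]])
    also have "\<dots> \<le> 1 / (t n * real (a k)) * \<bar>u * t n\<bar>" using mean_mult_bounds(4)[OF t_pos k] by (intro mult_right_mono) auto
    also have "\<dots> = \<bar>u\<bar> * (1 / real (a k))" using t_pos[of n] by (simp add: abs_mult)
    finally show ?thesis .
  qed
  have fac: "geo_char (weight (t n) k) (real (a k) * angle x n + u * t n) = g n k * R n k" if "k \<in> W" for n k
    using geo_denom_nonzero[OF weight[OF that]] by (simp add: g_def R_def geo_char_def)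
  have "(\<lambda>n. \<Sum>k\<in>F n. norm (R n k - c k)) \<longlonglongrightarrow> 0"
  proof (rule sum_finite_sets_tendsto_0[OF F_fin F_sub])
    show "norm (R n k - c k) \<le> 2 * \<bar>u\<bar> * (1 / real (a k))" if "k \<in> W" for n k
      using norm_triangle_ineq4[of "R n k - 1" "c k - 1"] Rb[OF that, of n] cb[OF that] by simp
    show "(\<lambda>k. 2 * \<bar>u\<bar> * (1 / real (a k))) summable_on W" by (intro summable_on_cmult_right summable_inverse)
    show "(\<lambda>n. norm (R n k - c k)) \<longlonglongrightarrow> 0" if "k \<in> W" for k
    proof -
      have "(\<lambda>n. R n k - c k) \<longlonglongrightarrow> c k - c k"
        unfolding R_def c_def by (intro tendsto_diff tendsto_const factor_ratio_tendsto that)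
      thus ?thesis by (intro tendsto_norm_zero) simp
    qed
  qed auto
  hence "(\<lambda>n. (\<Prod>k\<in>F n. g n k * R n k) - (\<Prod>k\<in>F n. g n k * c k)) \<longlonglongrightarrow> 0"
  proof (rule Lim_null_comparison[rotated], intro always_eventually allI)
    fix n
    have "norm ((\<Prod>k\<in>F n. g n k * R n k) - (\<Prod>k\<in>F n. g n k * c k)) \<le> (\<Sum>k\<in>F n. norm (g n k * R n k - g n k * c k))"
    proof (rule norm_prod_diff)
      show "norm (g n k * R n k) \<le> 1" if "k \<in> F n" for k
        unfolding fac[OF F_in_W[OF that], symmetric] by (intro norm_geo_char_le_1 weight F_in_W[OF that])
      show "norm (g n k * c k) \<le> 1" if "k \<in> F n" for k
        unfolding norm_mult using g1[OF F_in_W[OF that]] c1 by (intro mult_le_one) auto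
    qed
    also have "\<dots> \<le> (\<Sum>k\<in>F n. norm (R n k - c k))"
    proof (rule sum_mono)
      fix k assume "k \<in> F n"
      thus "norm (g n k * R n k - g n k * c k) \<le> norm (R n k - c k)"
        using g1[OF F_in_W] unfolding right_diff_distrib[symmetric] norm_mult by (intro mult_left_le_one_le) auto
    qed
    finally show "norm ((\<Prod>k\<in>F n. g n k * R n k) - (\<Prod>k\<in>F n. g n k * c k)) \<le> (\<Sum>k\<in>F n. norm (R n k - c k))" .
  qed
  moreover have "char_fn (t n) (F n) u (angle x n) = (\<Prod>k\<in>F n. g n k * R n k)" for n
    unfolding char_fn_def by (intro prod.cong refl fac F_in_W)
  moreover have "char_fn (t n) (F n) 0 (angle x n) * (\<Prod>k\<in>F n. c k) = (\<Prod>k\<in>F n. g n k * c k)" for n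
    by (simp add: char_fn_def g_def prod.distrib)
  ultimately show ?thesis by (simp add: c_def)
qed

text \<open>
  The central limit theorem for the total. The sum of the third order errors is
  \<open>O(exp_sum t / t\<^sup>3)\<close>, compared with \<open>sd\<^sup>3\<close>, where \<open>sd\<^sup>2\<close> is at least a multiple of \<open>exp_sum t / t\<^sup>2\<close>. The
  quotient is \<open>O(1 / (sd * t))\<close>.
\<close>

lemma char_fn_gaussian_limit:
  "(\<lambda>n. char_fn (t n) (F n) 0 (angle x n) * cis (- (of_int (m n) * angle x n))) \<longlonglongrightarrow> exp (- (of_real x)\<^sup>2 / 2)"
proof -
  obtain L c1 c2 K where c: "L \<ge> 1" "c1 > 0" "c2 > 0" "K > 0"
    "eventually (scaling L c1 c2 K) sequentially"
    by (rule sd_asymptotics)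
  note ev = c(5)[unfolded scaling_def[abs_def]]
  have sdpos: "eventually (\<lambda>n. sd n > 0) sequentially"
    using sd_at_top by (simp add: filterlim_at_top_dense)
  define g where "g n k = geo_char (weight (t n) k) (real (a k) * angle x n)" for n k
  define e where "e n k = exp (\<i> * of_real (mean_mult (t n) k * (real (a k) * angle x n))
      - of_real (mean_mult (t n) k * (1 + mean_mult (t n) k) * (real (a k) * angle x n)\<^sup>2 / 2))" for n k
  define \<mu> where "\<mu> n = (\<Sum>k\<in>F n. real (a k) * mean_mult (t n) k)" for n
  have weight: "0 < weight (t n) k" "weight (t n) k < 1" if "k \<in> W" for n k using weight_in_01[OF t_pos that] by auto
  have diff: "norm ((\<Prod>k\<in>F n. g n k) - (\<Prod>k\<in>F n. e n k)) \<le> 20 * \<bar>angle x n\<bar> ^ 3 * (216 * exp_sum (t n / 2) / t n ^ 3)" for n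
  proof -
    have "norm ((\<Prod>k\<in>F n. g n k) - (\<Prod>k\<in>F n. e n k)) \<le> (\<Sum>k\<in>F n. norm (g n k - e n k))"
    proof (rule norm_prod_diff)
      show "norm (g n k) \<le> 1" if "k \<in> F n" for k unfolding g_def by (intro norm_geo_char_le_1 weight F_in_W[OF that])
      show "norm (e n k) \<le> 1" if "k \<in> F n" for k
        using mean_mult_bounds(5)[OF t_pos F_in_W[OF that], of n] by (simp add: e_def norm_exp_eq_Re)
    qed
    also have "\<dots> \<le> (\<Sum>k\<in>F n. 20 * (mean_mult (t n) k * (1 + mean_mult (t n) k)\<^sup>2 * \<bar>real (a k) * angle x n\<bar> ^ 3))"
    proof (rule sum_mono)
      fix k assume "k \<in> F n"
      from geo_char_gaussian_approx[OF weight[OF F_in_W[OF this]] refl, of n "real (a k) * angle x n"]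
      show "norm (g n k - e n k) \<le> 20 * (mean_mult (t n) k * (1 + mean_mult (t n) k)\<^sup>2 * \<bar>real (a k) * angle x n\<bar> ^ 3)"
        unfolding g_def e_def mean_mult_def .
    qed
    also have "\<dots> = 20 * \<bar>angle x n\<bar> ^ 3 * (\<Sum>k\<in>F n. real (a k) ^ 3 * (mean_mult (t n) k * (1 + mean_mult (t n) k)\<^sup>2))"
      by (simp add: sum_distrib_left abs_mult power_mult_distrib mult_ac)
    also have "\<dots> \<le> 20 * \<bar>angle x n\<bar> ^ 3 * (216 * exp_sum (t n / 2) / t n ^ 3)"
      by (intro mult_left_mono third_moment_sum_le t_pos F_fin F_sub) auto
    finally show ?thesis .
  qed
  have "(\<lambda>n. (20 * 216 * K / c1 * \<bar>x\<bar> ^ 3) / (sd n * t n)) \<longlonglongrightarrow> 0"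
    by (rule real_tendsto_divide_at_top[OF tendsto_const sd_t_at_top])
  moreover have "eventually (\<lambda>n. norm ((\<Prod>k\<in>F n. g n k) - (\<Prod>k\<in>F n. e n k)) \<le> (20 * 216 * K / c1 * \<bar>x\<bar> ^ 3) / (sd n * t n)) sequentially"
    using ev sdpos
  proof eventually_elim
    case (elim n)
    have "exp_sum (t n / 2) \<le> K * exp_sum (t n)" using elim by simp
    also have "\<dots> \<le> K * ((sd n ^ 2 * (t n)\<^sup>2) / c1)"
      using elim c by (intro mult_left_mono) (auto simp: sd_sq field_simps)
    finally have Sb: "exp_sum (t n / 2) \<le> K * ((sd n ^ 2 * (t n)\<^sup>2) / c1)" .
    have "20 * \<bar>angle x n\<bar> ^ 3 * (216 * exp_sum (t n / 2) / t n ^ 3) \<le> 20 * \<bar>angle x n\<bar> ^ 3 * (216 * (K * ((sd n ^ 2 * (t n)\<^sup>2) / c1)) / t n ^ 3)"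
      using t_pos[of n] Sb by (intro mult_left_mono divide_right_mono) auto
    also have "\<dots> = (20 * 216 * K / c1 * \<bar>x\<bar> ^ 3) / (sd n * t n)"
      using elim t_pos[of n] c by (simp add: angle_def power_divide power2_eq_square power3_eq_cube abs_divide field_simps)
    finally show ?case using diff[of n] by linarith
  qed
  ultimately have d0: "(\<lambda>n. (\<Prod>k\<in>F n. g n k) - (\<Prod>k\<in>F n. e n k)) \<longlonglongrightarrow> 0"
    by (rule Lim_null_comparison[rotated])
  \<comment> \<open>The product of the Gaussian factors is a Gaussian, with the variance of the total.\<close>
  have prod_e: "(\<Prod>k\<in>F n. e n k) = cis (\<mu> n * angle x n) * of_real (exp (- (sd n * angle x n)\<^sup>2 / 2))" for n
  proof -
    have "(\<Prod>k\<in>F n. e n k) = exp (\<Sum>k\<in>F n. \<i> * of_real (mean_mult (t n) k * (real (a k) * angle x n))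
      - of_real (mean_mult (t n) k * (1 + mean_mult (t n) k) * (real (a k) * angle x n)\<^sup>2 / 2))"
      unfolding e_def by (rule exp_sum[OF F_fin, symmetric])
    also have "(\<Sum>k\<in>F n. \<i> * of_real (mean_mult (t n) k * (real (a k) * angle x n))
      - of_real (mean_mult (t n) k * (1 + mean_mult (t n) k) * (real (a k) * angle x n)\<^sup>2 / 2))
      = \<i> * of_real (\<Sum>k\<in>F n. mean_mult (t n) k * (real (a k) * angle x n)) - of_real (\<Sum>k\<in>F n. mean_mult (t n) k * (1 + mean_mult (t n) k) * (real (a k) * angle x n)\<^sup>2 / 2)"
      by (simp only: sum_subtractf of_real_sum sum_distrib_left)
    also have "(\<Sum>k\<in>F n. mean_mult (t n) k * (real (a k) * angle x n)) = \<mu> n * angle x n"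
      unfolding \<mu>_def sum_distrib_right by (intro sum.cong) (auto simp: mult_ac)
    also have "(\<Sum>k\<in>F n. mean_mult (t n) k * (1 + mean_mult (t n) k) * (real (a k) * angle x n)\<^sup>2 / 2) = (sd n * angle x n)\<^sup>2 / 2"
      unfolding power_mult_distrib[of "sd n"] sd_sq dim_var_def sum_distrib_right sum_divide_distrib
      by (intro sum.cong) (auto simp: power_mult_distrib mult_ac)
    also have "exp (\<i> * of_real x - of_real y) = cis x * complex_of_real (exp (- y))" for x y
      by (simp add: exp_diff cis_conv_exp exp_minus exp_of_real divide_inverse)
    finally show ?thesis by (simp only: minus_divide_left)
  qed
  have e2: "(\<lambda>n. (\<Prod>k\<in>F n. e n k) * cis (- (of_int (m n) * angle x n))) \<longlonglongrightarrow> of_real (exp (- x\<^sup>2 / 2))"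
  proof -
    have "(\<lambda>n. cis ((\<mu> n - of_int (m n)) * angle x n)) \<longlonglongrightarrow> cis 0"
    proof (intro tendsto_cis)
      have "(\<lambda>n. \<bar>angle x n\<bar>) \<longlonglongrightarrow> 0" using tendsto_rabs[OF angle_tendsto_0[of x]] by simp
      thus "(\<lambda>n. (\<mu> n - of_int (m n)) * angle x n) \<longlonglongrightarrow> 0"
      proof (rule Lim_null_comparison[rotated], intro always_eventually allI)
        show "norm ((\<mu> n - of_int (m n)) * angle x n) \<le> \<bar>angle x n\<bar>" for n
          using mean[of n] by (simp add: abs_mult \<mu>_def mult_left_le_one_le)
      qed
    qed
    hence "(\<lambda>n. cis ((\<mu> n - of_int (m n)) * angle x n) * of_real (exp (- x\<^sup>2 / 2))) \<longlonglongrightarrow> cis 0 * of_real (exp (- x\<^sup>2 / 2))"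
      by (intro tendsto_mult tendsto_const)
    moreover have "eventually (\<lambda>n. cis ((\<mu> n - of_int (m n)) * angle x n) * of_real (exp (- x\<^sup>2 / 2))
        = (\<Prod>k\<in>F n. e n k) * cis (- (of_int (m n) * angle x n))) sequentially"
      using sdpos
    proof eventually_elim
      case (elim n)
      have "sd n * angle x n = x" using elim by (simp add: angle_def)
      moreover have "cis ((\<mu> n - of_int (m n)) * angle x n) = cis (\<mu> n * angle x n) * cis (- (of_int (m n) * angle x n))"
        by (simp add: cis_mult algebra_simps)
      ultimately show ?case unfolding prod_e by (simp add: mult_ac)
    qed
    ultimately show ?thesis by (subst (asm) tendsto_cong) auto
  qed
  have "(\<lambda>n. ((\<Prod>k\<in>F n. g n k) - (\<Prod>k\<in>F n. e n k)) * cis (- (of_int (m n) * angle x n))) \<longlonglongrightarrow> 0"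
    by (rule tendsto_mult_cis_zero[OF d0])
  from tendsto_add[OF this e2] have "(\<lambda>n. (\<Prod>k\<in>F n. g n k) * cis (- (of_int (m n) * angle x n))) \<longlonglongrightarrow> of_real (exp (- x\<^sup>2 / 2))"
    by (simp only: left_diff_distrib diff_add_cancel add_0_left)
  moreover have "complex_of_real (exp (- x\<^sup>2 / 2)) = exp (- (of_real x)\<^sup>2 / 2)" by (simp flip: exp_of_real)
  ultimately show ?thesis by (simp add: char_fn_def g_def)
qed

lemma char_fn_continuous: "continuous_on X (\<lambda>\<theta>. char_fn (t n) (F n) u \<theta> * cis (- (of_int (m n) * \<theta>)))"
proof -
  have "1 - complex_of_real (weight (t n) k) * cis y \<noteq> 0" if "k \<in> F n" for k y
    using weight_in_01[OF t_pos F_in_W[OF that], of n] by (intro geo_denom_nonzero) auto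
  thus ?thesis unfolding char_fn_def geo_char_def by (intro continuous_intros ballI) auto
qed

lemma sd_le: "sd n \<le> sqrt (32 * inv_sum) * t n powr (- 3 / 2)"
proof -
  have t: "t n > 0" by (rule t_pos)
  have "dim_var (t n) (F n) \<le> 16 * exp_sum (t n / 2) / (t n)\<^sup>2" by (rule dim_var_le[OF t_pos F_fin F_sub])
  also have "\<dots> \<le> 16 * (inv_sum / (t n / 2)) / (t n)\<^sup>2"
    using exp_sum_le[of "t n / 2"] t by (intro divide_right_mono mult_left_mono) auto
  also have "\<dots> = 32 * inv_sum * t n powr (- 3)"
    using t by (simp add: powr_minus powr_numeral power2_eq_square power3_eq_cube field_simps)
  finally have "sd n \<le> sqrt (32 * inv_sum * t n powr (- 3))" by (simp add: sd_def)
  also have "\<dots> = sqrt (32 * inv_sum) * t n powr (- 3 / 2)"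
    using t by (simp add: real_sqrt_mult powr_half_sqrt[symmetric] powr_powr)
  finally show ?thesis .
qed

text \<open>
  The local limit theorem, simultaneously for all \<open>u\<close>. The case \<open>u = 0\<close> is the asymptotics of the
  probability that the total equals \<open>m n\<close>.
\<close>

lemma scaled_integral_limit:
  assumes H: "((\<lambda>X. \<Prod>k\<in>X. 1 / (1 - (\<i> * of_real u) / of_real (real (a k)))) \<longlongrightarrow> H) (finite_subsets_at_top W)"
  shows "(\<lambda>n. of_real (sd n) * integral {-pi..pi} (\<lambda>\<theta>. char_fn (t n) (F n) u \<theta> * cis (- (of_int (m n) * \<theta>))))
    \<longlonglongrightarrow> of_real (sqrt (2 * pi)) * H"
proof -
  define g where "g n \<theta> = char_fn (t n) (F n) u \<theta> * cis (- (of_int (m n) * \<theta>))" for n \<theta>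
  have ng: "norm (g n \<theta>) = norm (char_fn (t n) (F n) u \<theta>)" for n \<theta> by (simp add: g_def norm_mult)
  have tw: "norm (char_fn (t n) (F n) u \<theta>) \<le> norm (char_fn (t n) (F n) 0 \<theta>) * exp (\<bar>u\<bar> * inv_sum)" for n \<theta>
    by (rule norm_char_fn_twist[OF t_pos F_fin F_sub])
  have cont: "continuous_on X (g n)" for X n unfolding g_def by (rule char_fn_continuous)
  have [measurable]: "g n \<in> borel_measurable borel" for n by (rule borel_measurable_continuous_onI[OF cont])
  have pw: "(\<lambda>n. g n (angle x n)) \<longlonglongrightarrow> exp (- (of_real x)\<^sup>2 / 2) * H" for x
  proof -
    let ?c = "\<lambda>n. \<Prod>k\<in>F n. 1 / (1 - (\<i> * of_real u) / complex_of_real (real (a k)))"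
    let ?e = "\<lambda>n. cis (- (of_int (m n) * angle x n))"
    have "(\<lambda>n. (char_fn (t n) (F n) u (angle x n) - char_fn (t n) (F n) 0 (angle x n) * ?c n) * ?e n) \<longlonglongrightarrow> 0"
      by (rule tendsto_mult_cis_zero[OF char_fn_twist_split])
    moreover have "(\<lambda>n. (char_fn (t n) (F n) 0 (angle x n) * ?e n) * ?c n) \<longlonglongrightarrow> exp (- (of_real x)\<^sup>2 / 2) * H"
      by (intro tendsto_mult char_fn_gaussian_limit filterlim_compose[OF H F_exhausts])
    ultimately have "(\<lambda>n. (char_fn (t n) (F n) u (angle x n) - char_fn (t n) (F n) 0 (angle x n) * ?c n) * ?e n +
       (char_fn (t n) (F n) 0 (angle x n) * ?e n) * ?c n) \<longlonglongrightarrow> 0 + exp (- (of_real x)\<^sup>2 / 2) * H"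
      by (rule tendsto_add)
    moreover have "(char_fn (t n) (F n) u (angle x n) - char_fn (t n) (F n) 0 (angle x n) * ?c n) * ?e n +
       (char_fn (t n) (F n) 0 (angle x n) * ?e n) * ?c n = g n (angle x n)" for n
      by (simp add: g_def algebra_simps)
    ultimately show ?thesis by simp
  qed
  obtain L c1 c2 K where c: "L \<ge> 1" "c1 > 0" "c2 > 0" "K > 0"
    "eventually (scaling L c1 c2 K) sequentially"
    by (rule sd_asymptotics)
  note ev = c(5)[unfolded scaling_def[abs_def]]
  obtain T d \<beta> C where off: "T > 0" "T \<le> 1" "d > 0" "\<beta> > 0"
    "\<And>t F \<theta>. 0 < t \<Longrightarrow> t \<le> T \<Longrightarrow> finite F \<Longrightarrow> F \<subseteq> W \<Longrightarrow>
     {k\<in>W. real (a k) \<le> 1 / t\<^sup>2} \<subseteq> F \<Longrightarrow> t / L \<le> \<bar>\<theta>\<bar> \<Longrightarrow> \<bar>\<theta>\<bar> \<le> pi \<Longrightarrow>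
     norm (char_fn t F 0 \<theta>) \<le> exp (- (d * t powr - \<beta>)) + C * t\<^sup>2"
    using norm_char_fn_off_peak[OF c(1)] by blast
  define e where "e n = t n / L" for n
  have e0: "e n > 0" for n using t_pos[of n] c by (simp add: e_def)
  have sdpos: "eventually (\<lambda>n. sd n > 0) sequentially"
    using sd_at_top by (simp add: filterlim_at_top_dense)
  have "eventually (\<lambda>n. sd n > 0 \<and> t n \<le> T \<and> e n \<le> pi \<and> {k\<in>W. real (a k) \<le> L / t n} \<subseteq> F n \<and>
      dim_var (t n) (F n) * (t n)\<^sup>2 \<le> c2 * exp_sum (t n) \<and> exp_sum (t n) \<le> 2 * real (part_count (L / t n))) sequentially"
    using ev sdpos eventually_t_le[OF off(1)]
  proof eventually_elim
    case (elim n)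
    have "e n \<le> t n / 1" unfolding e_def using c(1) t_pos[of n] by (intro divide_left_mono) auto
    also have "\<dots> \<le> pi" using elim pi_gt3 by simp
    finally show ?case using elim by simp
  qed
  then obtain N where N: "\<And>n. n \<ge> N \<Longrightarrow> sd n > 0 \<and> t n \<le> T \<and> e n \<le> pi \<and> {k\<in>W. real (a k) \<le> L / t n} \<subseteq> F n \<and>
      dim_var (t n) (F n) * (t n)\<^sup>2 \<le> c2 * exp_sum (t n) \<and> exp_sum (t n) \<le> 2 * real (part_count (L / t n))"
    by (auto simp: eventually_sequentially)

  \<comment> \<open>The peak: after rescaling, dominated convergence.\<close>
  define s where "s n x = indicat_real {-(sd n * e n)..sd n * e n} x *\<^sub>R g n (angle x n)" for n x
  define \<kappa> where "\<kappa> = exp (- L) / (16 * c2)"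
  have \<kappa>: "\<kappa> > 0" using c by (simp add: \<kappa>_def)
  have bd: "norm (s n x) \<le> exp (\<bar>u\<bar> * inv_sum) * exp (- (\<kappa> * x\<^sup>2))" if n: "n \<ge> N" for n x
  proof (cases "x \<in> {-(sd n * e n)..sd n * e n}")
    case True
    have p: "sd n > 0" using N[OF n] by blast
    have "\<bar>x\<bar> \<le> sd n * e n" using True by auto
    hence th: "\<bar>angle x n\<bar> \<le> t n / L" using p by (simp add: angle_def e_def field_simps)
    have "norm (char_fn (t n) (F n) 0 (angle x n)) \<le> exp (- (exp (- L) / 8 * ((angle x n)\<^sup>2 / (t n)\<^sup>2) * real (part_count (L / t n))))"
      using N[OF n] off(2) by (intro norm_char_fn_inner t_pos c F_fin F_sub th) auto
    also have "\<dots> \<le> exp (- (\<kappa> * x\<^sup>2))"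
    proof -
      have "dim_var (t n) (F n) * (t n)\<^sup>2 \<le> c2 * (2 * real (part_count (L / t n)))"
        using N[OF n] c(3) by (meson less_imp_le mult_left_mono order_trans)
      hence "sd n ^ 2 * (t n)\<^sup>2 / (2 * c2) \<le> real (part_count (L / t n))" using c by (simp add: sd_sq field_simps)
      hence "exp (- L) / 8 * ((angle x n)\<^sup>2 / (t n)\<^sup>2) * (sd n ^ 2 * (t n)\<^sup>2 / (2 * c2))
          \<le> exp (- L) / 8 * ((angle x n)\<^sup>2 / (t n)\<^sup>2) * real (part_count (L / t n))"
        by (intro mult_left_mono) auto
      moreover have "exp (- L) / 8 * ((angle x n)\<^sup>2 / (t n)\<^sup>2) * (sd n ^ 2 * (t n)\<^sup>2 / (2 * c2)) = \<kappa> * x\<^sup>2"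
        using p t_pos[of n] by (simp add: angle_def \<kappa>_def power_divide)
      ultimately show ?thesis by simp
    qed
    finally have q: "norm (char_fn (t n) (F n) 0 (angle x n)) * exp (\<bar>u\<bar> * inv_sum) \<le> exp (- (\<kappa> * x\<^sup>2)) * exp (\<bar>u\<bar> * inv_sum)"
      by (intro mult_right_mono) auto
    have "norm (char_fn (t n) (F n) u (angle x n)) \<le> exp (\<bar>u\<bar> * inv_sum) * exp (- (\<kappa> * x\<^sup>2))"
      unfolding mult.commute[of "exp (\<bar>u\<bar> * inv_sum)"] by (rule order_trans[OF tw q])
    moreover have "norm (s n x) = norm (char_fn (t n) (F n) u (angle x n))"
      using True by (simp add: s_def ng)
    ultimately show ?thesis by simp
  qed (simp add: s_def)
  have lim_s: "(\<lambda>n. s n x) \<longlonglongrightarrow> exp (- (of_real x)\<^sup>2 / 2) * H" for x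
  proof (rule Lim_transform_eventually[OF pw[of x]])
    have "eventually (\<lambda>n. sd n * t n \<ge> L * \<bar>x\<bar>) sequentially"
      using sd_t_at_top by (simp add: filterlim_at_top)
    thus "eventually (\<lambda>n. g n (angle x n) = s n x) sequentially"
    proof eventually_elim
      case (elim n)
      have "\<bar>x\<bar> \<le> sd n * e n" using elim c(1) by (simp add: e_def field_simps)
      thus ?case by (auto simp: s_def indicator_def)
    qed
  qed
  have [measurable]: "s n \<in> borel_measurable borel" for n
    unfolding s_def angle_def by measurable
  have "(\<lambda>n. integral\<^sup>L lborel (s (n + N))) \<longlonglongrightarrow> (\<integral>x. exp (- (of_real x)\<^sup>2 / 2) * H \<partial>lborel)"
  proof (rule integral_dominated_convergence)
    show "integrable lborel (\<lambda>x. exp (\<bar>u\<bar> * inv_sum) * exp (- (\<kappa> * x\<^sup>2)))"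
      by (intro integrable_mult_right gaussian_integrable \<kappa>)
    show "AE x in lborel. (\<lambda>n. s (n + N) x) \<longlonglongrightarrow> exp (- (of_real x)\<^sup>2 / 2) * H"
      by (intro AE_I2 LIMSEQ_ignore_initial_segment lim_s)
    show "AE x in lborel. norm (s (n + N) x) \<le> exp (\<bar>u\<bar> * inv_sum) * exp (- (\<kappa> * x\<^sup>2))" for n
      by (intro AE_I2 bd) simp
  qed auto
  hence "(\<lambda>n. integral\<^sup>L lborel (s n)) \<longlonglongrightarrow> (\<integral>x. exp (- (of_real x)\<^sup>2 / 2) * H \<partial>lborel)"
    by (rule LIMSEQ_offset)
  moreover have "(\<integral>x. exp (- (complex_of_real x)\<^sup>2 / 2) * H \<partial>lborel) = of_real (sqrt (2 * pi)) * H"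
  proof -
    have "(\<integral>x. exp (- (complex_of_real x)\<^sup>2 / 2) \<partial>lborel) = (\<integral>x. complex_of_real (exp (- x\<^sup>2 / 2)) \<partial>lborel)"
      by (intro Bochner_Integration.integral_cong) (auto simp flip: exp_of_real)
    also have "\<dots> = of_real (sqrt (2 * pi))"
      by (simp only: integral_complex_of_real gaussian_integral)
    finally show ?thesis by (simp only: integral_mult_left_zero)
  qed
  ultimately have peak: "(\<lambda>n. integral\<^sup>L lborel (s n)) \<longlonglongrightarrow> of_real (sqrt (2 * pi)) * H" by (simp only:)
  have peak_eq: "integral\<^sup>L lborel (s n) = of_real (sd n) * integral {-e n..e n} (g n)" if n: "n \<ge> N" for n
  proof -
    have p: "sd n > 0" using N[OF n] by blast
    have "set_integrable lborel {-e n..e n} (g n)"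
      unfolding set_integrable_def by (rule borel_integrable_compact[OF compact_Icc cont])
    from set_borel_integral_eq_integral(2)[OF this]
    have "integral {-e n..e n} (g n) = (\<integral>\<theta>. indicat_real {-e n..e n} \<theta> *\<^sub>R g n \<theta> \<partial>lborel)"
      by (simp add: set_lebesgue_integral_def)
    also have "\<dots> = \<bar>1 / sd n\<bar> *\<^sub>R (\<integral>x. indicat_real {-e n..e n} (0 + 1 / sd n * x) *\<^sub>R g n (0 + 1 / sd n * x) \<partial>lborel)"
      by (rule lborel_integral_real_affine) (use p in auto)
    also have "(\<lambda>x. indicat_real {-e n..e n} (0 + 1 / sd n * x) *\<^sub>R g n (0 + 1 / sd n * x)) = s n"
      using p by (auto simp: s_def angle_def indicator_def fun_eq_iff field_simps)
    finally show ?thesis using p by (simp add: scaleR_conv_of_real)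
  qed

  \<comment> \<open>Off the peak, the supremum of the integrand is of smaller order than the peak integral.\<close>
  define r where "r n = integral {-pi..-e n} (g n) + integral {e n..pi} (g n)" for n
  define b where "b t = sqrt (32 * inv_sum) * t powr (- 3 / 2) * (2 * pi * (exp (\<bar>u\<bar> * inv_sum) * (exp (- (d * t powr - \<beta>)) + max 0 C * t\<^sup>2)))" for t :: real
  have split: "integral {-pi..pi} (g n) = integral {-e n..e n} (g n) + r n" if n: "n \<ge> N" for n
  proof -
    have "e n \<le> pi" using N[OF n] by blast
    hence "integral {-pi..pi} (g n) = integral {-pi..-e n} (g n) + integral {-e n..pi} (g n)"
      using e0[of n] by (intro Henstock_Kurzweil_Integration.integral_combine[symmetric] integrable_continuous_interval cont) auto
    also have "integral {-e n..pi} (g n) = integral {-e n..e n} (g n) + integral {e n..pi} (g n)"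
      using e0[of n] \<open>e n \<le> pi\<close> by (intro Henstock_Kurzweil_Integration.integral_combine[symmetric] integrable_continuous_interval cont) auto
    finally show ?thesis by (simp add: r_def)
  qed
  have rb: "norm (of_real (sd n) * r n) \<le> b (t n)" if n: "n \<ge> N" for n
  proof -
    define B where "B = exp (\<bar>u\<bar> * inv_sum) * (exp (- (d * t n powr - \<beta>)) + max 0 C * (t n)\<^sup>2)"
    have B0: "B \<ge> 0" by (auto simp: B_def intro!: mult_nonneg_nonneg add_nonneg_nonneg)
    have gB: "norm (g n \<theta>) \<le> B" if th: "t n / L \<le> \<bar>\<theta>\<bar>" "\<bar>\<theta>\<bar> \<le> pi" for \<theta>
    proof -
      have "norm (char_fn (t n) (F n) 0 \<theta>) \<le> exp (- (d * t n powr - \<beta>)) + C * (t n)\<^sup>2"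
        using N[OF n] by (intro off(5) t_pos F_fin F_sub F_large th) auto
      also have "\<dots> \<le> exp (- (d * t n powr - \<beta>)) + max 0 C * (t n)\<^sup>2"
        by (intro add_left_mono mult_right_mono) auto
      finally have "norm (char_fn (t n) (F n) 0 \<theta>) * exp (\<bar>u\<bar> * inv_sum) \<le> B"
        unfolding B_def by (simp add: mult.commute)
      thus ?thesis unfolding ng using tw[of n \<theta>] by linarith
    qed
    have en: "0 < e n" "e n \<le> pi" using N[OF n] e0 by auto
    have "norm (integral {-pi..-e n} (g n)) \<le> B * (- e n - (- pi))"
      using en by (intro integral_bound cont gB) (auto simp: e_def)
    also have "\<dots> \<le> B * pi" using en B0 by (intro mult_left_mono) auto
    finally have i1: "norm (integral {-pi..-e n} (g n)) \<le> B * pi" .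
    have "norm (integral {e n..pi} (g n)) \<le> B * (pi - e n)"
      using en by (intro integral_bound cont gB) (auto simp: e_def)
    also have "\<dots> \<le> B * pi" using en B0 by (intro mult_left_mono) auto
    finally have i2: "norm (integral {e n..pi} (g n)) \<le> B * pi" .
    have "2 * pi * B = B * pi + B * pi" by simp
    hence "norm (r n) \<le> 2 * pi * B"
      unfolding r_def using i1 i2 norm_triangle_ineq[of "integral {-pi..-e n} (g n)" "integral {e n..pi} (g n)"] by linarith
    hence "sd n * norm (r n) \<le> (sqrt (32 * inv_sum) * t n powr (- 3 / 2)) * (2 * pi * B)"
      using sd_le[of n] sd_nonneg[of n] by (intro mult_mono) (auto intro: order_trans)
    thus ?thesis using sd_nonneg[of n] by (simp add: norm_mult b_def B_def)
  qed
  have "(b \<longlongrightarrow> 0) (at_right 0)"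
  proof -
    have "((\<lambda>t::real. t powr (- 3 / 2) * exp (- (d * t powr - \<beta>))) \<longlongrightarrow> 0) (at_right 0)"
      using off(3,4) by real_asymp
    moreover have "((\<lambda>t::real. t powr (- 3 / 2) * t\<^sup>2) \<longlongrightarrow> 0) (at_right 0)" by real_asymp
    ultimately have "((\<lambda>t. (sqrt (32 * inv_sum) * (2 * pi * exp (\<bar>u\<bar> * inv_sum))) * (t powr (- 3 / 2) * exp (- (d * t powr - \<beta>)) + max 0 C * (t powr (- 3 / 2) * t\<^sup>2)))
        \<longlongrightarrow> (sqrt (32 * inv_sum) * (2 * pi * exp (\<bar>u\<bar> * inv_sum))) * (0 + max 0 C * 0)) (at_right 0)"
      by (intro tendsto_intros)
    moreover have "(\<lambda>t. (sqrt (32 * inv_sum) * (2 * pi * exp (\<bar>u\<bar> * inv_sum))) * (t powr (- 3 / 2) * exp (- (d * t powr - \<beta>)) + max 0 C * (t powr (- 3 / 2) * t\<^sup>2))) = b"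
      unfolding b_def by (rule ext) (simp add: algebra_simps)
    ultimately show ?thesis by simp
  qed
  hence "(\<lambda>n. b (t n)) \<longlonglongrightarrow> 0" by (rule filterlim_compose[OF _ t_right])
  hence rest: "(\<lambda>n. of_real (sd n) * r n) \<longlonglongrightarrow> 0"
    by (rule Lim_null_comparison[rotated]) (use rb in \<open>auto simp: eventually_sequentially\<close>)
  from tendsto_add[OF peak rest]
  have "(\<lambda>n. integral\<^sup>L lborel (s n) + of_real (sd n) * r n) \<longlonglongrightarrow> of_real (sqrt (2 * pi)) * H" by simp
  moreover have "eventually (\<lambda>n. integral\<^sup>L lborel (s n) + of_real (sd n) * r n = of_real (sd n) * integral {-pi..pi} (g n)) sequentially"
    unfolding eventually_sequentially
  proof (intro exI[of _ N] allI impI)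
    fix n assume n: "N \<le> n"
    show "integral\<^sup>L lborel (s n) + of_real (sd n) * r n = of_real (sd n) * integral {-pi..pi} (g n)"
      unfolding peak_eq[OF n] split[OF n] by (simp add: distrib_left)
  qed
  ultimately have "(\<lambda>n. of_real (sd n) * integral {-pi..pi} (g n)) \<longlonglongrightarrow> of_real (sqrt (2 * pi)) * H"
    by (rule Lim_transform_eventually)
  thus ?thesis unfolding g_def[abs_def] .
qed

text \<open>
  The integral is a constant independent of \<open>u\<close> times the sum over all partitions of \<open>m n\<close>: the weight
  of a partition in the unconditioned model depends only on its total. The hypothesis on \<open>F n\<close> ensures
  that no partition of \<open>m n\<close> is lost.
\<close>

lemma char_fn_integral_eq:
  assumes parts: "{k\<in>W. int (a k) \<le> m n} \<subseteq> F n"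
  shows "integral {-pi..pi} (\<lambda>\<theta>. char_fn (t n) (F n) u \<theta> * cis (- (of_int (m n) * \<theta>)))
    = (2 * pi * (\<Prod>k\<in>F n. 1 - weight (t n) k) * exp (- (t n * of_int (m n)))) *
      (\<Sum>\<rho>\<in>partitions_into a W (m n). cis (u * (t n * real (size \<rho>))))"
proof -
  define w where "w k = cis (u * t n) * of_real (weight (t n) k)" for k
  define P0 where "P0 = (\<Prod>k\<in>F n. 1 - weight (t n) k)"
  have same: "partitions_into a W (m n) = partitions_into a (F n) (m n)"
  proof -
    have "set_mset \<rho> \<subseteq> F n" if "set_mset \<rho> \<subseteq> W" "int (\<Sum>k\<in>#\<rho>. a k) = m n" for \<rho>
    proof
      fix k assume k: "k \<in># \<rho>"
      have "a k \<le> (\<Sum>k\<in>#\<rho>. a k)" using k by (metis insert_DiffM le_add1 image_mset_add_mset sum_mset.add_mset)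
      hence "int (a k) \<le> m n" using that(2) by linarith
      thus "k \<in> F n" using k that(1) parts by blast
    qed
    thus ?thesis using F_sub[of n] unfolding partitions_into_def by blast
  qed
  have "integral {-pi..pi} (\<lambda>\<theta>. (\<Prod>j\<in>F n. 1 / (1 - w j * cis (real (a j) * \<theta>))) * cis (of_int (- m n) * \<theta>))
      = of_real (2 * pi) * (\<Sum>\<rho>\<in>partitions_into a (F n) (m n). \<Prod>j\<in>#\<rho>. w j)"
  proof (rule coefficient_integral[OF F_fin])
    show "a j \<ge> 1" if "j \<in> F n" for j using a_pos[OF F_in_W[OF that]] .
    show "norm (w j) < 1" if "j \<in> F n" for j
      using weight_in_01[OF t_pos F_in_W[OF that], of n] by (simp add: w_def norm_mult)
  qed
  also have "(\<Sum>\<rho>\<in>partitions_into a (F n) (m n). \<Prod>j\<in>#\<rho>. w j)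
      = (\<Sum>\<rho>\<in>partitions_into a W (m n). of_real (exp (- (t n * of_int (m n)))) * cis (u * (t n * real (size \<rho>))))"
    unfolding same
  proof (rule sum.cong[OF refl])
    fix \<rho> assume "\<rho> \<in> partitions_into a (F n) (m n)"
    hence "int (\<Sum>k\<in>#\<rho>. a k) = m n" unfolding partitions_into_def by blast
    hence mean_mult: "real (\<Sum>k\<in>#\<rho>. a k) = of_int (m n)" by (metis of_int_of_nat_eq)
    have "(\<Prod>j\<in>#\<rho>. w j) = of_real (exp (- (t n * real (\<Sum>k\<in>#\<rho>. a k)))) * cis (u * (t n * real (size \<rho>)))"
    proof (induction \<rho>)
      case (add x \<rho>)
      have e: "(\<Prod>j\<in>#add_mset x \<rho>. w j) = w x * (\<Prod>j\<in>#\<rho>. w j)" by simp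
      have wx: "w x = cis (u * t n) * of_real (weight (t n) x)" by (simp add: w_def)
      have c1: "cis (u * (t n * real (size (add_mset x \<rho>)))) = cis (u * t n) * cis (u * (t n * real (size \<rho>)))"
        by (simp add: cis_mult algebra_simps)
      have c2: "exp (- (t n * real (\<Sum>k\<in>#add_mset x \<rho>. a k))) = weight (t n) x * exp (- (t n * real (\<Sum>k\<in>#\<rho>. a k)))"
        by (simp add: weight_def algebra_simps flip: exp_add)
      show ?case unfolding e add.IH wx c1 c2 by (simp only: of_real_mult mult_ac)
    qed simp
    thus "(\<Prod>j\<in>#\<rho>. w j) = of_real (exp (- (t n * of_int (m n)))) * cis (u * (t n * real (size \<rho>)))"
      unfolding mean_mult .
  qed
  finally have I: "integral {-pi..pi} (\<lambda>\<theta>. (\<Prod>j\<in>F n. 1 / (1 - w j * cis (real (a j) * \<theta>))) * cis (of_int (- m n) * \<theta>))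
      = of_real (2 * pi) * (of_real (exp (- (t n * of_int (m n)))) * (\<Sum>\<rho>\<in>partitions_into a W (m n). cis (u * (t n * real (size \<rho>)))))"
    by (simp only: sum_distrib_left)
  have "char_fn (t n) (F n) u \<theta> * cis (- (of_int (m n) * \<theta>)) =
      of_real P0 * ((\<Prod>j\<in>F n. 1 / (1 - w j * cis (real (a j) * \<theta>))) * cis (of_int (- m n) * \<theta>))" for \<theta>
  proof -
    have "geo_char (weight (t n) k) (real (a k) * \<theta> + u * t n) = of_real (1 - weight (t n) k) * (1 / (1 - w k * cis (real (a k) * \<theta>)))" for k
      by (simp add: geo_char_def w_def mult_ac flip: cis_mult)
    hence "char_fn (t n) (F n) u \<theta> = of_real P0 * (\<Prod>j\<in>F n. 1 / (1 - w j * cis (real (a j) * \<theta>)))"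
      unfolding char_fn_def P0_def by (simp only: prod.distrib of_real_prod)
    thus ?thesis by (simp only: mult.assoc of_int_minus mult_minus_left)
  qed
  hence "integral {-pi..pi} (\<lambda>\<theta>. char_fn (t n) (F n) u \<theta> * cis (- (of_int (m n) * \<theta>)))
     = of_real P0 * integral {-pi..pi} (\<lambda>\<theta>. (\<Prod>j\<in>F n. 1 / (1 - w j * cis (real (a j) * \<theta>))) * cis (of_int (- m n) * \<theta>))"
    by (simp only: integral_mult_right)
  thus ?thesis unfolding I by (simp add: P0_def)
qed

text \<open>
  The quotient of the integrals for \<open>u\<close> and for 0 is the characteristic function of the scaled number of
  parts under the uniform measure on the partitions of \<open>m n\<close>.
\<close>

lemma size_char_limit:
  assumes parts: "\<And>n. {k\<in>W. int (a k) \<le> m n} \<subseteq> F n"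
    and H: "((\<lambda>X. \<Prod>k\<in>X. 1 / (1 - (\<i> * of_real u) / of_real (real (a k)))) \<longlongrightarrow> H) (finite_subsets_at_top W)"
  shows "(\<lambda>n. (\<Sum>\<rho>\<in>partitions_into a W (m n). cis (u * (t n * real (size \<rho>)))) / of_nat (card (partitions_into a W (m n)))) \<longlonglongrightarrow> H"
proof -
  define J where "J u n = integral {-pi..pi} (\<lambda>\<theta>. char_fn (t n) (F n) u \<theta> * cis (- (of_int (m n) * \<theta>)))" for u n
  have 1: "(\<lambda>n. of_real (sd n) * J u n) \<longlonglongrightarrow> of_real (sqrt (2 * pi)) * H"
    unfolding J_def by (rule scaled_integral_limit[OF H])
  have 0: "(\<lambda>n. of_real (sd n) * J 0 n) \<longlonglongrightarrow> of_real (sqrt (2 * pi)) * 1"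
    unfolding J_def by (rule scaled_integral_limit) simp
  have "(\<lambda>n. (of_real (sd n) * J u n) / (of_real (sd n) * J 0 n)) \<longlonglongrightarrow> (of_real (sqrt (2 * pi)) * H) / (of_real (sqrt (2 * pi)) * 1)"
    by (rule tendsto_divide[OF 1 0]) simp
  hence "(\<lambda>n. (of_real (sd n) * J u n) / (of_real (sd n) * J 0 n)) \<longlonglongrightarrow> H" by simp
  moreover have "eventually (\<lambda>n. (of_real (sd n) * J u n) / (of_real (sd n) * J 0 n) =
     (\<Sum>\<rho>\<in>partitions_into a W (m n). cis (u * (t n * real (size \<rho>)))) / of_nat (card (partitions_into a W (m n)))) sequentially"
  proof -
    have "eventually (\<lambda>n. sd n > 0) sequentially"
      using sd_at_top by (simp add: filterlim_at_top_dense)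
    thus ?thesis
    proof eventually_elim
      case (elim n)
      define D where "D = complex_of_real (2 * pi * (\<Prod>k\<in>F n. 1 - weight (t n) k) * exp (- (t n * of_int (m n))))"
      have "(\<Prod>k\<in>F n. 1 - weight (t n) k) > 0"
        using weight_in_01[OF t_pos F_in_W] by (intro prod_pos) auto
      hence D: "D \<noteq> 0" unfolding D_def of_real_eq_0_iff by simp
      have J: "J v n = D * (\<Sum>\<rho>\<in>partitions_into a W (m n). cis (v * (t n * real (size \<rho>))))" for v
        unfolding J_def D_def char_fn_integral_eq[OF parts] by simp
      have "(of_real (sd n) * J u n) / (of_real (sd n) * J 0 n) = J u n / J 0 n" using elim by simp
      also have "\<dots> = (\<Sum>\<rho>\<in>partitions_into a W (m n). cis (u * (t n * real (size \<rho>)))) / of_nat (card (partitions_into a W (m n)))"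
        unfolding J using D by simp
      finally show ?case .
    qed
  qed
  ultimately show ?thesis by (rule Lim_transform_eventually)
qed

end

section \<open>Dimensions of irreducible representations\<close>

definition intervals_prod :: "nat \<Rightarrow> (nat \<Rightarrow> nat) \<Rightarrow> nat" where
  "intervals_prod r k = (\<Prod>l=1..r. \<Prod>j=l..r. \<Sum>i=l..j. k i)"

lemma c_const_pos: "c_const r > 0"
  unfolding c_const_def by (intro prod_pos) auto

lemma irr_dim_eq: "irr_dim r k = real (intervals_prod r k) / c_const r"
  by (simp add: weyl_def intervals_prod_def)

lemma interval_sum_ge:
  fixes k :: "nat \<Rightarrow> nat"
  assumes "k \<in> weights r" "1 \<le> l" "l \<le> j" "j \<le> r"
  shows "1 \<le> (\<Sum>i=l..j. k i)"
proof -
  have "k l \<le> (\<Sum>i=l..j. k i)" using assms by (intro member_le_sum) auto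
  moreover have "k l \<ge> 1" using assms by (auto simp: weights_def PiE_iff)
  ultimately show ?thesis by linarith
qed

lemma intervals_prod_pos: "k \<in> weights r \<Longrightarrow> intervals_prod r k > 0"
  unfolding intervals_prod_def
proof (intro prod_pos ballI)
  fix l j assume "k \<in> weights r" "l \<in> {1..r}" "j \<in> {l..r}"
  thus "0 < (\<Sum>i=l..j. k i)" using interval_sum_ge[of k r l j] by simp
qed

definition dim_nat :: "nat \<Rightarrow> (nat \<Rightarrow> nat) \<Rightarrow> nat" where
  "dim_nat r k = nat \<lfloor>irr_dim r k\<rfloor>"

lemma real_dim_nat: "k \<in> weights r \<Longrightarrow> real (dim_nat r k) = irr_dim r k"
proof -
  assume "k \<in> weights r"
  then obtain m where "irr_dim r k = real m" using irr_dim_in_Nats[of k r] by (auto simp: Nats_def)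
  thus ?thesis unfolding dim_nat_def by simp
qed

lemma dim_nat_ge_1: "k \<in> weights r \<Longrightarrow> dim_nat r k \<ge> 1"
proof -
  assume k: "k \<in> weights r"
  have "irr_dim r k > 0" unfolding irr_dim_eq using intervals_prod_pos[OF k] c_const_pos[of r] by simp
  hence "real (dim_nat r k) > 0" using real_dim_nat[OF k] by simp
  thus ?thesis by simp
qed

text \<open>
  The interval sums from \<open>l\<close> to \<open>l\<close> and from \<open>l\<close> to \<open>r\<close> already give, for \<open>l < r\<close>,
  \<open>k\<^sub>l (k\<^sub>l + k\<^sub>r) \<ge> k\<^sub>l powr (3 / 2) * sqrt k\<^sub>r\<close>. One of the surplus factors \<open>sqrt k\<^sub>r\<close>, available as
  \<open>r \<ge> 2\<close>, completes the remaining factor \<open>k\<^sub>r\<close> to \<open>k\<^sub>r powr (3 / 2)\<close>.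
\<close>

lemma intervals_prod_ge:
  assumes k: "k \<in> weights r" and r: "r \<ge> 2"
  shows "(\<Prod>i=1..r. real (k i) powr (3 / 2)) \<le> real (intervals_prod r k)"
proof -
  have k1: "real (k i) \<ge> 1" if "i \<in> {1..r}" for i using k that by (auto simp: weights_def PiE_iff)
  define P where "P l = (\<Prod>j=l..r. real (\<Sum>i=l..j. k i))" for l
  have ge1: "1 \<le> real (\<Sum>i=l..j. k i)" if "l \<in> {1..r}" "j \<in> {l..r}" for l j
    using interval_sum_ge[OF k, of l j] that by (simp del: of_nat_sum)
  have last: "real (k r) \<le> P r" by (simp add: P_def)
  have inner: "real (k l) powr (3 / 2) * sqrt (real (k r)) \<le> P l" if l: "l \<in> {1..<r}" for l
  proof -
    have kl: "real (k l) \<ge> 1" "real (k r) \<ge> 1" using k1[of l] k1[of r] l by auto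
    have "k l + k r = (\<Sum>i\<in>{l, r}. k i)" using l by simp
    also have "\<dots> \<le> (\<Sum>i=l..r. k i)" using l by (intro sum_mono2) auto
    finally have s: "real (k l) + real (k r) \<le> real (\<Sum>i=l..r. k i)" by (simp del: of_nat_sum flip: of_nat_add)
    have "sqrt (real (k l)) * sqrt (real (k r)) \<le> real (k l) + real (k r)"
      using arith_geo_mean_sqrt[of "real (k l)" "real (k r)"] kl by (simp add: real_sqrt_mult)
    with s have s2: "sqrt (real (k l)) * sqrt (real (k r)) \<le> real (\<Sum>i=l..r. k i)" by linarith
    have "real (k l) powr (3 / 2) = real (k l) * sqrt (real (k l))"
    proof -
      have "real (k l) powr (3 / 2) = real (k l) powr 1 * real (k l) powr (1 / 2)"
        by (subst powr_add[symmetric]) simp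
      also have "\<dots> = real (k l) * sqrt (real (k l))" using kl by (simp add: powr_half_sqrt)
      finally show ?thesis .
    qed
    hence "real (k l) powr (3 / 2) * sqrt (real (k r)) = real (k l) * (sqrt (real (k l)) * sqrt (real (k r)))" by simp
    also have "\<dots> \<le> real (k l) * real (\<Sum>i=l..r. k i)" using s2 by (intro mult_left_mono) auto
    also have "\<dots> = (\<Prod>j\<in>{l, r}. real (\<Sum>i=l..j. k i))" using l by simp
    also have "\<dots> \<le> (\<Prod>j\<in>{l, r}. real (\<Sum>i=l..j. k i)) * (\<Prod>j\<in>{l..r} - {l, r}. real (\<Sum>i=l..j. k i))"
    proof -
      have "1 \<le> (\<Prod>j\<in>{l..r} - {l, r}. real (\<Sum>i=l..j. k i))" using l by (intro prod_ge_1 ge1) auto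
      moreover have "0 \<le> (\<Prod>j\<in>{l, r}. real (\<Sum>i=l..j. k i))" by (intro prod_nonneg ballI of_nat_0_le_iff)
      ultimately show ?thesis using mult_left_mono[of 1] by fastforce
    qed
    also have "\<dots> = P l" unfolding P_def using l by (subst prod.subset_diff[of "{l, r}" "{l..r}"]) auto
    finally show ?thesis .
  qed
  have kr: "real (k r) \<ge> 1" using k1[of r] r by simp
  have ins: "{1..r} = insert r {1..<r}" using r by auto
  have "real (k r) powr (3 / 2) \<le> sqrt (real (k r)) ^ (r - 1) * real (k r)"
  proof -
    have "real (k r) powr (3 / 2) = real (k r) powr (1 / 2) * real (k r) powr 1"
      by (subst powr_add[symmetric]) simp
    also have "\<dots> = sqrt (real (k r)) ^ 1 * real (k r)" using kr by (simp add: powr_half_sqrt)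
    also have "\<dots> \<le> sqrt (real (k r)) ^ (r - 1) * real (k r)"
      using kr r by (intro mult_right_mono power_increasing) auto
    finally show ?thesis .
  qed
  hence "(\<Prod>i=1..r. real (k i) powr (3 / 2)) \<le> (sqrt (real (k r)) ^ (r - 1) * real (k r)) * (\<Prod>i\<in>{1..<r}. real (k i) powr (3 / 2))"
    unfolding ins by (simp add: mult_right_mono prod_nonneg)
  also have "\<dots> = real (k r) * (\<Prod>i\<in>{1..<r}. real (k i) powr (3 / 2) * sqrt (real (k r)))"
    by (simp add: prod.distrib)
  also have "\<dots> \<le> P r * (\<Prod>i\<in>{1..<r}. P i)"
    using last inner by (intro mult_mono prod_mono conjI) (auto intro!: prod_nonneg mult_nonneg_nonneg simp: P_def)
  also have "\<dots> = (\<Prod>i=1..r. P i)" unfolding ins by simp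
  also have "\<dots> = real (intervals_prod r k)" by (simp add: P_def intervals_prod_def)
  finally show ?thesis .
qed

text \<open>
  By the previous bound a finite partial sum is at most a constant times the \<open>r\<close>-th power of the convergent series
  of \<open>x powr (- 3 / 2)\<close>.
\<close>

lemma summable_inverse_dim_nat:
  assumes r: "r \<ge> 2"
  shows "(\<lambda>k. 1 / real (dim_nat r k)) summable_on weights r"
proof (rule nonneg_bdd_above_summable_on)
  define f where "f x = real x powr (- 3 / 2)" for x :: nat
  have sf: "summable f" unfolding f_def by (subst summable_real_powr_iff) simp
  have "(\<Sum>k\<in>X. 1 / real (dim_nat r k)) \<le> c_const r * suminf f ^ r" if X: "finite X" "X \<subseteq> weights r" for X
  proof -
    define B where "B = (\<Sum>k\<in>X. \<Sum>i=1..r. k i)"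
    have sub: "X \<subseteq> PiE {1..r} (\<lambda>_. {1..B})"
    proof
      fix k assume k: "k \<in> X"
      have "k i \<le> B" if "i \<in> {1..r}" for i
      proof -
        have "k i \<le> (\<Sum>i=1..r. k i)" using that by (intro member_le_sum) auto
        also have "\<dots> \<le> B" unfolding B_def using k X by (intro member_le_sum[of k X "\<lambda>k. \<Sum>i=1..r. k i"]) auto
        finally show ?thesis .
      qed
      moreover have "k \<in> weights r" using k X by auto
      ultimately show "k \<in> PiE {1..r} (\<lambda>_. {1..B})" by (auto simp: weights_def PiE_iff)
    qed
    have "(\<Sum>k\<in>X. 1 / real (dim_nat r k)) \<le> (\<Sum>k\<in>X. c_const r * (\<Prod>i=1..r. f (k i)))"
    proof (rule sum_mono)
      fix k assume "k \<in> X"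
      hence k: "k \<in> weights r" using X by auto
      have k1: "real (k i) > 0" if "i \<in> {1..r}" for i using k that by (force simp: weights_def PiE_iff)
      have pos: "(\<Prod>i=1..r. real (k i) powr (3 / 2)) > 0" using k1 by (intro prod_pos) auto
      have "1 / real (dim_nat r k) = c_const r * (1 / real (intervals_prod r k))" unfolding real_dim_nat[OF k] irr_dim_eq by simp
      also have "\<dots> \<le> c_const r * (1 / (\<Prod>i=1..r. real (k i) powr (3 / 2)))"
        using intervals_prod_ge[OF k r] pos c_const_pos[of r] by (intro mult_left_mono divide_left_mono mult_pos_pos) (auto intro: order_less_le_trans)
      also have "1 / (\<Prod>i=1..r. real (k i) powr (3 / 2)) = (\<Prod>i=1..r. f (k i))"
        unfolding f_def by (simp add: powr_minus_divide prod_dividef)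
      finally show "1 / real (dim_nat r k) \<le> c_const r * (\<Prod>i=1..r. f (k i))" .
    qed
    also have "\<dots> \<le> (\<Sum>k\<in>PiE {1..r} (\<lambda>_. {1..B}). c_const r * (\<Prod>i=1..r. f (k i)))"
      using c_const_pos[of r] by (intro sum_mono2 sub finite_PiE) (auto intro!: mult_nonneg_nonneg prod_nonneg simp: f_def)
    also have "\<dots> = c_const r * (\<Prod>i=1..r. \<Sum>x\<in>{1..B}. f x)"
      by (subst prod_sum_PiE) (auto simp: sum_distrib_left)
    also have "\<dots> \<le> c_const r * (\<Prod>i=1..r. suminf f)"
      using c_const_pos[of r] by (intro mult_left_mono prod_mono conjI sum_le_suminf sf sum_nonneg) (auto simp: f_def)
    finally show ?thesis by simp
  qed
  thus "bdd_above (sum (\<lambda>k. 1 / real (dim_nat r k)) ` {F. F \<subseteq> weights r \<and> finite F})"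
    by (intro bdd_aboveI[of _ "c_const r * suminf f ^ r"]) auto
qed auto

text \<open>
  A one-parameter family on which the dimension is a binomial coefficient. It supplies
  enough small dimensions for growth and aperiodicity.
\<close>

definition last_weight :: "nat \<Rightarrow> nat \<Rightarrow> nat \<Rightarrow> nat" where
  "last_weight r j = (\<lambda>i\<in>{1..r}. if i = r then j else 1)"

lemma last_weight_weights: "j \<ge> 1 \<Longrightarrow> last_weight r j \<in> weights r"
  by (auto simp: last_weight_def weights_def)

lemma last_weight_inj: "r \<ge> 1 \<Longrightarrow> last_weight r i = last_weight r j \<Longrightarrow> i = j"
  by (drule fun_cong[of _ _ r]) (simp add: last_weight_def)

lemma dim_nat_last_weight:
  assumes r: "r \<ge> 1" and j: "j \<ge> 1"
  shows "dim_nat r (last_weight r j) = (j + r - 1) choose r"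
proof -
  let ?w = "last_weight r j"
  have inner: "(\<Prod>m=l..r. \<Sum>i=l..m. ?w i) = fact (r - l) * (j + r - l)" if l: "l \<in> {1..r}" for l
  proof -
    have "{l..r} = insert r {l..<r}" using l by auto
    hence "(\<Prod>m=l..r. \<Sum>i=l..m. ?w i) = (\<Sum>i=l..r. ?w i) * (\<Prod>m\<in>{l..<r}. \<Sum>i=l..m. ?w i)" by simp
    also have "(\<Sum>i=l..r. ?w i) = j + r - l"
    proof -
      have "{l..r} = insert r {l..<r}" using l by auto
      moreover have "(\<Sum>i\<in>{l..<r}. ?w i) = (\<Sum>i\<in>{l..<r}. 1)" using l by (intro sum.cong) (auto simp: last_weight_def)
      moreover have "?w r = j" using r by (simp add: last_weight_def)
      ultimately show ?thesis using l by simp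
    qed
    also have "(\<Prod>m\<in>{l..<r}. \<Sum>i=l..m. ?w i) = (\<Prod>m\<in>{l..<r}. m + 1 - l)"
    proof (rule prod.cong[OF refl])
      fix m assume m: "m \<in> {l..<r}"
      have "(\<Sum>i=l..m. ?w i) = (\<Sum>i=l..m. 1)" using l m by (intro sum.cong) (auto simp: last_weight_def)
      thus "(\<Sum>i=l..m. ?w i) = m + 1 - l" by simp
    qed
    also have "\<dots> = (\<Prod>x=1..r - l. x)"
      by (rule prod.reindex_bij_witness[of _ "\<lambda>x. x + l - 1" "\<lambda>m. m + 1 - l"]) (use l in auto)
    finally show ?thesis by (simp add: fact_prod)
  qed
  have "intervals_prod r ?w = (\<Prod>l=1..r. fact (r - l) * (j + r - l))"
    unfolding intervals_prod_def using inner by (intro prod.cong) auto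
  also have "\<dots> = (\<Prod>l=1..r. fact (r - l)) * (\<Prod>l=1..r. j + r - l)" by (simp add: prod.distrib)
  also have "(\<Prod>l=1..r. fact (r - l)) = (\<Prod>i<r. fact i :: nat)"
    by (rule prod.reindex_bij_witness[of _ "\<lambda>i. r - i" "\<lambda>l. r - l"]) auto
  also have "(\<Prod>l=1..r. j + r - l) = (\<Prod>i=0..<r. j + i)"
    by (rule prod.reindex_bij_witness[of _ "\<lambda>i. r - i" "\<lambda>l. r - l"]) auto
  also have "(\<Prod>i=0..<r. j + i) = pochhammer j r" by (simp add: pochhammer_prod)
  finally have I: "intervals_prod r ?w = (\<Prod>i<r. fact i) * pochhammer j r" .
  have c: "c_const r = real ((\<Prod>i<r. fact i) * fact r)"
  proof -
    have "c_const r = (\<Prod>i\<in>{..r}. fact i)" unfolding c_const_def by (rule prod.mono_neutral_left) (auto simp: not_le)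
    also have "{..r} = insert r {..<r}" by auto
    finally show ?thesis by simp
  qed
  have nz: "(\<Prod>i<r. fact i :: nat) \<noteq> 0" by simp
  have "pochhammer j r = fact r * ((j + r - 1) choose r)"
  proof -
    have "real ((j + r - 1) choose r) = real (j + r - 1) gchoose r" by (rule binomial_gbinomial)
    also have "\<dots> = pochhammer (real (j + r - 1) - real r + 1) r / fact r" by (rule gbinomial_pochhammer')
    also have "real (j + r - 1) - real r + 1 = real j" using r j by (simp add: of_nat_diff)
    also have "pochhammer (real j) r = real (pochhammer j r)" by (simp add: pochhammer_of_nat)
    finally have "real (fact r * ((j + r - 1) choose r)) = real (pochhammer j r)" by simp
    thus ?thesis by (simp only: of_nat_eq_iff)
  qed
  hence "real (intervals_prod r ?w) = c_const r * real ((j + r - 1) choose r)"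
    unfolding I c by (simp only: of_nat_mult mult.assoc)
  hence "irr_dim r ?w = real ((j + r - 1) choose r)" unfolding irr_dim_eq using c_const_pos[of r] by simp
  thus ?thesis by (simp add: dim_nat_def)
qed

lemma choose_le_power:
  assumes "j \<ge> 1"
  shows "(j + r - 1) choose r \<le> j ^ r"
proof (induction r)
  case (Suc r)
  have "Suc r * ((j + Suc r - 1) choose Suc r) = (j + r) * ((j + r - 1) choose r)"
    using Suc_times_binomial_eq[of "j + r - 1" r] assms by (simp add: mult.commute)
  also have "\<dots> \<le> (j * Suc r) * j ^ r"
  proof (rule mult_mono[OF _ Suc])
    have "1 * r \<le> j * r" using assms by (rule mult_right_mono) simp
    thus "j + r \<le> j * Suc r" by simp
  qed auto
  also have "\<dots> = Suc r * j ^ Suc r" by (simp only: power_Suc mult_ac)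
  finally show ?case by (simp only: mult_le_cancel1 zero_less_Suc simp_thms)
qed simp

definition ones :: "nat \<Rightarrow> nat \<Rightarrow> nat" where "ones r = (\<lambda>i\<in>{1..r}. 1)"
text \<open>
  Halving with upward rounding stays in \<open>\<nat>\<^sup>r\<close>. It decreases the dimension by a fixed factor, except at
  the all-ones vector, and is at most \<open>2 ^ r\<close>-to-one.
\<close>

definition halve :: "nat \<Rightarrow> (nat \<Rightarrow> nat) \<Rightarrow> nat \<Rightarrow> nat" where "halve r k = (\<lambda>i\<in>{1..r}. (k i + 1) div 2)"

lemma ones_weights: "ones r \<in> weights r" by (auto simp: ones_def weights_def)

lemma halve_weights: "k \<in> weights r \<Longrightarrow> halve r k \<in> weights r"
  by (force simp: halve_def weights_def PiE_iff)

text \<open>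
  No interval sum increases, and at an index with \<open>k i \<ge> 2\<close> the interval \<open>{i}\<close> alone gains the factor
  \<open>3 / 2\<close>, the worst case being \<open>k i = 3\<close>.
\<close>

lemma dim_nat_halve:
  assumes k: "k \<in> weights r" "k \<noteq> ones r"
  shows "3 / 2 * real (dim_nat r (halve r k)) \<le> real (dim_nat r k)"
proof -
  obtain i where i: "i \<in> {1..r}" "k i \<noteq> 1"
  proof -
    have "\<exists>i\<in>{1..r}. k i \<noteq> 1"
    proof (rule ccontr)
      assume "\<not> ?thesis"
      hence "k = ones r" using k(1) by (auto simp: ones_def weights_def PiE_iff extensional_def fun_eq_iff)
      thus False using k(2) by simp
    qed
    thus thesis using that by blast
  qed
  have ki: "k i \<ge> 2" using i k(1) by (force simp: weights_def PiE_iff)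
  let ?h = "halve r k"
  have hle: "?h j \<le> k j" if "j \<in> {1..r}" for j
  proof -
    have "k j \<ge> 1" using k(1) that by (auto simp: weights_def PiE_iff)
    thus ?thesis using that by (simp add: halve_def)
  qed
  have hi: "3 / 2 * real (?h i) \<le> real (k i)"
  proof -
    have "3 * ((k i + 1) div 2) \<le> 2 * k i" using ki by presburger
    hence "3 * real ((k i + 1) div 2) \<le> 2 * real (k i)" by (metis of_nat_le_iff of_nat_mult of_nat_numeral)
    thus ?thesis using i by (simp add: halve_def)
  qed
  \<comment> \<open>The gain is attributed to the interval \<open>{i}\<close>, one factor of the double product.\<close>
  define g where "g l j = (if l = i \<and> j = i then 3 / 2 else (1::real))" for l j
  have G: "(\<Prod>l=1..r. \<Prod>j=l..r. g l j) = 3 / 2"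
  proof -
    have "(\<Prod>j=l..r. g l j) = (if l = i then 3 / 2 else 1)" if "l \<in> {1..r}" for l
      using i that by (auto simp: g_def prod.delta)
    hence "(\<Prod>l=1..r. \<Prod>j=l..r. g l j) = (\<Prod>l=1..r. if l = i then 3 / 2 else 1)" by (intro prod.cong) auto
    thus ?thesis using i by (simp add: prod.delta)
  qed
  have "3 / 2 * real (intervals_prod r ?h) = (\<Prod>l=1..r. \<Prod>j=l..r. g l j) * (\<Prod>l=1..r. \<Prod>j=l..r. real (\<Sum>i=l..j. ?h i))"
    unfolding G intervals_prod_def by (simp only: of_nat_prod)
  also have "\<dots> = (\<Prod>l=1..r. \<Prod>j=l..r. g l j * real (\<Sum>i=l..j. ?h i))"
    by (simp only: prod.distrib)
  also have "\<dots> \<le> (\<Prod>l=1..r. \<Prod>j=l..r. real (\<Sum>i=l..j. k i))"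
  proof (intro prod_mono conjI prod_nonneg)
    fix l j assume lj: "l \<in> {1..r}" "j \<in> {l..r}"
    show "0 \<le> g l j * real (\<Sum>i=l..j. ?h i)" by (simp add: g_def del: of_nat_sum)
    show "g l j * real (\<Sum>i=l..j. ?h i) \<le> real (\<Sum>i=l..j. k i)"
    proof (cases "l = i \<and> j = i")
      case True
      then show ?thesis using hi by (simp add: g_def)
    next
      case False
      have "(\<Sum>i=l..j. ?h i) \<le> (\<Sum>i=l..j. k i)" using lj by (intro sum_mono hle) auto
      moreover have "g l j = 1" using False by (auto simp: g_def)
      ultimately show ?thesis by (simp del: of_nat_sum)
    qed
  qed (auto simp: g_def sum_nonneg)
  also have "\<dots> = real (intervals_prod r k)" by (simp add: intervals_prod_def)
  finally have "3 / 2 * real (intervals_prod r ?h) \<le> real (intervals_prod r k)" .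
  hence "3 / 2 * real (intervals_prod r ?h) / c_const r \<le> real (intervals_prod r k) / c_const r"
    using c_const_pos[of r] by (intro divide_right_mono) auto
  thus ?thesis using real_dim_nat[OF k(1)] real_dim_nat[OF halve_weights[OF k(1)]] by (simp add: irr_dim_eq)
qed

text \<open>
  \<open>k\<close> is determined by its halved vector together with the set of indices with odd entries.
\<close>

lemma sum_halve_le:
  fixes f :: "(nat \<Rightarrow> nat) \<Rightarrow> real"
  assumes X: "finite X" "X \<subseteq> weights r" and f: "\<And>k. f k \<ge> 0"
  shows "(\<Sum>k\<in>X. f (halve r k)) \<le> 2 ^ r * (\<Sum>k\<in>halve r ` X. f k)"
proof -
  \<comment> \<open>The parities recover \<open>k i\<close> from \<open>(k i + 1) div 2\<close>.\<close>
  define p where "p k = {i\<in>{1..r}. odd (k i)}" for k :: "nat \<Rightarrow> nat"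
  have inj: "inj_on (\<lambda>k. (halve r k, p k)) X"
  proof (rule inj_onI)
    fix k k' assume kk: "k \<in> X" "k' \<in> X" "(halve r k, p k) = (halve r k', p k')"
    show "k = k'"
    proof
      fix i
      show "k i = k' i"
      proof (cases "i \<in> {1..r}")
        case True
        have "(k i + 1) div 2 = (k' i + 1) div 2" using kk(3) True by (auto simp: halve_def fun_eq_iff dest: spec[of _ i])
        moreover have "odd (k i) \<longleftrightarrow> odd (k' i)" using kk(3) True unfolding p_def by blast
        ultimately show ?thesis by presburger
      next
        case False
        have "k \<in> weights r" "k' \<in> weights r" using kk X by auto
        thus ?thesis using False by (auto simp: weights_def PiE_iff extensional_def)
      qed
    qed
  qed
  have "(\<Sum>k\<in>X. f (halve r k)) = (\<Sum>q\<in>(\<lambda>k. (halve r k, p k)) ` X. f (fst q))"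
    by (simp add: sum.reindex[OF inj])
  also have "\<dots> \<le> (\<Sum>q\<in>halve r ` X \<times> Pow {1..r}. f (fst q))"
    using X f by (intro sum_mono2) (auto simp: p_def)
  also have "\<dots> = (\<Sum>k\<in>halve r ` X. \<Sum>s\<in>Pow {1..r}. f k)"
    by (subst sum.cartesian_product) (simp add: case_prod_unfold)
  also have "\<dots> = 2 ^ r * (\<Sum>k\<in>halve r ` X. f k)"
    by (simp add: card_Pow sum_distrib_left)
  finally show ?thesis .
qed


lemma dim_nat_ones: "r \<ge> 1 \<Longrightarrow> dim_nat r (ones r) = 1"
proof -
  assume r: "r \<ge> 1"
  have "ones r = last_weight r 1" by (auto simp: ones_def last_weight_def)
  thus ?thesis using dim_nat_last_weight[OF r, of 1] by simp
qed

lemma summable_parts_dim_nat: "r \<ge> 2 \<Longrightarrow> summable_parts (weights r) (dim_nat r)"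
  by unfold_locales (rule dim_nat_ge_1 summable_inverse_dim_nat; assumption)+

abbreviation exp_sum_dim :: "nat \<Rightarrow> real \<Rightarrow> real" where
  "exp_sum_dim r \<equiv> summable_parts.exp_sum (weights r) (dim_nat r)"

text \<open>
  The all-ones vector is not decreased by halving; its term is at most 1, which the right-hand side
  absorbs since it contains the same vector with a term of at least \<open>exp (- (3 / 2))\<close>.
\<close>

lemma exp_sum_dim_contract:
  assumes r: "r \<ge> 2" and t: "0 < t" "t \<le> 1"
  shows "exp_sum_dim r t \<le> (exp (3 / 2) + 2 ^ r) * exp_sum_dim r (3 / 2 * t)"
proof -
  interpret summable_parts "weights r" "dim_nat r" by (rule summable_parts_dim_nat[OF r])
  let ?e = "\<lambda>t k. exp (- (t * real (dim_nat r k)))"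
  have t': "3 / 2 * t > 0" using t by simp
  have fin: "(\<Sum>k\<in>Y. ?e (3 / 2 * t) k) \<le> exp_sum_dim r (3 / 2 * t)" if "finite Y" "Y \<subseteq> weights r" for Y
    using that by (intro sum_le_exp_sum t')
  have one: "1 \<le> exp (3 / 2) * exp_sum_dim r (3 / 2 * t)"
  proof -
    have "exp (- (3 / 2)) \<le> (\<Sum>k\<in>{ones r}. ?e (3 / 2 * t) k)" using t r by (simp add: dim_nat_ones)
    also have "\<dots> \<le> exp_sum_dim r (3 / 2 * t)" by (intro fin) (auto simp: ones_weights)
    finally have "exp (3 / 2) * exp (- (3 / 2)) \<le> exp (3 / 2) * exp_sum_dim r (3 / 2 * t)" by (intro mult_left_mono) auto
    thus ?thesis by (simp flip: exp_add)
  qed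
  have "(\<Sum>k\<in>X. ?e t k) \<le> (exp (3 / 2) + 2 ^ r) * exp_sum_dim r (3 / 2 * t)"
    if X: "finite X" "X \<subseteq> weights r" for X
  proof -
    have "(\<Sum>k\<in>X. ?e t k) \<le> (\<Sum>k\<in>insert (ones r) X. ?e t k)" using X by (intro sum_mono2) auto
    also have "\<dots> = ?e t (ones r) + (\<Sum>k\<in>X - {ones r}. ?e t k)" using X by (simp add: sum.insert_remove)
    also have "?e t (ones r) \<le> 1" using t by simp
    also have "(\<Sum>k\<in>X - {ones r}. ?e t k) \<le> (\<Sum>k\<in>X - {ones r}. ?e (3 / 2 * t) (halve r k))"
    proof (rule sum_mono)
      fix k assume k: "k \<in> X - {ones r}"
      have "t * (3 / 2 * real (dim_nat r (halve r k))) \<le> t * real (dim_nat r k)"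
        using k X t by (intro mult_left_mono dim_nat_halve) auto
      thus "?e t k \<le> ?e (3 / 2 * t) (halve r k)" by (simp add: mult_ac)
    qed
    also have "\<dots> \<le> 2 ^ r * (\<Sum>k\<in>halve r ` (X - {ones r}). ?e (3 / 2 * t) k)"
      using X by (intro sum_halve_le) auto
    also have "\<dots> \<le> 2 ^ r * exp_sum_dim r (3 / 2 * t)"
      using X halve_weights by (intro mult_left_mono fin) auto
    finally show ?thesis
      using one by (simp add: distrib_right)
  qed
  thus ?thesis unfolding exp_sum_def[of t] by (rule infsum_le_finite_sums[OF exp_summable[OF t(1)]])
qed

text \<open>
  Two contractions suffice, as \<open>(3 / 2)\<^sup>2 \<ge> 2\<close>.
\<close>

lemma exp_sum_dim_doubling:
  assumes r: "r \<ge> 2"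
  shows "\<exists>K. \<forall>t. 0 < t \<longrightarrow> t \<le> 1 \<longrightarrow> exp_sum_dim r (t / 2) \<le> K * exp_sum_dim r t"
proof -
  interpret summable_parts "weights r" "dim_nat r" by (rule summable_parts_dim_nat[OF r])
  define K :: real where "K = exp (3 / 2) + 2 ^ r"
  have K: "K \<ge> 0" by (simp add: K_def)
  have "exp_sum_dim r (t / 2) \<le> K ^ 2 * exp_sum_dim r t" if t: "0 < t" "t \<le> 1" for t
  proof -
    have "exp_sum_dim r (t / 2) \<le> K * exp_sum_dim r (3 / 2 * (t / 2))"
      unfolding K_def using t by (intro exp_sum_dim_contract r) auto
    also have "\<dots> \<le> K * (K * exp_sum_dim r (3 / 2 * (3 / 2 * (t / 2))))"
      unfolding K_def using t by (intro mult_left_mono exp_sum_dim_contract r) auto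
    also have "exp_sum_dim r (3 / 2 * (3 / 2 * (t / 2))) \<le> exp_sum_dim r t"
      unfolding exp_sum_def using t by (intro infsum_mono exp_summable) (auto intro!: mult_right_mono)
    finally show ?thesis using K by (simp add: power2_eq_square mult_left_mono mult.assoc)
  qed
  thus ?thesis by blast
qed

lemma dim_nat_growth:
  assumes r: "r \<ge> 2"
  shows "\<exists>c>0. \<exists>\<beta>>0. \<forall>x\<ge>1. c * x powr \<beta> \<le> real (summable_parts.part_count (weights r) (dim_nat r) x)"
proof (rule exI[of _ "1/2"], intro conjI, simp, rule exI[of _ "1 / real r"], intro conjI allI impI)
  fix x :: real assume x: "x \<ge> 1"
  interpret summable_parts "weights r" "dim_nat r" by (rule summable_parts_dim_nat[OF r])
  define n where "n = nat \<lfloor>x powr (1 / real r)\<rfloor>"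
  have p1: "x powr (1 / real r) \<ge> 1" using x r by (simp add: ge_one_powr_ge_zero)
  have n1: "n \<ge> 1" using p1 unfolding n_def by linarith
  have n: "real n \<le> x powr (1 / real r)" "x powr (1 / real r) < real n + 1" using p1 unfolding n_def by linarith+
  have "last_weight r ` {1..n} \<subseteq> {k\<in>weights r. real (dim_nat r k) \<le> x}"
  proof (rule image_subsetI)
    fix j assume j: "j \<in> {1..n}"
    have "real (dim_nat r (last_weight r j)) \<le> real (j ^ r)"
      using dim_nat_last_weight[of r j] choose_le_power[of j r] j r by (simp only: of_nat_le_iff) simp
    also have "\<dots> \<le> (x powr (1 / real r)) ^ r" using j n by (simp add: power_mono)
    also have "\<dots> = x" using x r by (simp add: powr_powr flip: powr_realpow)
    finally show "last_weight r j \<in> {k\<in>weights r. real (dim_nat r k) \<le> x}"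
      using last_weight_weights[of j r] j by simp
  qed
  hence "card (last_weight r ` {1..n}) \<le> card {k\<in>weights r. real (dim_nat r k) \<le> x}" by (rule card_mono[OF finite_parts_le])
  moreover have "card (last_weight r ` {1..n}) = n"
    using last_weight_inj[of r] r by (subst card_image) (auto simp: inj_on_def)
  ultimately have "real n \<le> real (card {k\<in>weights r. real (dim_nat r k) \<le> x})" by simp
  moreover have "1 / 2 * x powr (1 / real r) \<le> real n" using n n1 by linarith
  ultimately show "1 / 2 * x powr (1 / real r) \<le> real (part_count x)" unfolding part_count_def by linarith
qed (use r in auto)

text \<open>
  By induction on \<open>r\<close>: the \<open>r\<close>-th difference of \<open>y \<mapsto> y choose r\<close> is 1, and each difference at most
  doubles the distance of the angles from the multiples of \<open>2 * pi\<close>.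
\<close>

lemma choose_angles_control:
  assumes "\<And>i. i \<le> r \<Longrightarrow> norm (cis (real ((y + i) choose r) * \<theta>) - 1) < \<delta>"
  shows "norm (cis \<theta> - 1) < 2 ^ r * \<delta>"
  using assms
proof (induction r arbitrary: \<delta>)
  case 0
  from "0.prems"[of 0] show ?case by simp
next
  case (Suc r)
  have "norm (cis (real ((y + i) choose r) * \<theta>) - 1) < 2 * \<delta>" if i: "i \<le> r" for i
  proof -
    define \<alpha> where "\<alpha> = real ((y + Suc i) choose Suc r) * \<theta>"
    define \<gamma> where "\<gamma> = real ((y + i) choose Suc r) * \<theta>"
    have "real ((y + i) choose r) * \<theta> = \<alpha> - \<gamma>" by (simp add: \<alpha>_def \<gamma>_def algebra_simps)
    hence "cis (real ((y + i) choose r) * \<theta>) - 1 = cis (- \<gamma>) * ((cis \<alpha> - 1) - (cis \<gamma> - 1))"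
      by (simp add: cis_mult right_diff_distrib)
    hence "norm (cis (real ((y + i) choose r) * \<theta>) - 1) = norm ((cis \<alpha> - 1) - (cis \<gamma> - 1))" by (simp only: norm_mult norm_cis mult_1)
    also have "\<dots> \<le> norm (cis \<alpha> - 1) + norm (cis \<gamma> - 1)" by (rule norm_triangle_ineq4)
    also have "\<dots> < \<delta> + \<delta>"
      using Suc.prems[of "Suc i"] Suc.prems[of i] i unfolding \<alpha>_def \<gamma>_def by (intro add_strict_mono) auto
    finally show ?thesis by simp
  qed
  from Suc.IH[OF this] show ?case by simp
qed

lemma dim_nat_aperiodic:
  assumes r: "r \<ge> 1" and G0: "finite G0"
  shows "\<exists>G \<eta>. finite G \<and> G \<subseteq> weights r - G0 \<and> \<eta> > 0 \<and>
      (\<forall>\<theta>. \<exists>k\<in>G. \<eta> * norm (cis \<theta> - 1) \<le> norm (cis (real (dim_nat r k) * \<theta>) - 1))"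
proof -
  have "finite (last_weight r -` G0)"
    using last_weight_inj[OF r] by (intro finite_vimageI G0) (auto simp: inj_def)
  then obtain J where J: "\<And>j. last_weight r j \<in> G0 \<Longrightarrow> j < J"
    using finite_nat_set_iff_bounded[of "last_weight r -` G0"] by auto
  define G where "G = (\<lambda>i. last_weight r (J + 1 + i)) ` {..r}"
  have "\<exists>k\<in>G. 1 / 2 ^ r * norm (cis \<theta> - 1) \<le> norm (cis (real (dim_nat r k) * \<theta>) - 1)" for \<theta>
  proof (rule ccontr)
    assume neg: "\<not> ?thesis"
    have "norm (cis \<theta> - 1) < 2 ^ r * (1 / 2 ^ r * norm (cis \<theta> - 1))"
    proof (rule choose_angles_control[where y = "J + r"])
      fix i assume i: "i \<le> r"
      have "J + 1 + i + r - 1 = J + r + i" by simp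
      hence d: "dim_nat r (last_weight r (J + 1 + i)) = (J + r + i) choose r"
        using dim_nat_last_weight[OF r, of "J + 1 + i"] by (simp add: add_ac)
      have "last_weight r (J + 1 + i) \<in> G" using i by (simp add: G_def)
      hence "norm (cis (real (dim_nat r (last_weight r (J + 1 + i))) * \<theta>) - 1) < 1 / 2 ^ r * norm (cis \<theta> - 1)"
        using neg by (meson not_le)
      thus "norm (cis (real ((J + r + i) choose r) * \<theta>) - 1) < 1 / 2 ^ r * norm (cis \<theta> - 1)" unfolding d .
    qed
    thus False by simp
  qed
  moreover have "G \<subseteq> weights r - G0" using J by (fastforce simp: G_def intro: last_weight_weights)
  ultimately show ?thesis by (intro exI[of _ G] exI[of _ "1 / 2 ^ r"]) (auto simp: G_def)
qed

section \<open>The number of irreducible constituents\<close>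

lemma part_system_dim_nat:
  assumes r: "r \<ge> 2"
  shows "part_system (weights r) (dim_nat r)"
proof -
  interpret summable_parts "weights r" "dim_nat r" by (rule summable_parts_dim_nat[OF r])
  show ?thesis
    by unfold_locales (rule exp_sum_dim_doubling[OF r] dim_nat_growth[OF r] dim_nat_aperiodic; use r in simp)+
qed

lemma weights_infinite: "r \<ge> 2 \<Longrightarrow> infinite (weights r)"
proof
  assume r: "r \<ge> 2" and fin: "finite (weights r)"
  have "last_weight r ` {1..} \<subseteq> weights r" using last_weight_weights by auto
  hence "finite (last_weight r ` {1::nat..})" using fin by (rule finite_subset)
  moreover have "inj_on (last_weight r) {1..}" using last_weight_inj[of r] r by (auto simp: inj_on_def)
  ultimately have "finite {1::nat..}" by (rule finite_imageD)
  thus False by (simp add: infinite_Ici)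
qed

text \<open>
  \<open>M\<close> at complex arguments.
\<close>

definition mult_limit :: "nat \<Rightarrow> complex \<Rightarrow> complex" where
  "mult_limit r z = Lim (finite_subsets_at_top (weights r)) (\<lambda>X. \<Prod>k\<in>X. 1 / (1 - z / complex_of_real (real (dim_nat r k))))"

lemma mult_limit_tendsto:
  assumes r: "r \<ge> 2" and z: "\<bar>Re z\<bar> < 1"
  shows "((\<lambda>X. \<Prod>k\<in>X. 1 / (1 - z / complex_of_real (real (dim_nat r k)))) \<longlongrightarrow> mult_limit r z) (finite_subsets_at_top (weights r))"
proof -
  have "\<exists>H. ((\<lambda>X. \<Prod>k\<in>X. 1 / (1 - z / complex_of_real (real (dim_nat r k)))) \<longlongrightarrow> H) (finite_subsets_at_top (weights r))"
    using dim_nat_ge_1[of _ r] summable_inverse_dim_nat[OF r] z by (intro prod_inverse_tendsto_finite_subsets) auto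
  then obtain H where H: "((\<lambda>X. \<Prod>k\<in>X. 1 / (1 - z / complex_of_real (real (dim_nat r k)))) \<longlongrightarrow> H) (finite_subsets_at_top (weights r))" ..
  from tendsto_Lim[OF finite_subsets_at_top_neq_bot H] have "mult_limit r z = H" by (simp only: mult_limit_def)
  thus ?thesis using H by simp
qed

lemma M_fun_eq:
  assumes r: "r \<ge> 2" and u: "-1 < u" "u < 1"
  shows "complex_of_real (M_fun r u) = mult_limit r (of_real u)"
proof -
  have lim: "((\<lambda>X. \<Prod>k\<in>X. 1 / (1 - of_real u / complex_of_real (real (dim_nat r k)))) \<longlongrightarrow> mult_limit r (of_real u)) (finite_subsets_at_top (weights r))"
    using u by (intro mult_limit_tendsto[OF r]) auto
  have "((\<lambda>X. Re (\<Prod>k\<in>X. 1 / (1 - of_real u / complex_of_real (real (dim_nat r k))))) \<longlongrightarrow> Re (mult_limit r (of_real u))) (finite_subsets_at_top (weights r))"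
    by (rule tendsto_Re[OF lim])
  moreover have eq: "(\<Prod>k\<in>X. 1 / (1 - of_real u / complex_of_real (real (dim_nat r k)))) = complex_of_real (\<Prod>k\<in>X. inverse (1 - u / irr_dim r k))"
    if "X \<subseteq> weights r" for X
  proof -
    have "(\<Prod>k\<in>X. inverse (1 - u / irr_dim r k)) = (\<Prod>k\<in>X. 1 / (1 - u / real (dim_nat r k)))"
      using that real_dim_nat by (intro prod.cong refl) (auto simp: inverse_eq_divide)
    thus ?thesis by simp
  qed
  have ev: "eventually (\<lambda>X. (\<Prod>k\<in>X. 1 / (1 - of_real u / complex_of_real (real (dim_nat r k)))) = complex_of_real (\<Prod>k\<in>X. inverse (1 - u / irr_dim r k))) (finite_subsets_at_top (weights r))"
    by (intro eventually_finite_subsets_at_top_weakI eq)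
  from tendsto_cong[OF ev] lim
  have lim2: "((\<lambda>X. complex_of_real (\<Prod>k\<in>X. inverse (1 - u / irr_dim r k))) \<longlongrightarrow> mult_limit r (of_real u)) (finite_subsets_at_top (weights r))"
    by blast
  from tendsto_Re[OF this] have re: "((\<lambda>X. \<Prod>k\<in>X. inverse (1 - u / irr_dim r k)) \<longlongrightarrow> Re (mult_limit r (of_real u))) (finite_subsets_at_top (weights r))"
    by (simp only: Re_complex_of_real)
  hence "M_fun r u = Re (mult_limit r (of_real u))"
    unfolding M_fun_def by (rule tendsto_Lim[OF finite_subsets_at_top_neq_bot])
  moreover have "mult_limit r (of_real u) = complex_of_real (Re (mult_limit r (of_real u)))"
    by (rule tendsto_unique[OF finite_subsets_at_top_neq_bot lim2]) (rule tendsto_of_real[OF re])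
  ultimately show ?thesis by simp
qed

lemma limit_law_exists:
  assumes r: "r \<ge> 2"
  shows "\<exists>\<mu>. real_distribution \<mu> \<and>
    (\<forall>z. \<bar>Re z\<bar> < 1 \<longrightarrow> has_bochner_integral \<mu> (\<lambda>x. exp (z * complex_of_real x)) (mult_limit r z))"
proof -
  interpret part_system "weights r" "dim_nat r" by (rule part_system_dim_nat[OF r])
  have "countable {k \<in> weights r. 1 / real (dim_nat r k) \<noteq> 0}"
    using summable_inverse by (rule summable_countable_real)
  moreover have "{k \<in> weights r. 1 / real (dim_nat r k) \<noteq> 0} = weights r" using dim_nat_ge_1 by force
  ultimately have "countable (weights r)" by simp
  then obtain e :: "nat \<Rightarrow> nat \<Rightarrow> nat" where e: "bij_betw e UNIV (weights r)"
    using weights_infinite[OF r] by (meson bij_betw_from_nat_into)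
  have eW: "e i \<in> weights r" for i using e by (auto simp: bij_betw_def)
  show ?thesis
  proof (rule exponential_series_law)
    show "0 \<le> 1 / real (dim_nat r (e i))" "1 / real (dim_nat r (e i)) \<le> 1" for i using dim_nat_ge_1[OF eW[of i]] by auto
    have "(\<lambda>i. 1 / real (dim_nat r (e i))) summable_on UNIV"
      using summable_inverse summable_on_reindex_bij_betw[OF e, of "\<lambda>k. 1 / real (dim_nat r k)"] by simp
    thus "summable (\<lambda>i. 1 / real (dim_nat r (e i)))" by (rule summable_on_imp_summable)
    fix z :: complex assume z: "\<bar>Re z\<bar> < 1"
    have fl: "filterlim (\<lambda>m. e ` {..<m}) (finite_subsets_at_top (weights r)) sequentially"
    proof (rule filterlim_finite_subsets_sequentially)
      fix X assume X: "finite X" "X \<subseteq> weights r"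
      define I where "I = inv_into UNIV e ` X"
      have XI: "X = e ` I" unfolding I_def using X e
        by (force simp: bij_betw_def image_image f_inv_into_f subset_iff)
      have "finite I" using X by (simp add: I_def)
      then obtain m where m: "I \<subseteq> {..<m}" using finite_nat_bounded by blast
      show "eventually (\<lambda>n. X \<subseteq> e ` {..<n}) sequentially"
        using eventually_ge_at_top[of m]
      proof eventually_elim
        case (elim n)
        have "I \<subseteq> {..<n}" using m elim by auto
        thus ?case unfolding XI by (rule image_mono)
      qed
    qed (use eW in auto)
    have "(\<Prod>k\<in>e ` {..<m}. 1 / (1 - z / complex_of_real (real (dim_nat r k)))) = (\<Prod>i<m. 1 / (1 - z * complex_of_real (1 / real (dim_nat r (e i)))))" for m
      using e by (subst prod.reindex) (auto simp: bij_betw_def inj_on_def)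
    with filterlim_compose[OF mult_limit_tendsto[OF r z] fl]
    show "(\<lambda>m. \<Prod>i<m. 1 / (1 - z * complex_of_real (1 / real (dim_nat r (e i))))) \<longlonglongrightarrow> mult_limit r z" by simp
  qed
qed

lemma sum_image_mset_eq_sum_count:
  fixes f :: "'a \<Rightarrow> nat"
  assumes "finite X" "set_mset \<rho> \<subseteq> X"
  shows "(\<Sum>k\<in>#\<rho>. f k) = (\<Sum>k\<in>X. count \<rho> k * f k)"
  using assms(2)
proof (induction \<rho>)
  case (add x \<rho>)
  have "(\<Sum>k\<in>X. count (add_mset x \<rho>) k * f k) = (\<Sum>k\<in>X. (if k = x then f k else 0) + count \<rho> k * f k)"
    by (intro sum.cong) auto
  also have "\<dots> = f x + (\<Sum>k\<in>X. count \<rho> k * f k)"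
    using add.prems assms(1) by (simp add: sum.distrib)
  finally show ?case using add by simp
qed simp

lemma rep_dim_eq:
  assumes "set_mset \<rho> \<subseteq> weights r"
  shows "rep_dim r \<rho> = real (\<Sum>k\<in>#\<rho>. dim_nat r k)"
proof -
  have "rep_dim r \<rho> = (\<Sum>k\<in>set_mset \<rho>. real (count \<rho> k * dim_nat r k))"
    unfolding rep_dim_def
  proof (rule sum.cong[OF refl])
    fix k assume "k \<in># \<rho>"
    hence "k \<in> weights r" using assms by blast
    thus "irr_dim r k * real (count \<rho> k) = real (count \<rho> k * dim_nat r k)"
      by (simp only: real_dim_nat[symmetric] of_nat_mult mult.commute)
  qed
  also have "\<dots> = real (\<Sum>k\<in>set_mset \<rho>. count \<rho> k * dim_nat r k)" by (simp only: of_nat_sum)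
  also have "(\<Sum>k\<in>set_mset \<rho>. count \<rho> k * dim_nat r k) = (\<Sum>k\<in>#\<rho>. dim_nat r k)"
    by (rule sum_image_mset_eq_sum_count[symmetric]) auto
  finally show ?thesis .
qed

lemma reps_eq: "reps r n = partitions_into (dim_nat r) (weights r) (int n)"
proof -
  have "rep_dim r \<rho> = real n \<longleftrightarrow> int (\<Sum>k\<in>#\<rho>. dim_nat r k) = int n" if "set_mset \<rho> \<subseteq> weights r" for \<rho>
    unfolding rep_dim_eq[OF that] of_nat_eq_iff ..
  thus ?thesis unfolding reps_def partitions_into_def by blast
qed

lemma N_irr_eq: "N_irr \<rho> = size \<rho>"
  by (simp add: N_irr_def size_multiset_overloaded_eq)

lemma reps_nonempty:
  assumes "r \<ge> 2"
  shows "reps r n \<noteq> {}"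
proof -
  have "replicate_mset n (ones r) \<in> reps r n"
    unfolding reps_eq partitions_into_def using assms by (auto simp: dim_nat_ones ones_weights)
  thus ?thesis by blast
qed

lemma reps_finite:
  assumes r: "r \<ge> 2"
  shows "finite (reps r n)"
proof -
  interpret part_system "weights r" "dim_nat r" by (rule part_system_dim_nat[OF r])
  let ?F = "{k\<in>weights r. real (dim_nat r k) \<le> real n}"
  have "reps r n \<subseteq> partitions_into (dim_nat r) ?F (int n)"
  proof
    fix \<rho> assume \<rho>: "\<rho> \<in> reps r n"
    hence s: "(\<Sum>k\<in>#\<rho>. dim_nat r k) = n" unfolding reps_eq partitions_into_def mem_Collect_eq of_nat_eq_iff by blast
    have "dim_nat r k \<le> n" if "k \<in># \<rho>" for k
    proof -
      have "dim_nat r k \<le> (\<Sum>k\<in>#\<rho>. dim_nat r k)" using that by (metis insert_DiffM le_add1 image_mset_add_mset sum_mset.add_mset)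
      thus ?thesis by (simp only: s)
    qed
    thus "\<rho> \<in> partitions_into (dim_nat r) ?F (int n)" using \<rho> unfolding reps_eq partitions_into_def by auto
  qed
  moreover have "finite (partitions_into (dim_nat r) ?F (int n))"
    by (rule finite_partitions_into[OF finite_parts_le]) (use dim_nat_ge_1 in blast)
  ultimately show ?thesis by (rule finite_subset)
qed

lemma char_scaled_size:
  assumes r: "r \<ge> 2"
  shows "char (distr (P r n) borel (\<lambda>\<rho>. c * real (N_irr \<rho>))) u
    = (\<Sum>\<rho>\<in>reps r n. cis (u * (c * real (size \<rho>)))) / of_nat (card (reps r n))"
proof -
  have set: "set_pmf (pmf_of_set (reps r n)) = reps r n"
    by (rule set_pmf_of_set[OF reps_nonempty[OF r] reps_finite[OF r]])
  have "char (distr (P r n) borel (\<lambda>\<rho>. c * real (N_irr \<rho>))) u = (\<integral>\<rho>. cis (u * (c * real (size \<rho>))) \<partial>P r n)"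
    unfolding char_def by (subst integral_distr) (auto simp: P_def N_irr_eq cis_conv_exp)
  also have "\<dots> = (\<Sum>\<rho>\<in>reps r n. pmf (pmf_of_set (reps r n)) \<rho> *\<^sub>R cis (u * (c * real (size \<rho>))))"
    unfolding P_def by (rule integral_measure_pmf[OF reps_finite[OF r]]) (simp add: set)
  also have "\<dots> = (\<Sum>\<rho>\<in>reps r n. cis (u * (c * real (size \<rho>))) / of_nat (card (reps r n)))"
    using reps_nonempty[OF r] reps_finite[OF r] by (intro sum.cong refl) (simp add: scaleR_conv_of_real)
  finally show ?thesis by (simp add: sum_divide_distrib)
qed

text \<open>
  Resolves the two descriptions by uniqueness: with \<open>t = s\<^sub>n\<^bsup>r (r + 1) / 2\<^esup>\<close> one has \<open>q\<^sub>n = exp (- t)\<close>, and the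
  equation for \<open>q\<^sub>n\<close> becomes \<open>mean_dim t = n\<close>.
\<close>

lemma saddle_point:
  assumes r: "r \<ge> 2" and n: "n \<ge> 1"
  shows "s_seq r n ^ (r * (r + 1) div 2) > 0"
    and "((\<lambda>k. real (dim_nat r k) * part_system.mean_mult (dim_nat r) (s_seq r n ^ (r * (r + 1) div 2)) k) has_sum real n) (weights r)"
proof -
  interpret part_system "weights r" "dim_nat r" by (rule part_system_dim_nat[OF r])
  have ne: "weights r \<noteq> {}" using ones_weights by blast
  obtain t where t: "t > 0" "mean_dim t = real n" using mean_dim_solution[of "real n"] n ne by auto
  have summand: "irr_dim r k * q powr irr_dim r k / (1 - q powr irr_dim r k) = real (dim_nat r k) * mean_mult (- ln q) k"
    if "k \<in> weights r" "0 < q" for q k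
    using real_dim_nat[OF that(1)] that(2) by (simp add: mean_mult_def weight_def powr_def mult.commute)
  have hs: "((\<lambda>k. irr_dim r k * q powr irr_dim r k / (1 - q powr irr_dim r k)) has_sum real n) (weights r) \<longleftrightarrow> - ln q = t"
    if q: "0 < q" "q < 1" for q
  proof -
    have lq: "- ln q > 0" using q by simp
    have "((\<lambda>k. irr_dim r k * q powr irr_dim r k / (1 - q powr irr_dim r k)) has_sum real n) (weights r) \<longleftrightarrow>
        ((\<lambda>k. real (dim_nat r k) * mean_mult (- ln q) k) has_sum real n) (weights r)"
      using summand q by (intro has_sum_cong) auto
    also have "\<dots> \<longleftrightarrow> mean_dim (- ln q) = mean_dim t" unfolding mean_dim_has_sum_iff[OF lq] t(2) ..
    also have "\<dots> \<longleftrightarrow> - ln q = t" using mean_dim_solution_unique[OF ne lq t(1)] by auto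
    finally show ?thesis .
  qed
  have q: "q_seq r n = exp (- t)"
    unfolding q_seq_def
  proof (rule the_equality)
    show "0 < exp (- t) \<and> exp (- t) < 1 \<and> ((\<lambda>k. irr_dim r k * exp (- t) powr irr_dim r k / (1 - exp (- t) powr irr_dim r k)) has_sum real n) (weights r)"
      using t(1) hs[of "exp (- t)"] by simp
    fix q assume A: "0 < q \<and> q < 1 \<and> ((\<lambda>k. irr_dim r k * q powr irr_dim r k / (1 - q powr irr_dim r k)) has_sum real n) (weights r)"
    hence "- ln q = t" using hs[of q] by blast
    hence "exp (- t) = exp (ln q)" by simp
    thus "q = exp (- t)" using A by simp
  qed
  define d where "d = r * (r + 1) div 2"
  have "2 * 3 \<le> r * (r + 1)" using r by (intro mult_le_mono) auto
  hence d: "d > 0" unfolding d_def by linarith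
  have s: "s_seq r n = root d t"
    unfolding s_seq_def q d_def[symmetric]
  proof (rule the_equality)
    show "0 < root d t \<and> exp (- t) = exp (- (root d t ^ d))" using t d by simp
    fix s assume "0 < s \<and> exp (- t) = exp (- (s ^ d))"
    thus "s = root d t" using d by (simp add: real_root_power_cancel)
  qed
  have st: "s_seq r n ^ d = t" unfolding s using t d by simp
  show "s_seq r n ^ (r * (r + 1) div 2) > 0" using st t by (simp add: d_def)
  have "((\<lambda>k. real (dim_nat r k) * mean_mult t k) has_sum real n) (weights r)"
    using mean_dim_has_sum_iff[OF t(1)] t(2) by simp
  thus "((\<lambda>k. real (dim_nat r k) * mean_mult (s_seq r n ^ (r * (r + 1) div 2)) k) has_sum real n) (weights r)"
    using st by (simp add: d_def)
qed

text \<open>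
  For each \<open>n\<close> the finite set of parts has to contain all dimensions up to \<open>n\<close>, all dimensions up to
  \<open>1 / t\<^sup>2\<close>, and enough others to bring the expected dimension within 1 of \<open>n\<close>. The index is shifted
  because the saddle point equation has no solution for \<open>n = 0\<close>.
\<close>

lemma char_tendsto:
  assumes r: "r \<ge> 2"
  shows "(\<lambda>n. char (distr (P r n) borel (\<lambda>\<rho>. s_seq r n ^ (r * (r + 1) div 2) * real (N_irr \<rho>))) u) \<longlonglongrightarrow> mult_limit r (\<i> * of_real u)"
proof -
  interpret part_system "weights r" "dim_nat r" by (rule part_system_dim_nat[OF r])
  have ne: "weights r \<noteq> {}" using ones_weights by blast
  define t where "t n = s_seq r (Suc n) ^ (r * (r + 1) div 2)" for n
  define m where "m n = int (Suc n)" for n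
  have t0: "t n > 0" for n unfolding t_def by (rule saddle_point(1)[OF r]) simp
  have hs: "((\<lambda>k. real (dim_nat r k) * mean_mult (t n) k) has_sum real (Suc n)) (weights r)" for n
    unfolding t_def by (rule saddle_point(2)[OF r]) simp
  have tlim: "t \<longlonglongrightarrow> 0"
  proof (rule mean_dim_solutions_tendsto_0[OF ne t0])
    have "mean_dim (t n) = real (Suc n)" for n using hs[of n] mean_dim_has_sum_iff[OF t0] by simp
    thus "filterlim (\<lambda>n. mean_dim (t n)) at_top sequentially"
      using filterlim_compose[OF filterlim_real_sequentially filterlim_Suc] by simp
  qed
  have "\<exists>X. finite X \<and> X \<subseteq> weights r \<and> {k\<in>weights r. real (dim_nat r k) \<le> max (1 / (t n)\<^sup>2) (real (Suc n))} \<subseteq> X \<and>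
      \<bar>(\<Sum>k\<in>X. real (dim_nat r k) * mean_mult (t n) k) - of_int (m n)\<bar> \<le> 1" for n
  proof -
    have "((\<lambda>X. \<Sum>k\<in>X. real (dim_nat r k) * mean_mult (t n) k) \<longlongrightarrow> real (Suc n)) (finite_subsets_at_top (weights r))"
      using hs[of n] by (simp add: has_sum_def)
    hence "eventually (\<lambda>X. dist (\<Sum>k\<in>X. real (dim_nat r k) * mean_mult (t n) k) (real (Suc n)) < 1) (finite_subsets_at_top (weights r))"
      by (rule tendstoD) simp
    then obtain X0 where X0a: "finite X0 \<and> X0 \<subseteq> weights r \<and> (\<forall>X. finite X \<and> X0 \<subseteq> X \<and> X \<subseteq> weights r \<longrightarrow>
        dist (\<Sum>k\<in>X. real (dim_nat r k) * mean_mult (t n) k) (real (Suc n)) < 1)"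
      unfolding eventually_finite_subsets_at_top by (elim exE)
    note X0 = X0a[THEN conjunct1] X0a[THEN conjunct2, THEN conjunct1] X0a[THEN conjunct2, THEN conjunct2]
    define X where "X = X0 \<union> {k\<in>weights r. real (dim_nat r k) \<le> max (1 / (t n)\<^sup>2) (real (Suc n))}"
    have X: "finite X" "X0 \<subseteq> X" "X \<subseteq> weights r" using X0 finite_parts_le by (auto simp: X_def)
    have "dist (\<Sum>k\<in>X. real (dim_nat r k) * mean_mult (t n) k) (real (Suc n)) < 1" by (rule X0(3)[rule_format]) (intro conjI X)
    hence "\<bar>(\<Sum>k\<in>X. real (dim_nat r k) * mean_mult (t n) k) - of_int (m n)\<bar> \<le> 1" by (simp add: m_def dist_real_def)
    thus ?thesis using X by (intro exI[of _ X]) (auto simp: X_def)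
  qed
  hence "\<forall>n. \<exists>X. finite X \<and> X \<subseteq> weights r \<and> {k\<in>weights r. real (dim_nat r k) \<le> max (1 / (t n)\<^sup>2) (real (Suc n))} \<subseteq> X \<and>
      \<bar>(\<Sum>k\<in>X. real (dim_nat r k) * mean_mult (t n) k) - of_int (m n)\<bar> \<le> 1" by (rule allI)
  from choice[OF this] obtain F where F_all: "\<forall>n. finite (F n) \<and> F n \<subseteq> weights r \<and>
      {k\<in>weights r. real (dim_nat r k) \<le> max (1 / (t n)\<^sup>2) (real (Suc n))} \<subseteq> F n \<and>
      \<bar>(\<Sum>k\<in>F n. real (dim_nat r k) * mean_mult (t n) k) - of_int (m n)\<bar> \<le> 1" ..
  note F = F_all[rule_format, THEN conjunct1] F_all[rule_format, THEN conjunct2, THEN conjunct1]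
    F_all[rule_format, THEN conjunct2, THEN conjunct2, THEN conjunct1]
    F_all[rule_format, THEN conjunct2, THEN conjunct2, THEN conjunct2]
  interpret part_sequence "weights r" "dim_nat r" t F m
  proof
    show "{k\<in>weights r. real (dim_nat r k) \<le> 1 / (t n)\<^sup>2} \<subseteq> F n" for n
      by (rule order_trans[OF _ F(3)]) auto
  qed (rule t0 tlim F)+
  have "(\<lambda>n. (\<Sum>\<rho>\<in>partitions_into (dim_nat r) (weights r) (m n). cis (u * (t n * real (size \<rho>)))) / of_nat (card (partitions_into (dim_nat r) (weights r) (m n))))
      \<longlonglongrightarrow> mult_limit r (\<i> * of_real u)"
  proof (rule size_char_limit)
    show "{k\<in>weights r. int (dim_nat r k) \<le> m n} \<subseteq> F n" for n
      by (rule order_trans[OF _ F(3)]) (auto simp: m_def)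
  qed (rule mult_limit_tendsto[OF r], simp)
  hence "(\<lambda>n. char (distr (P r (Suc n)) borel (\<lambda>\<rho>. s_seq r (Suc n) ^ (r * (r + 1) div 2) * real (N_irr \<rho>))) u)
      \<longlonglongrightarrow> mult_limit r (\<i> * of_real u)"
    unfolding char_scaled_size[OF r] reps_eq t_def m_def .
  thus ?thesis by (rule LIMSEQ_imp_Suc)
qed

theorem theorem7p4:
  fixes r :: nat
  assumes "r \<ge> 2"
  shows "\<exists>\<mu> :: real measure.
    real_distribution \<mu> \<and> has_mgf_on \<mu> (M_fun r) {-1<..<1} \<and>
    (\<forall>\<nu>. real_distribution \<nu> \<and> has_mgf_on \<nu> (M_fun r) {-1<..<1} \<longrightarrow> \<nu> = \<mu>) \<and>
    weak_conv_m
      (\<lambda>n. distr (P r n) borel (\<lambda>\<rho>. s_seq r n ^ (r * (r + 1) div 2) * real (N_irr \<rho>))) \<mu>"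
proof -
  obtain \<mu> where \<mu>: "real_distribution \<mu>"
    "\<And>z. \<bar>Re z\<bar> < 1 \<Longrightarrow> has_bochner_integral \<mu> (\<lambda>x. exp (z * complex_of_real x)) (mult_limit r z)"
    using limit_law_exists[OF assms] by blast
  have mgf: "has_mgf_on \<mu> (M_fun r) {-1<..<1}"
    unfolding has_mgf_on_def
  proof
    fix u :: real assume u: "u \<in> {-1<..<1}"
    have "has_bochner_integral \<mu> (\<lambda>x. exp (of_real u * complex_of_real x)) (mult_limit r (of_real u))"
      using u by (intro \<mu>(2)) auto
    hence "has_bochner_integral \<mu> (\<lambda>x. complex_of_real (exp (u * x))) (complex_of_real (M_fun r u))"
      using u M_fun_eq[OF assms, of u] by (simp flip: exp_of_real)
    thus "has_bochner_integral \<mu> (\<lambda>x. exp (u * x)) (M_fun r u)"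
      by (simp only: has_bochner_integral_iff integral_complex_of_real of_real_eq_iff complex_of_real_integrable_eq)
  qed
  have "weak_conv_m (\<lambda>n. distr (P r n) borel (\<lambda>\<rho>. s_seq r n ^ (r * (r + 1) div 2) * real (N_irr \<rho>))) \<mu>"
  proof (rule levy_continuity[OF _ \<mu>(1)])
    show "real_distribution (distr (P r n) borel (\<lambda>\<rho>. s_seq r n ^ (r * (r + 1) div 2) * real (N_irr \<rho>)))" for n
      unfolding P_def by (intro prob_space.real_distribution_distr measure_pmf.prob_space_axioms) simp
    show "(\<lambda>n. char (distr (P r n) borel (\<lambda>\<rho>. s_seq r n ^ (r * (r + 1) div 2) * real (N_irr \<rho>))) u) \<longlonglongrightarrow> char \<mu> u" for u
    proof -
      have "char \<mu> u = mult_limit r (\<i> * of_real u)"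
        using \<mu>(2)[of "\<i> * of_real u"] by (simp add: char_def has_bochner_integral_iff mult.assoc)
      thus ?thesis using char_tendsto[OF assms, of u] by simp
    qed
  qed
  thus ?thesis using \<mu>(1) mgf mgf_on_interval_unique[OF _ \<mu>(1) _ mgf] by blast
qed

end
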